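(* Let $(M,F)$ be an $n$-dimensional Finsler space, let $K$ be its dual Cartan structure, and let $V$ be the vertical bundle of the big-tangent manifold $\mathcal{T}M$ (with $y\neq 0$, $p\neq 0$), equipped with the metric $G$. Let $\mathcal{E}=y^i\frac{\partial}{\partial y^i}+p_i\frac{\partial}{\partial p_i}$ be the Liouville vector field. Then the vertical Liouville distribution $V_{\mathcal{E}}$, i.e. the $G$-orthogonal complement in $V$ of the line distribution $\{\mathcal{E}\}$ spanned by $\mathcal{E}$, is integrable, and hence defines a foliation on $\mathcal{T}M$.
   Context: Let $M$ be a smooth $n$-dimensional manifold, $TM^0$ and $T^*M^0$ its tangent and cotangent bundles with the zero sections removed. A Finsler structure on $M$ is a function $F:TM\to[0,\infty)$, smooth on $TM^0$, with $F(x,\lambda y)=\lambda F(x,y)$ for $\lambda>0$, and such that $g_{ij}(x,y)=\frac12\frac{\partial^2F^2}{\partial y^i\partial y^j}$ is positive definite on $TM^0$; $(M,F)$ is called a Finsler space. The dual Cartan structure $K:T^*M\to[0,\infty)$ is obtained from $F$ by Legendre transformation: $K(x,p)=F(x,y)$ whenever $p_i=g_{ij}(x,y)y^j$, $y\ne0$, and $K(x,0)=0$. It is smooth on $T^*M^0$, satisfies $K(x,\lambda p)=\lambda K(x,p)$ for $\lambda>0$, and $g^{*ij}(x,p)=\frac12\frac{\partial^2K^2}{\partial p_i\partial p_j}$ is positive definite on $T^*M^0$. The big-tangent manifold $\mathcal{T}M$ is the total space of $TM\oplus T^*M\to M$, a $3n$-dimensional manifold with local coordinates $(x^i,y^i,p_i)$,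 where $(x^i)$ are coordinates on $M$, $(y^i)$ vector coordinates and $(p_i)$ covector coordinates; we work on its open subset where $y\ne 0$ and $p\neq 0$. The vertical bundle $V$ (the kernel of the differential of the projection to $M$) has local frame $\{\frac{\partial}{\partial y^i},\frac{\partial}{\partial p_i}\}$. The metric $G$ on $V$ is $G(X,Y)=g_{ij}(x,y)X_1^iY_1^j+g^{*ij}(x,p)X^2_iY^2_j$ for $X=X_1^i\frac{\partial}{\partial y^i}+X^2_i\frac{\partial}{\partial p_i}$, $Y=Y_1^j\frac{\partial}{\partial y^j}+Y^2_j\frac{\partial}{\partial p_j}$ in $\Gamma(V)$. *)

theory Defs
  imports "HOL-Analysis.Analysis"
begin

section \<open>Smooth maps between Euclidean spaces\<close>

text \<open>Meant for open \<open>S\<close> in a finite-dimensional space, where continuity of all iterated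
  directional derivatives up to order \<open>k\<close> is the usual notion of a \<open>C\<^sup>k\<close> map.\<close>

primrec Ck_on :: "nat \<Rightarrow> ('a::euclidean_space \<Rightarrow> 'b::real_normed_vector) \<Rightarrow> 'a set \<Rightarrow> bool" where
  "Ck_on 0 f S \<longleftrightarrow> continuous_on S f"
| "Ck_on (Suc k) f S \<longleftrightarrow> (\<forall>x\<in>S. f differentiable (at x)) \<and>
     (\<forall>v. Ck_on k (\<lambda>x. frechet_derivative f (at x) v) S)"

definition smooth_on :: "'a::euclidean_space set \<Rightarrow> ('a \<Rightarrow> 'b::real_normed_vector) \<Rightarrow> bool" where
  "smooth_on S f \<longleftrightarrow> (\<forall>k. Ck_on k f S)"

definition partial :: "'n::finite \<Rightarrow> (real^'n \<Rightarrow> real) \<Rightarrow> real^'n \<Rightarrow> real" where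
  "partial i f u = frechet_derivative f (at u) (axis i 1)"


section \<open>Smooth manifolds\<close>

text \<open>A chart is a pair of a domain and a coordinate map, whose values outside the domain are
  irrelevant. A manifold is given by an atlas; its underlying set is the union of the chart
  domains, and its topology is the one induced by the charts.\<close>

type_synonym ('m, 'e) chart = "'m set \<times> ('m \<Rightarrow> 'e)"

definition chart_inv :: "('m, 'e) chart \<Rightarrow> 'e \<Rightarrow> 'm" where
  "chart_inv c = inv_into (fst c) (snd c)"

definition transition :: "('m, 'e) chart \<Rightarrow> ('m, 'd) chart \<Rightarrow> 'e \<Rightarrow> 'd" where
  "transition c d = snd d \<circ> chart_inv c"

definition atlas_carrier :: "('m, 'e) chart set \<Rightarrow> 'm set" where
  "atlas_carrier A = (\<Union>c\<in>A. fst c)"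

definition charts_at :: "('m, 'e) chart set \<Rightarrow> 'm \<Rightarrow> ('m, 'e) chart set" where
  "charts_at A x = {c \<in> A. x \<in> fst c}"

definition smooth_atlas :: "('m, 'e::euclidean_space) chart set \<Rightarrow> bool" where
  "smooth_atlas A \<longleftrightarrow>
     (\<forall>c\<in>A. inj_on (snd c) (fst c) \<and> open (snd c ` fst c)) \<and>
     (\<forall>c\<in>A. \<forall>d\<in>A. open (snd c ` (fst c \<inter> fst d)) \<and>
        smooth_on (snd c ` (fst c \<inter> fst d)) (transition c d))"

definition atlas_topology :: "('m, 'e::euclidean_space) chart set \<Rightarrow> 'm topology" where
  "atlas_topology A =
     topology (\<lambda>W. W \<subseteq> atlas_carrier A \<and> (\<forall>c\<in>A. open (snd c ` (fst c \<inter> W))))"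

lemma openin_atlas_topology:
  assumes "smooth_atlas A"
  shows "openin (atlas_topology A) W \<longleftrightarrow>
    W \<subseteq> atlas_carrier A \<and> (\<forall>c\<in>A. open (snd c ` (fst c \<inter> W)))"
proof -
  define P where
    "P = (\<lambda>W. W \<subseteq> atlas_carrier A \<and> (\<forall>c\<in>A. open (snd c ` (fst c \<inter> W))))"
  have PI: "P W" if "W \<subseteq> atlas_carrier A" "\<And>c. c \<in> A \<Longrightarrow> open (snd c ` (fst c \<inter> W))" for W
    unfolding P_def using that by (intro conjI ballI)
  have P1: "W \<subseteq> atlas_carrier A" if "P W" for W
    using that unfolding P_def by (rule conjunct1)
  have P2: "open (snd c ` (fst c \<inter> W))" if "P W" "c \<in> A" for W c
    using bspec[OF conjunct2[OF that(1)[unfolded P_def]] that(2)] .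
  have inj: "inj_on (snd c) (fst c)" if "c \<in> A" for c
    using assms that unfolding smooth_atlas_def by (elim conjE) (drule (1) bspec, erule conjunct1)
  have "istopology P"
    unfolding istopology_def
  proof (intro conjI allI impI)
    fix S T
    assume S: "P S" and T: "P T"
    show "P (S \<inter> T)"
    proof (rule PI)
      show "S \<inter> T \<subseteq> atlas_carrier A"
        using P1[OF S] by (rule le_infI1)
      fix c assume c: "c \<in> A"
      have "snd c ` ((fst c \<inter> S) \<inter> (fst c \<inter> T)) = snd c ` (fst c \<inter> S) \<inter> snd c ` (fst c \<inter> T)"
        by (rule inj_on_image_Int[OF inj[OF c]]) (rule Int_lower1)+
      moreover have "(fst c \<inter> S) \<inter> (fst c \<inter> T) = fst c \<inter> (S \<inter> T)"
        by blast
      ultimately show "open (snd c ` (fst c \<inter> (S \<inter> T)))"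
        using open_Int[OF P2[OF S c] P2[OF T c]] by (simp only:)
    qed
  next
    fix \<K>
    assume K: "\<forall>W\<in>\<K>. P W"
    show "P (\<Union>\<K>)"
    proof (rule PI)
      show "\<Union>\<K> \<subseteq> atlas_carrier A"
        by (rule Union_least) (rule P1, rule bspec[OF K])
      fix c assume c: "c \<in> A"
      have "snd c ` (fst c \<inter> \<Union>\<K>) = (\<Union>W\<in>\<K>. snd c ` (fst c \<inter> W))"
        by (simp only: Int_Union image_UN)
      moreover have "open (\<Union>W\<in>\<K>. snd c ` (fst c \<inter> W))"
        by (rule open_UN) (rule ballI, rule P2[OF bspec[OF K] c])
      ultimately show "open (snd c ` (fst c \<inter> \<Union>\<K>))"
        by (simp only:)
    qed
  qed
  then show ?thesis
    unfolding atlas_topology_def P_def[symmetric] by (simp only: topology_inverse') (simp only: P_def)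
qed

definition smooth_manifold :: "('m, 'e::euclidean_space) chart set \<Rightarrow> bool" where
  "smooth_manifold A \<longleftrightarrow> smooth_atlas A \<and>
     Hausdorff_space (atlas_topology A) \<and> second_countable (atlas_topology A)"

definition maximal_atlas :: "('m, 'e::euclidean_space) chart set \<Rightarrow> ('m, 'e) chart set" where
  "maximal_atlas A = {c. fst c \<subseteq> atlas_carrier A \<and> smooth_atlas (insert c A)}"

definition smooth_fun_on :: "('m, 'e::euclidean_space) chart set \<Rightarrow> 'm set \<Rightarrow> ('m \<Rightarrow> real) \<Rightarrow> bool" where
  "smooth_fun_on A W f \<longleftrightarrow> (\<forall>c\<in>A. smooth_on (snd c ` (fst c \<inter> W)) (f \<circ> chart_inv c))"


section \<open>Tangent and cotangent vectors\<close>

text \<open>A tangent or cotangent vector at \<open>x\<close> is the family of its component vectors in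
  all charts of the atlas around \<open>x\<close>, subject to the contravariant or covariant transformation law. Components at
  charts which are not around \<open>x\<close> are set to zero, so that a vector is determined by
  its components in any one chart around \<open>x\<close>.\<close>

type_synonym ('m, 'e) chart_vec = "('m, 'e) chart \<Rightarrow> 'e"

definition vec_zero :: "('m, 'e::real_vector) chart_vec" where
  "vec_zero = (\<lambda>_. 0)"

definition vec_scale :: "real \<Rightarrow> ('m, 'e::real_vector) chart_vec \<Rightarrow> ('m, 'e) chart_vec" where
  "vec_scale t v = (\<lambda>c. t *\<^sub>R v c)"

definition tangent_space ::
    "('m, 'e::euclidean_space) chart set \<Rightarrow> 'm \<Rightarrow> ('m, 'e) chart_vec set" where
  "tangent_space A x = {v.
     (\<forall>c\<in>charts_at A x. \<forall>d\<in>charts_at A x.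
        v d = frechet_derivative (transition c d) (at (snd c x)) (v c)) \<and>
     (\<forall>c. c \<notin> charts_at A x \<longrightarrow> v c = 0)}"

text \<open>The pairing \<open>p c \<bullet> v c\<close> of a covector \<open>p\<close> with a tangent vector \<open>v\<close> does not depend on
  the chart \<open>c\<close>.\<close>

definition cotangent_space ::
    "('m, 'e::euclidean_space) chart set \<Rightarrow> 'm \<Rightarrow> ('m, 'e) chart_vec set" where
  "cotangent_space A x = {p.
     (\<forall>c\<in>charts_at A x. \<forall>d\<in>charts_at A x. \<forall>w.
        p c \<bullet> w = p d \<bullet> frechet_derivative (transition c d) (at (snd c x)) w) \<and>
     (\<forall>c. c \<notin> charts_at A x \<longrightarrow> p c = 0)}"

definition tangent_chart ::
    "('m, 'e::euclidean_space) chart set \<Rightarrow> ('m, 'e) chart \<Rightarrow> ('m \<times> ('m, 'e) chart_vec, 'e \<times> 'e) chart" where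
  "tangent_chart A c =
     ({(x, y). x \<in> fst c \<and> y \<in> tangent_space A x}, \<lambda>(x, y). (snd c x, y c))"

definition cotangent_chart ::
    "('m, 'e::euclidean_space) chart set \<Rightarrow> ('m, 'e) chart \<Rightarrow> ('m \<times> ('m, 'e) chart_vec, 'e \<times> 'e) chart" where
  "cotangent_chart A c =
     ({(x, p). x \<in> fst c \<and> p \<in> cotangent_space A x}, \<lambda>(x, p). (snd c x, p c))"

definition slit_tangent_bundle ::
    "('m, 'e::euclidean_space) chart set \<Rightarrow> ('m \<times> ('m, 'e) chart_vec) set" where
  "slit_tangent_bundle A =
     {(x, y). x \<in> atlas_carrier A \<and> y \<in> tangent_space A x \<and> y \<noteq> vec_zero}"


section \<open>Distributions and foliations\<close>

definition smooth_section_on ::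
    "('m, 'e::euclidean_space) chart set \<Rightarrow> ('m \<Rightarrow> ('m, 'e) chart_vec set) \<Rightarrow> 'm set \<Rightarrow>
     ('m \<Rightarrow> ('m, 'e) chart_vec) \<Rightarrow> bool" where
  "smooth_section_on B D W X \<longleftrightarrow> (\<forall>m\<in>W. X m \<in> tangent_space B m \<and> X m \<in> D m) \<and>
     (\<forall>c\<in>B. smooth_on (snd c ` (fst c \<inter> W)) (\<lambda>u. X (chart_inv c u) c))"

definition lie_bracket ::
    "('m, 'e::euclidean_space) chart set \<Rightarrow> ('m \<Rightarrow> ('m, 'e) chart_vec) \<Rightarrow> ('m \<Rightarrow> ('m, 'e) chart_vec) \<Rightarrow>
     'm \<Rightarrow> ('m, 'e) chart_vec" where
  "lie_bracket B X Y m = (\<lambda>c. if c \<in> charts_at B m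
     then frechet_derivative (\<lambda>u. Y (chart_inv c u) c) (at (snd c m)) (X m c)
        - frechet_derivative (\<lambda>u. X (chart_inv c u) c) (at (snd c m)) (Y m c)
     else 0)"

definition involutive ::
    "('m, 'e::euclidean_space) chart set \<Rightarrow> ('m \<Rightarrow> ('m, 'e) chart_vec set) \<Rightarrow> bool" where
  "involutive B D \<longleftrightarrow> (\<forall>W X Y. openin (atlas_topology B) W \<and>
     smooth_section_on B D W X \<and> smooth_section_on B D W Y \<longrightarrow>
     (\<forall>m\<in>W. lie_bracket B X Y m \<in> D m))"

text \<open>A foliated atlas whose plaques are the slices of the charts parallel to the fixed
  \<open>k\<close>-dimensional subspace \<open>L\<close> of the model space (usually \<open>\<real>\<^sup>k \<times> 0\<close>). The last condition says that,
  locally, transition maps send plaques into plaques, i.e. have the form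
  \<open>(a, b) \<mapsto> (h\<^sub>1(a, b), h\<^sub>2(b))\<close> with respect to a splitting \<open>L \<oplus> L'\<close>.\<close>

definition foliation ::
    "('m, 'e::euclidean_space) chart set \<Rightarrow> nat \<Rightarrow> 'e set \<Rightarrow> ('m, 'e) chart set \<Rightarrow> bool" where
  "foliation B k L \<F> \<longleftrightarrow> subspace L \<and> dim L = k \<and>
     \<F> \<subseteq> maximal_atlas B \<and> atlas_carrier \<F> = atlas_carrier B \<and>
     (\<forall>c\<in>\<F>. \<forall>d\<in>\<F>. \<forall>m\<in>fst c \<inter> fst d.
        \<exists>U. open U \<and> snd c m \<in> U \<and> U \<subseteq> snd c ` (fst c \<inter> fst d) \<and>
          (\<forall>u\<in>U. \<forall>u'\<in>U. u - u' \<in> L \<longrightarrow> transition c d u - transition c d u' \<in> L))"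

text \<open>\<open>D\<close> is the tangent distribution of the foliation: at each point of a foliated chart, \<open>D\<close>
  consists of the vectors tangent to the plaque.\<close>

definition tangent_to_foliation ::
    "('m, 'e::euclidean_space) chart set \<Rightarrow> 'e set \<Rightarrow> ('m, 'e) chart set \<Rightarrow>
     ('m \<Rightarrow> ('m, 'e) chart_vec set) \<Rightarrow> bool" where
  "tangent_to_foliation B L \<F> D \<longleftrightarrow> (\<forall>c\<in>\<F>. \<forall>m\<in>fst c.
     D m = {v \<in> tangent_space B m. \<forall>b\<in>charts_at B m.
              frechet_derivative (transition b c) (at (snd b m)) (v b) \<in> L})"

definition defines_foliation ::
    "('m, 'e::euclidean_space) chart set \<Rightarrow> nat \<Rightarrow> ('m \<Rightarrow> ('m, 'e) chart_vec set) \<Rightarrow> bool" where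
  "defines_foliation B k D \<longleftrightarrow> (\<exists>L \<F>. foliation B k L \<F> \<and> tangent_to_foliation B L \<F> D)"


section \<open>Finsler and dual Cartan structures\<close>

text \<open>The matrix \<open>1/2 \<partial>\<^sup>2f\<^sup>2/\<partial>\<eta>\<^sup>i\<partial>\<eta>\<^sup>j\<close> at the point \<open>(u, \<eta>)\<close>.\<close>

definition fibre_metric :: "((real^'n) \<times> (real^'n) \<Rightarrow> real) \<Rightarrow> real^'n \<Rightarrow> real^'n \<Rightarrow> real^'n^'n" where
  "fibre_metric f u \<eta> = (\<chi> i j. 1/2 * partial i (partial j (\<lambda>\<zeta>. (f (u, \<zeta>))\<^sup>2)) \<eta>)"

text \<open>The components \<open>g\<^sub>i\<^sub>j(x, y)\<close> and \<open>g\<^sup>*\<^sup>i\<^sup>j(x, p)\<close> in the chart \<open>c\<close> of \<open>M\<close>.\<close>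

definition finsler_metric ::
    "('m, real^'n) chart set \<Rightarrow> ('m \<times> ('m, real^'n) chart_vec \<Rightarrow> real) \<Rightarrow> ('m, real^'n) chart \<Rightarrow>
     'm \<Rightarrow> ('m, real^'n) chart_vec \<Rightarrow> real^'n^'n" where
  "finsler_metric A F c x y = fibre_metric (F \<circ> chart_inv (tangent_chart A c)) (snd c x) (y c)"

definition cartan_metric ::
    "('m, real^'n) chart set \<Rightarrow> ('m \<times> ('m, real^'n) chart_vec \<Rightarrow> real) \<Rightarrow> ('m, real^'n) chart \<Rightarrow>
     'm \<Rightarrow> ('m, real^'n) chart_vec \<Rightarrow> real^'n^'n" where
  "cartan_metric A K c x p = fibre_metric (K \<circ> chart_inv (cotangent_chart A c)) (snd c x) (p c)"

definition finsler_structure ::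
    "('m, real^'n) chart set \<Rightarrow> ('m \<times> ('m, real^'n) chart_vec \<Rightarrow> real) \<Rightarrow> bool" where
  "finsler_structure A F \<longleftrightarrow>
     (\<forall>x\<in>atlas_carrier A. \<forall>y\<in>tangent_space A x. F (x, y) \<ge> 0) \<and>
     smooth_fun_on (tangent_chart A ` A) (slit_tangent_bundle A) F \<and>
     (\<forall>x\<in>atlas_carrier A. \<forall>y\<in>tangent_space A x. \<forall>t>0. F (x, vec_scale t y) = t * F (x, y)) \<and>
     (\<forall>(x, y)\<in>slit_tangent_bundle A. \<forall>c\<in>charts_at A x. \<forall>w. w \<noteq> 0 \<longrightarrow>
        (\<Sum>i\<in>UNIV. \<Sum>j\<in>UNIV. finsler_metric A F c x y $ i $ j * w $ i * w $ j) > 0)"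

text \<open>Only the Legendre relation is required; smoothness and homogeneity of \<open>K\<close> and positivity
  of its vertical Hessian follow from the corresponding properties of \<open>F\<close>.\<close>

definition dual_cartan_structure ::
    "('m, real^'n) chart set \<Rightarrow> ('m \<times> ('m, real^'n) chart_vec \<Rightarrow> real) \<Rightarrow>
     ('m \<times> ('m, real^'n) chart_vec \<Rightarrow> real) \<Rightarrow> bool" where
  "dual_cartan_structure A F K \<longleftrightarrow>
     (\<forall>x\<in>atlas_carrier A. \<forall>p\<in>cotangent_space A x. K (x, p) \<ge> 0) \<and>
     (\<forall>x\<in>atlas_carrier A. K (x, vec_zero) = 0) \<and>
     (\<forall>x\<in>atlas_carrier A. \<forall>y\<in>tangent_space A x. \<forall>p\<in>cotangent_space A x. y \<noteq> vec_zero \<longrightarrow>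
        (\<forall>c\<in>charts_at A x. \<forall>i. p c $ i = (\<Sum>j\<in>UNIV. finsler_metric A F c x y $ i $ j * y c $ j)) \<longrightarrow>
        K (x, p) = F (x, y))"


section \<open>The big-tangent manifold\<close>

text \<open>Only the open part \<open>y \<noteq> 0\<close>, \<open>p \<noteq> 0\<close> of the total space of \<open>TM \<oplus> T\<^sup>*M\<close> is considered.\<close>

type_synonym ('m, 'n) big_point = "'m \<times> ('m, real^'n) chart_vec \<times> ('m, real^'n) chart_vec"

type_synonym 'n big_coord = "(real^'n) \<times> (real^'n) \<times> (real^'n)"

type_synonym ('m, 'n) big_vec = "(('m, 'n) big_point, 'n big_coord) chart_vec"

definition big_tangent_chart ::
    "('m, real^'n) chart set \<Rightarrow> ('m, real^'n) chart \<Rightarrow> (('m, 'n) big_point, 'n big_coord) chart" where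
  "big_tangent_chart A c =
     ({(x, y, p). x \<in> fst c \<and> y \<in> tangent_space A x \<and> p \<in> cotangent_space A x \<and>
                  y \<noteq> vec_zero \<and> p \<noteq> vec_zero},
      \<lambda>(x, y, p). (snd c x, y c, p c))"

definition big_tangent_atlas ::
    "('m, real^'n) chart set \<Rightarrow> (('m, 'n) big_point, 'n big_coord) chart set" where
  "big_tangent_atlas A = big_tangent_chart A ` A"

text \<open>The bundle projection is \<open>fst\<close>; the condition says that its differential kills \<open>X\<close>.\<close>

definition vertical_bundle ::
    "('m, real^'n) chart set \<Rightarrow> ('m, 'n) big_point \<Rightarrow> ('m, 'n) big_vec set" where
  "vertical_bundle A m = {X \<in> tangent_space (big_tangent_atlas A) m.
     \<forall>b\<in>charts_at (big_tangent_atlas A) m. \<forall>c\<in>charts_at A (fst m).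
       frechet_derivative (snd c \<circ> fst \<circ> chart_inv b) (at (snd b m)) (X b) = 0}"

text \<open>The metric \<open>G\<close> is computed in an arbitrarily chosen chart of \<open>M\<close> around the base point; on
  vertical vectors the value does not depend on this choice.\<close>

definition big_metric ::
    "('m, real^'n) chart set \<Rightarrow> ('m \<times> ('m, real^'n) chart_vec \<Rightarrow> real) \<Rightarrow>
     ('m \<times> ('m, real^'n) chart_vec \<Rightarrow> real) \<Rightarrow> ('m, 'n) big_point \<Rightarrow>
     ('m, 'n) big_vec \<Rightarrow> ('m, 'n) big_vec \<Rightarrow> real" where
  "big_metric A F K = (\<lambda>(x, y, p) X Y.
     let c = (SOME c. c \<in> charts_at A x);
         (_, X1, X2) = X (big_tangent_chart A c);
         (_, Y1, Y2) = Y (big_tangent_chart A c)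
     in (\<Sum>i\<in>UNIV. \<Sum>j\<in>UNIV. finsler_metric A F c x y $ i $ j * X1 $ i * Y1 $ j)
      + (\<Sum>i\<in>UNIV. \<Sum>j\<in>UNIV. cartan_metric A K c x p $ i $ j * X2 $ i * Y2 $ j))"

text \<open>In a chart \<open>b\<close> the point \<open>m\<close> has coordinates \<open>snd b m = (x\<^sup>i, y\<^sup>i, p\<^sub>i)\<close>, and \<open>y\<^sup>i\<partial>/\<partial>y\<^sup>i + p\<^sub>i\<partial>/\<partial>p\<^sub>i\<close>
  has components \<open>(0, y\<^sup>i, p\<^sub>i)\<close>.\<close>

definition liouville_field ::
    "('m, real^'n) chart set \<Rightarrow> ('m, 'n) big_point \<Rightarrow> ('m, 'n) big_vec" where
  "liouville_field A m =
     (\<lambda>b. if b \<in> charts_at (big_tangent_atlas A) m then (0, snd (snd b m)) else 0)"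

definition liouville_line ::
    "('m, real^'n) chart set \<Rightarrow> ('m, 'n) big_point \<Rightarrow> ('m, 'n) big_vec set" where
  "liouville_line A m = range (\<lambda>t. vec_scale t (liouville_field A m))"

definition vertical_liouville_distribution ::
    "('m, real^'n) chart set \<Rightarrow> ('m \<times> ('m, real^'n) chart_vec \<Rightarrow> real) \<Rightarrow>
     ('m \<times> ('m, real^'n) chart_vec \<Rightarrow> real) \<Rightarrow> ('m, 'n) big_point \<Rightarrow> ('m, 'n) big_vec set" where
  "vertical_liouville_distribution A F K m =
     {X \<in> vertical_bundle A m. \<forall>Y\<in>liouville_line A m. big_metric A F K m X Y = 0}"

end

theory Submission
  imports Defs
begin

text \<open>
  The idea is that the vertical Liouville distribution is the kernel, inside the vertical bundle, of
  the differential of the function \<open>F\<^sup>2 + K\<^sup>2\<close>. Indeed Euler's relation for the homogeneous function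
  \<open>F\<^sup>2\<close> gives \<open>g\<^sub>i\<^sub>j X\<^sup>i y\<^sup>j = 1/2 X\<^sup>i \<partial>F\<^sup>2/\<partial>y\<^sup>i\<close>, and likewise for \<open>K\<close>, so that
  \<open>G(X, \<E>) = 1/2 X(F\<^sup>2 + K\<^sup>2)\<close> for vertical \<open>X\<close> (\<open>big_metric_liouville\<close>). Hence the distribution is
  the common kernel of the differentials of the base point and of \<open>F\<^sup>2 + K\<^sup>2\<close> (\<open>distribution_iff\<close>), and
  its leaves are the level sets of \<open>F\<^sup>2 + K\<^sup>2\<close> in the fibres.

  Involutivity follows because the bracket of two fields annihilating a function annihilates it too.
  Both this and the fact that the bracket is a tangent vector come from the symmetry of second
  derivatives (\<open>bracket_related\<close>).

  Foliated charts can be written down explicitly. The Liouville field is radial and transverse to the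
  level sets, so a point of the fibre is determined by its ray and the value of \<open>F\<^sup>2 + K\<^sup>2\<close>. Affine
  coordinates on the rays together with this value straighten the level sets; the inverse change of
  coordinates only takes a square root, thanks to homogeneity (locale \<open>cone_function\<close>).

  What needs work is the regularity of \<open>K\<close>, which is given by the Legendre relation alone. In a
  fibre the Legendre transformation \<open>y \<mapsto> g(y)y\<close> is the gradient of \<open>F\<^sup>2/2\<close>. It is injective by convexity
  (\<open>legendre_inj\<close>), surjective onto the nonzero covectors by maximizing \<open>p(y)/F(y)\<close>
  (\<open>legendre_surj\<close>), and its inverse is smooth since the Hessian is invertible
  (\<open>smooth_legendre_inv\<close>). Therefore \<open>K\<close> is smooth and homogeneous in charts
  (\<open>fibre_homogeneous_K_chart\<close>).
\<close>

section \<open>Calculus of smooth maps\<close>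

text \<open>The congruence rule appears as a hypothesis because its own proof, by induction on the order,
  applies this introduction rule with the congruence rule of one order less.\<close>

lemma Ck_on_SucI:
  fixes f :: "'a::euclidean_space \<Rightarrow> 'b::real_normed_vector"
  assumes "\<And>x. x \<in> S \<Longrightarrow> (f has_derivative f' x) (at x)"
    and "\<And>v. Ck_on k (\<lambda>x. f' x v) S" and "open S"
    and cong: "\<And>g h :: 'a \<Rightarrow> 'b. (\<And>x. x \<in> S \<Longrightarrow> g x = h x) \<Longrightarrow> Ck_on k g S \<Longrightarrow> Ck_on k h S"
  shows "Ck_on (Suc k) f S"
  unfolding Ck_on.simps
proof (intro conjI ballI allI)
  show "f differentiable (at x)" if "x \<in> S" for x
    using assms(1)[OF that] by (rule differentiableI)
  show "Ck_on k (\<lambda>x. frechet_derivative f (at x) v) S" for v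
    by (rule cong[OF _ assms(2)[of v]]) (simp add: frechet_derivative_at[OF assms(1), symmetric])
qed

lemma Ck_on_cong:
  assumes "open S" "\<And>x. x \<in> S \<Longrightarrow> f x = g x" "Ck_on k f S"
  shows "Ck_on k g S"
  using assms(2,3)
proof (induction k arbitrary: f g)
  case 0
  then show ?case by (auto intro: continuous_on_cong[THEN iffD1, rotated 2])
next
  case (Suc k)
  have D: "(g has_derivative frechet_derivative f (at x)) (at x)" if "x \<in> S" for x
    by (rule has_derivative_transform_within_open[where f = f, OF _ \<open>open S\<close> that Suc.prems(1)])
       (use Suc.prems that in \<open>auto simp: frechet_derivative_works\<close>)
  show ?case
    by (rule Ck_on_SucI[OF D _ \<open>open S\<close> Suc.IH]) (use Suc.prems in auto)
qed

lemmas Ck_on_SucI' = Ck_on_SucI[OF _ _ _ Ck_on_cong]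

lemma Ck_on_Suc_has_derivative:
  "Ck_on (Suc k) f S \<Longrightarrow> x \<in> S \<Longrightarrow> (f has_derivative frechet_derivative f (at x)) (at x)"
  by (simp add: frechet_derivative_works)

lemma Ck_on_SucD: "Ck_on (Suc k) f S \<Longrightarrow> Ck_on k f S"
proof (induction k arbitrary: f)
  case 0
  then show ?case
    by (auto intro!: continuous_at_imp_continuous_on differentiable_imp_continuous_within)
next
  case (Suc k)
  then show ?case using Ck_on.simps(2) by metis
qed

lemma Ck_on_subset: "Ck_on k f S \<Longrightarrow> T \<subseteq> S \<Longrightarrow> Ck_on k f T"
  by (induction k arbitrary: f) (auto intro: continuous_on_subset)

lemma Ck_on_const: "Ck_on k (\<lambda>x. c) S"
  by (induction k arbitrary: c) simp_all

lemma Ck_on_linear: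
  assumes "bounded_linear L" "open S"
  shows "Ck_on k L S"
proof (cases k)
  case 0
  then show ?thesis using assms by (simp add: linear_continuous_on)
next
  case (Suc l)
  show ?thesis unfolding Suc
    by (rule Ck_on_SucI'[OF bounded_linear_imp_has_derivative Ck_on_const])
       (use assms in auto)
qed

lemma Ck_on_linear_compose:
  assumes "bounded_linear L" "Ck_on k f S" "open S"
  shows "Ck_on k (\<lambda>x. L (f x)) S"
  using assms(2)
proof (induction k arbitrary: f)
  case 0
  then show ?case using assms(1) bounded_linear.continuous_on by auto
next
  case (Suc k)
  show ?case
    by (rule Ck_on_SucI'[OF bounded_linear.has_derivative[OF assms(1)
          Ck_on_Suc_has_derivative[OF Suc.prems]] Suc.IH])
       (use Suc.prems assms in auto)
qed

lemma Ck_on_add: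
  assumes "Ck_on k f S" "Ck_on k g S" "open S"
  shows "Ck_on k (\<lambda>x. f x + g x) S"
  using assms(1,2)
proof (induction k arbitrary: f g)
  case 0
  then show ?case by (auto intro: continuous_on_add)
next
  case (Suc k)
  show ?case
    by (rule Ck_on_SucI'[OF has_derivative_add[OF Ck_on_Suc_has_derivative[OF Suc.prems(1)]
          Ck_on_Suc_has_derivative[OF Suc.prems(2)]] Suc.IH])
       (use Suc.prems assms in auto)
qed

lemma Ck_on_bilinear:
  assumes B: "bounded_bilinear B" and "Ck_on k f S" "Ck_on k g S" and S: "open S"
  shows "Ck_on k (\<lambda>x. B (f x) (g x)) S"
  using assms(2,3)
proof (induction k arbitrary: f g)
  case 0
  then show ?case using bounded_bilinear.continuous_on[OF B] by auto
next
  case (Suc k)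
  show ?case
  proof (rule Ck_on_SucI'[OF bounded_bilinear.FDERIV[OF B
          Ck_on_Suc_has_derivative[OF Suc.prems(1)]
          Ck_on_Suc_has_derivative[OF Suc.prems(2)]]])
    show "Ck_on k (\<lambda>x. B (f x) (frechet_derivative g (at x) v) +
        B (frechet_derivative f (at x) v) (g x)) S" for v
      using Suc.prems Ck_on_SucD[OF Suc.prems(1)] Ck_on_SucD[OF Suc.prems(2)]
      by (intro Ck_on_add Suc.IH S) auto
  qed (use S in auto)
qed

lemma Ck_on_sum:
  assumes "\<And>i. i \<in> I \<Longrightarrow> Ck_on k (f i) S" "open S"
  shows "Ck_on k (\<lambda>x. \<Sum>i\<in>I. f i x) S"
  using assms(1)
  by (induction I rule: infinite_finite_induct) (auto intro: Ck_on_const Ck_on_add \<open>open S\<close>)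

text \<open>The chain rule expresses a directional derivative of \<open>g \<circ> f\<close> through the derivatives of \<open>g\<close>
  in the moving direction \<open>Df(x)v\<close>. Expanding this direction in the standard basis turns it
  into a sum of products of functions that are \<open>C\<^sup>k\<close> by induction.\<close>

lemma Ck_on_compose:
  fixes f :: "'a::euclidean_space \<Rightarrow> 'b::euclidean_space" and g :: "'b \<Rightarrow> 'c::real_normed_vector"
  assumes "Ck_on k f S" "Ck_on k g T" "f ` S \<subseteq> T" "open S" "open T"
  shows "Ck_on k (\<lambda>x. g (f x)) S"
  using assms(1,2)
proof (induction k arbitrary: g)
  case 0
  then show ?case using assms(3) by (auto intro: continuous_on_compose2)
next
  case (Suc k)
  have fT: "f x \<in> T" if "x \<in> S" for x using that assms(3) by auto
  have D: "((\<lambda>x. g (f x)) has_derivative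
      (\<lambda>v. \<Sum>b\<in>Basis. (frechet_derivative f (at x) v \<bullet> b) *\<^sub>R frechet_derivative g (at (f x)) b)) (at x)"
    if "x \<in> S" for x
  proof -
    have lin: "linear (frechet_derivative g (at (f x)))"
      using Suc.prems fT[OF that] by (auto intro: linear_frechet_derivative)
    have "((\<lambda>x. g (f x)) has_derivative
        (\<lambda>v. frechet_derivative g (at (f x)) (frechet_derivative f (at x) v))) (at x)"
      using has_derivative_compose[OF Ck_on_Suc_has_derivative[OF Suc.prems(1) that]
        Ck_on_Suc_has_derivative[OF Suc.prems(2) fT[OF that]]] .
    moreover have "frechet_derivative g (at (f x)) (frechet_derivative f (at x) v) =
      (\<Sum>b\<in>Basis. (frechet_derivative f (at x) v \<bullet> b) *\<^sub>R frechet_derivative g (at (f x)) b)" for v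
      by (subst euclidean_representation[symmetric, of "frechet_derivative f (at x) v"])
         (simp add: linear_sum[OF lin] linear_cmul[OF lin])
    ultimately show ?thesis by simp
  qed
  show ?case
  proof (rule Ck_on_SucI'[OF D _ \<open>open S\<close> \<open>open S\<close>])
    fix v
    have 1: "Ck_on k (\<lambda>x. frechet_derivative g (at (f x)) b) S" for b
      by (rule Suc.IH) (use Suc.prems Ck_on_SucD in auto)
    have 2: "Ck_on k (\<lambda>x. frechet_derivative f (at x) v \<bullet> b) S" for b
      by (rule Ck_on_linear_compose[OF bounded_linear_inner_left _ \<open>open S\<close>]) (use Suc.prems in auto)
    show "Ck_on k (\<lambda>x. \<Sum>b\<in>Basis. (frechet_derivative f (at x) v \<bullet> b) *\<^sub>R
        frechet_derivative g (at (f x)) b) S"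
      by (intro Ck_on_sum Ck_on_bilinear[OF bounded_bilinear_scaleR] 1 2 \<open>open S\<close>)
  qed auto
qed

lemma smooth_onI: "(\<And>k. Ck_on k f S) \<Longrightarrow> smooth_on S f"
  by (simp add: smooth_on_def)

lemma smooth_onD: "smooth_on S f \<Longrightarrow> Ck_on k f S"
  by (simp add: smooth_on_def)

lemma smooth_on_cong: "open S \<Longrightarrow> (\<And>x. x \<in> S \<Longrightarrow> f x = g x) \<Longrightarrow> smooth_on S f \<Longrightarrow> smooth_on S g"
  unfolding smooth_on_def using Ck_on_cong by blast

lemma smooth_on_subset: "smooth_on S f \<Longrightarrow> T \<subseteq> S \<Longrightarrow> smooth_on T f"
  unfolding smooth_on_def using Ck_on_subset by blast

lemma smooth_on_has_derivative:
  "smooth_on S f \<Longrightarrow> x \<in> S \<Longrightarrow> (f has_derivative frechet_derivative f (at x)) (at x)"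
  by (rule Ck_on_Suc_has_derivative[OF smooth_onD])

lemma smooth_on_differentiable: "smooth_on S f \<Longrightarrow> x \<in> S \<Longrightarrow> f differentiable (at x)"
  by (blast intro: differentiableI smooth_on_has_derivative)

lemma smooth_on_linear_derivative: "smooth_on S f \<Longrightarrow> x \<in> S \<Longrightarrow> linear (frechet_derivative f (at x))"
  by (blast intro: linear_frechet_derivative smooth_on_differentiable)

lemma smooth_on_derivative: "smooth_on S f \<Longrightarrow> smooth_on S (\<lambda>x. frechet_derivative f (at x) v)"
  unfolding smooth_on_def using Ck_on.simps(2) by blast

lemma smooth_on_continuous: "smooth_on S f \<Longrightarrow> continuous_on S f"
  using smooth_onD[of S f 0] by simp

lemma smooth_on_const: "smooth_on S (\<lambda>x. c)"
  by (simp add: smooth_on_def Ck_on_const)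

lemma smooth_on_linear: "bounded_linear L \<Longrightarrow> open S \<Longrightarrow> smooth_on S L"
  by (simp add: smooth_on_def Ck_on_linear)

lemma smooth_on_linear_compose:
  "bounded_linear L \<Longrightarrow> smooth_on S f \<Longrightarrow> open S \<Longrightarrow> smooth_on S (\<lambda>x. L (f x))"
  by (simp add: smooth_on_def Ck_on_linear_compose)

lemma smooth_on_add:
  "smooth_on S f \<Longrightarrow> smooth_on S g \<Longrightarrow> open S \<Longrightarrow> smooth_on S (\<lambda>x. f x + g x)"
  by (simp add: smooth_on_def Ck_on_add)

lemma smooth_on_bilinear:
  "bounded_bilinear B \<Longrightarrow> smooth_on S f \<Longrightarrow> smooth_on S g \<Longrightarrow> open S \<Longrightarrow> smooth_on S (\<lambda>x. B (f x) (g x))"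
  by (simp add: smooth_on_def Ck_on_bilinear)

lemmas smooth_on_mult = smooth_on_bilinear[OF bounded_bilinear_mult]
lemmas smooth_on_scaleR = smooth_on_bilinear[OF bounded_bilinear_scaleR]
lemmas smooth_on_inner = smooth_on_bilinear[OF bounded_bilinear_inner]

lemma smooth_on_sum:
  "(\<And>i. i \<in> I \<Longrightarrow> smooth_on S (f i)) \<Longrightarrow> open S \<Longrightarrow> smooth_on S (\<lambda>x. \<Sum>i\<in>I. f i x)"
  by (simp add: smooth_on_def Ck_on_sum)

lemma smooth_on_prod:
  fixes f :: "'i \<Rightarrow> 'a::euclidean_space \<Rightarrow> real"
  assumes "\<And>i. i \<in> I \<Longrightarrow> smooth_on S (f i)" "open S"
  shows "smooth_on S (\<lambda>x. \<Prod>i\<in>I. f i x)"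
  using assms(1)
  by (induction I rule: infinite_finite_induct)
     (auto intro: smooth_on_const smooth_on_mult \<open>open S\<close>)

lemma smooth_on_compose:
  fixes f :: "'a::euclidean_space \<Rightarrow> 'b::euclidean_space"
  assumes "smooth_on T g" "smooth_on S f" "f ` S \<subseteq> T" "open S" "open T"
  shows "smooth_on S (\<lambda>x. g (f x))"
  using assms Ck_on_compose unfolding smooth_on_def by blast

lemma smooth_on_minus: "smooth_on S f \<Longrightarrow> open S \<Longrightarrow> smooth_on S (\<lambda>x. - f x)"
  by (rule smooth_on_linear_compose[OF bounded_linear_minus[OF bounded_linear_ident]])

lemma smooth_on_diff:
  "smooth_on S f \<Longrightarrow> smooth_on S g \<Longrightarrow> open S \<Longrightarrow> smooth_on S (\<lambda>x. f x - g x)"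
  using smooth_on_add[of S f "\<lambda>x. - g x"] smooth_on_minus[of S g] by simp

lemma smooth_on_Pair:
  fixes f :: "'a::euclidean_space \<Rightarrow> 'b::euclidean_space" and g :: "'a \<Rightarrow> 'c::euclidean_space"
  assumes "smooth_on S f" "smooth_on S g" "open S"
  shows "smooth_on S (\<lambda>x. (f x, g x))"
proof -
  have "smooth_on S (\<lambda>x. (f x, 0) + (0, g x))"
    by (intro smooth_on_add smooth_on_linear_compose[of "\<lambda>y. (y, 0)"]
        smooth_on_linear_compose[of "\<lambda>y. (0, y)"] bounded_linear_Pair bounded_linear_ident
        bounded_linear_zero assms)
  then show ?thesis by simp
qed

lemma smooth_on_fst: "smooth_on S f \<Longrightarrow> open S \<Longrightarrow> smooth_on S (\<lambda>x. fst (f x))"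
  by (rule smooth_on_linear_compose[OF bounded_linear_fst])

lemma smooth_on_snd: "smooth_on S f \<Longrightarrow> open S \<Longrightarrow> smooth_on S (\<lambda>x. snd (f x))"
  by (rule smooth_on_linear_compose[OF bounded_linear_snd])

lemma smooth_on_nth: "smooth_on S f \<Longrightarrow> open S \<Longrightarrow> smooth_on S (\<lambda>x. f x $ i)"
  by (rule smooth_on_linear_compose[OF bounded_linear_vec_nth])

lemma smooth_on_componentwise:
  fixes f :: "'a::euclidean_space \<Rightarrow> 'b::euclidean_space"
  assumes "\<And>b. b \<in> Basis \<Longrightarrow> smooth_on S (\<lambda>x. f x \<bullet> b)" "open S"
  shows "smooth_on S f"
proof -
  have "smooth_on S (\<lambda>x. \<Sum>b\<in>Basis. (f x \<bullet> b) *\<^sub>R b)"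
    by (intro smooth_on_sum smooth_on_scaleR assms smooth_on_const)
  then show ?thesis by (simp add: euclidean_representation)
qed

lemma smooth_on_vec_lambda:
  fixes f :: "'n::finite \<Rightarrow> 'a::euclidean_space \<Rightarrow> real"
  assumes "\<And>i. smooth_on S (f i)" "open S"
  shows "smooth_on S (\<lambda>x. \<chi> i. f i x)"
  by (rule smooth_on_componentwise) (auto simp: Basis_vec_def inner_axis assms)

lemma smooth_on_inverse: "smooth_on {x. x \<noteq> 0} (inverse :: real \<Rightarrow> real)"
proof (rule smooth_onI)
  have op: "open {x::real. x \<noteq> 0}" by (simp add: open_Collect_neq)
  show "Ck_on k (inverse :: real \<Rightarrow> real) {x. x \<noteq> 0}" for k
  proof (induction k)
    case 0
    then show ?case by (auto intro!: continuous_intros)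
  next
    case (Suc k)
    have "Ck_on k (\<lambda>x::real. (inverse x * inverse x) * (- v)) {x. x \<noteq> 0}" for v
      by (intro Ck_on_bilinear[OF bounded_bilinear_mult] Suc Ck_on_const op)
    then show ?case
      by (intro Ck_on_SucI'[where f' = "\<lambda>x v. (inverse x * inverse x) * (- v)"] op)
         (auto intro!: derivative_eq_intros simp: fun_eq_iff)
  qed
qed

lemma smooth_on_divide:
  fixes f g :: "'a::euclidean_space \<Rightarrow> real"
  assumes "smooth_on S f" "smooth_on S g" "open S" "\<And>x. x \<in> S \<Longrightarrow> g x \<noteq> 0"
  shows "smooth_on S (\<lambda>x. f x / g x)"
  unfolding divide_inverse
  by (intro smooth_on_mult smooth_on_compose[OF smooth_on_inverse] assms)
     (use assms in \<open>auto simp: open_Collect_neq\<close>)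

lemma smooth_on_sqrt: "smooth_on {0<..} sqrt"
proof (rule smooth_onI)
  show "Ck_on k sqrt {0<..}" for k
  proof (induction k)
    case 0
    then show ?case by (auto intro!: continuous_intros)
  next
    case (Suc k)
    have "Ck_on k (\<lambda>x. inverse (sqrt x)) {0<..}"
      by (rule Ck_on_compose[OF Suc smooth_onD[OF smooth_on_inverse]])
         (auto simp: open_Collect_neq)
    then have "Ck_on k (\<lambda>x. inverse (sqrt x) * (v / 2)) {0<..}" for v
      by (intro Ck_on_bilinear[OF bounded_bilinear_mult] Ck_on_const) auto
    then show ?case
      by (intro Ck_on_SucI'[where f' = "\<lambda>x v. inverse (sqrt x) * (v / 2)"])
         (auto intro!: derivative_eq_intros simp: fun_eq_iff field_simps)
  qed
qed

lemma smooth_on_ident: "open S \<Longrightarrow> smooth_on S (\<lambda>x. x)"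
  by (rule smooth_on_linear[OF bounded_linear_ident])

text \<open>The definition of smoothness speaks of derivatives in a fixed direction. The coordinates of the
  tangent bundle require them in a direction that moves with the point.\<close>

lemma smooth_on_derivative_apply:
  fixes f :: "'a::euclidean_space \<Rightarrow> 'b::real_normed_vector" and w :: "'c::euclidean_space \<Rightarrow> 'a"
  assumes f: "smooth_on T f" and u: "smooth_on S u" "u ` S \<subseteq> T" and w: "smooth_on S w"
    and op: "open S" "open T"
  shows "smooth_on S (\<lambda>x. frechet_derivative f (at (u x)) (w x))"
proof (rule smooth_on_cong[OF op(1)])
  show "smooth_on S (\<lambda>x. \<Sum>b\<in>Basis. (w x \<bullet> b) *\<^sub>R frechet_derivative f (at (u x)) b)"
    by (intro smooth_on_sum smooth_on_scaleR smooth_on_inner w smooth_on_const op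
        smooth_on_compose[OF smooth_on_derivative[OF f] u])
  fix x assume "x \<in> S"
  then have lin: "linear (frechet_derivative f (at (u x)))"
    using f u by (auto intro: smooth_on_linear_derivative)
  show "(\<Sum>b\<in>Basis. (w x \<bullet> b) *\<^sub>R frechet_derivative f (at (u x)) b) =
      frechet_derivative f (at (u x)) (w x)"
    by (subst (2) euclidean_representation[symmetric, of "w x"])
       (simp add: linear_sum[OF lin] linear_cmul[OF lin])
qed

lemma frechet_derivative_eq:
  "(f has_derivative f') (at x) \<Longrightarrow> frechet_derivative f (at x) = f'"
  by (rule frechet_derivative_at[symmetric])

lemma frechet_derivative_cong:
  assumes "open S" "x \<in> S" "\<And>z. z \<in> S \<Longrightarrow> f z = g z" "f differentiable (at x)"
  shows "frechet_derivative f (at x) = frechet_derivative g (at x)"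
  by (rule frechet_derivative_at,
      rule has_derivative_transform_within_open[OF _ assms(1,2,3)])
     (use assms(4) frechet_derivative_works in auto)

section \<open>Symmetry of second derivatives and the bracket under smooth maps\<close>

lemma has_derivative_along_line:
  fixes f :: "'a::real_normed_vector \<Rightarrow> real"
  assumes "f differentiable (at (p + s *\<^sub>R v))"
  shows "((\<lambda>s. f (p + s *\<^sub>R v)) has_real_derivative
    frechet_derivative f (at (p + s *\<^sub>R v)) v) (at s)"
proof -
  have "((\<lambda>s. p + s *\<^sub>R v) has_derivative (\<lambda>t. t *\<^sub>R v)) (at s)"
    by (auto intro!: derivative_eq_intros)
  from has_derivative_compose[OF this] assms
  have "((\<lambda>s. f (p + s *\<^sub>R v)) has_derivative
      (\<lambda>t. frechet_derivative f (at (p + s *\<^sub>R v)) (t *\<^sub>R v))) (at s)"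
    by (simp add: frechet_derivative_works)
  moreover have "frechet_derivative f (at (p + s *\<^sub>R v)) (t *\<^sub>R v) =
      t * frechet_derivative f (at (p + s *\<^sub>R v)) v" for t
    using linear_cmul[OF linear_frechet_derivative[OF assms]] by simp
  ultimately show ?thesis
    by (simp add: has_field_derivative_def mult_commute_abs)
qed

text \<open>The second difference is symmetric in \<open>v\<close> and \<open>w\<close>. Applying the mean value theorem first in the
  direction \<open>v\<close> and then in the direction \<open>w\<close> turns it into a mixed derivative, in an order of
  differentiation that depends on which direction comes first.\<close>

lemma second_difference_mean_value:
  fixes f :: "'a::euclidean_space \<Rightarrow> real"
  assumes f: "smooth_on (ball x r) f" and d: "0 < d" "d * (norm v + norm w) < r"
  shows "\<exists>z\<in>ball x r.
    f (x + d *\<^sub>R v + d *\<^sub>R w) - f (x + d *\<^sub>R v) - f (x + d *\<^sub>R w) + f x =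
    d * d * frechet_derivative (\<lambda>z. frechet_derivative f (at z) v) (at z) w"
proof -
  define a where "a = (\<lambda>z. frechet_derivative f (at z) v)"
  have a: "smooth_on (ball x r) a"
    unfolding a_def by (rule smooth_on_derivative[OF f])
  have near: "norm (s *\<^sub>R v + t *\<^sub>R w) \<le> d * (norm v + norm w)"
    if "0 \<le> s" "s \<le> d" "0 \<le> t" "t \<le> d" for s t
    using norm_triangle_ineq[of "s *\<^sub>R v" "t *\<^sub>R w"] that
      mult_right_mono[of s d "norm v"] mult_right_mono[of t d "norm w"]
    by (simp add: distrib_left)
  have inb: "x + s *\<^sub>R v + t *\<^sub>R w \<in> ball x r"
    if "0 \<le> s" "s \<le> d" "0 \<le> t" "t \<le> d" for s t
  proof -
    have "dist x (x + s *\<^sub>R v + t *\<^sub>R w) = norm (s *\<^sub>R v + t *\<^sub>R w)"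
      unfolding dist_norm by (metis add.assoc add_diff_cancel_left' norm_minus_commute)
    then show ?thesis using near[OF that] d(2) by simp
  qed
  have fd: "f differentiable (at (x + t *\<^sub>R w + s *\<^sub>R v))"
    if "0 \<le> s" "s \<le> d" "0 \<le> t" "t \<le> d" for s t
    using smooth_on_differentiable[OF f inb[OF that]] by (simp add: algebra_simps)
  have "((\<lambda>s. f (x + d *\<^sub>R w + s *\<^sub>R v) - f (x + 0 *\<^sub>R w + s *\<^sub>R v)) has_real_derivative
      (a (x + d *\<^sub>R w + s *\<^sub>R v) - a (x + 0 *\<^sub>R w + s *\<^sub>R v))) (at s)" if "0 \<le> s" "s \<le> d" for s
    unfolding a_def
    by (intro DERIV_diff has_derivative_along_line fd) (use that d(1) in auto)
  from MVT2[OF d(1), of "\<lambda>s. f (x + d *\<^sub>R w + s *\<^sub>R v) - f (x + 0 *\<^sub>R w + s *\<^sub>R v)", OF this]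
  obtain s where s: "0 < s" "s < d" and
    1: "f (x + d *\<^sub>R w + d *\<^sub>R v) - f (x + d *\<^sub>R v) - (f (x + d *\<^sub>R w) - f x) =
      d * (a (x + d *\<^sub>R w + s *\<^sub>R v) - a (x + s *\<^sub>R v))"
    by auto
  have "((\<lambda>t. a (x + s *\<^sub>R v + t *\<^sub>R w)) has_real_derivative
      frechet_derivative a (at (x + s *\<^sub>R v + t *\<^sub>R w)) w) (at t)" if "0 \<le> t" "t \<le> d" for t
    by (intro has_derivative_along_line smooth_on_differentiable[OF a inb]) (use that s in auto)
  from MVT2[OF d(1), of "\<lambda>t. a (x + s *\<^sub>R v + t *\<^sub>R w)", OF this]
  obtain t where t: "0 < t" "t < d" and
    2: "a (x + s *\<^sub>R v + d *\<^sub>R w) - a (x + s *\<^sub>R v) =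
      d * frechet_derivative a (at (x + s *\<^sub>R v + t *\<^sub>R w)) w"
    by auto
  show ?thesis
  proof (rule bexI)
    show "f (x + d *\<^sub>R v + d *\<^sub>R w) - f (x + d *\<^sub>R v) - f (x + d *\<^sub>R w) + f x =
      d * d * frechet_derivative (\<lambda>z. frechet_derivative f (at z) v) (at (x + s *\<^sub>R v + t *\<^sub>R w)) w"
      using 1 2 unfolding a_def[symmetric] by (simp add: algebra_simps)
  qed (use inb s t in auto)
qed

text \<open>If the two mixed derivatives differed at \<open>x\<close>, they would differ by continuity at all pairs of
  points of a small ball. But the two ways to evaluate one second difference provide two points
  of the ball at which they agree.\<close>

lemma symmetric_second_derivative_real:
  fixes f :: "'a::euclidean_space \<Rightarrow> real"
  assumes f: "smooth_on S f" and S: "open S" "x \<in> S"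
  shows "frechet_derivative (\<lambda>z. frechet_derivative f (at z) v) (at x) w =
    frechet_derivative (\<lambda>z. frechet_derivative f (at z) w) (at x) v"
proof (rule ccontr)
  define P where "P = (\<lambda>v w z. frechet_derivative (\<lambda>z. frechet_derivative f (at z) v) (at z) w)"
  have P: "continuous_on S (P v w)" for v w
    unfolding P_def by (intro smooth_on_continuous smooth_on_derivative f)
  assume neq: "\<not> ?thesis"
  define e where "e = \<bar>P v w x - P w v x\<bar> / 2"
  have e: "e > 0" using neq by (simp add: e_def P_def)
  have tend: "\<forall>\<^sub>F z in nhds x. dist (P v w z) (P v w x) < e" for v w
    using P[of v w] S e by (metis continuous_on_eq_continuous_at isCont_def tendsto_at_iff_tendsto_nhds tendstoD)
  have "\<forall>\<^sub>F z in nhds x. z \<in> S \<and> dist (P v w z) (P v w x) < e \<and> dist (P w v z) (P w v x) < e"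
    by (intro eventually_conj tend eventually_nhds_in_open S)
  then obtain r where r: "r > 0" and rz: "\<And>z. z \<in> ball x r \<Longrightarrow>
      z \<in> S \<and> dist (P v w z) (P v w x) < e \<and> dist (P w v z) (P w v x) < e"
    unfolding eventually_nhds_metric by (auto simp: dist_commute)
  have fb: "smooth_on (ball x r) f"
    using f by (rule smooth_on_subset) (use rz in auto)
  define d where "d = r / (2 * (norm v + norm w + 1))"
  have N: "norm v + norm w + 1 > 0" by (simp add: add_nonneg_pos)
  have d: "d > 0" using r N by (simp add: d_def)
  have "d * (norm v + norm w) < d * (2 * (norm v + norm w + 1))"
    by (rule mult_strict_left_mono[OF _ d]) (use N in \<open>simp add: distrib_left\<close>)
  also have "\<dots> = r" using N by (simp add: d_def)
  finally have dr: "d * (norm v + norm w) < r" "d * (norm w + norm v) < r"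
    by (simp_all add: add.commute)
  obtain z where z: "z \<in> ball x r" "f (x + d *\<^sub>R v + d *\<^sub>R w) - f (x + d *\<^sub>R v) - f (x + d *\<^sub>R w) + f x =
      d * d * P v w z"
    using second_difference_mean_value[OF fb d dr(1)] unfolding P_def by auto
  obtain z' where z': "z' \<in> ball x r" "f (x + d *\<^sub>R w + d *\<^sub>R v) - f (x + d *\<^sub>R w) - f (x + d *\<^sub>R v) + f x =
      d * d * P w v z'"
    using second_difference_mean_value[OF fb d dr(2)] unfolding P_def by auto
  have "d * d * P v w z = d * d * P w v z'"
    using z(2) z'(2) by (simp add: algebra_simps)
  then have "P v w z = P w v z'" using d by simp
  moreover have "dist (P v w z) (P v w x) < e" "dist (P w v z') (P w v x) < e"
    using rz z(1) z'(1) by auto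
  ultimately have "dist (P v w x) (P w v x) < 2 * e"
    using dist_triangle_half_r[of "P v w z" "P v w x" "2 * e" "P w v x"] by simp
  then show False unfolding e_def dist_real_def by simp
qed

lemma frechet_derivative_inner_right:
  assumes "f differentiable (at x)"
  shows "frechet_derivative (\<lambda>z. f z \<bullet> b) (at x) v = frechet_derivative f (at x) v \<bullet> b"
  using has_derivative_inner_left[OF assms[unfolded frechet_derivative_works], of b]
  by (simp add: frechet_derivative_eq)

lemma symmetric_second_derivative:
  fixes f :: "'a::euclidean_space \<Rightarrow> 'b::euclidean_space"
  assumes f: "smooth_on S f" and S: "open S" "x \<in> S"
  shows "frechet_derivative (\<lambda>z. frechet_derivative f (at z) v) (at x) w =
    frechet_derivative (\<lambda>z. frechet_derivative f (at z) w) (at x) v"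
proof (rule euclidean_eqI)
  fix b :: 'b assume "b \<in> Basis"
  have c: "frechet_derivative (\<lambda>z. frechet_derivative f (at z) v) (at x) w \<bullet> b =
      frechet_derivative (\<lambda>z. frechet_derivative (\<lambda>z. f z \<bullet> b) (at z) v) (at x) w" for v w
  proof -
    have dd: "(\<lambda>z. frechet_derivative f (at z) v) differentiable (at x)"
      by (rule smooth_on_differentiable[OF smooth_on_derivative[OF f] S(2)])
    have "frechet_derivative f (at z) v \<bullet> b = frechet_derivative (\<lambda>z. f z \<bullet> b) (at z) v"
      if "z \<in> S" for z
      by (simp add: frechet_derivative_inner_right[OF smooth_on_differentiable[OF f that]])
    then have "frechet_derivative (\<lambda>z. frechet_derivative f (at z) v \<bullet> b) (at x) =
        frechet_derivative (\<lambda>z. frechet_derivative (\<lambda>z. f z \<bullet> b) (at z) v) (at x)"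
      using dd by (intro frechet_derivative_cong[OF S]) (auto intro: differentiable_inner)
    then show ?thesis by (simp add: frechet_derivative_inner_right[OF dd, symmetric])
  qed
  show "frechet_derivative (\<lambda>z. frechet_derivative f (at z) v) (at x) w \<bullet> b =
      frechet_derivative (\<lambda>z. frechet_derivative f (at z) w) (at x) v \<bullet> b"
    unfolding c
    by (intro symmetric_second_derivative_real[OF _ S] smooth_on_inner f smooth_on_const S)
qed

text \<open>Differentiating \<open>X'(T z) = DT(z)(X z)\<close> produces the second derivative of \<open>T\<close>, which is
  symmetric and therefore cancels in the bracket. Applied to a transition map this gives the
  transformation law of the bracket; applied to a function \<open>T\<close> and \<open>X' = Y' = 0\<close> it says
  that the bracket of two fields which annihilate \<open>T\<close> annihilates \<open>T\<close>.\<close>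

lemma bracket_related:
  fixes T :: "'a::euclidean_space \<Rightarrow> 'b::euclidean_space"
  assumes T: "smooth_on S T" and S: "open S" "u \<in> S"
    and X: "X differentiable (at u)" and Y: "Y differentiable (at u)"
    and X': "X' differentiable (at (T u))" and Y': "Y' differentiable (at (T u))"
    and TX: "\<And>z. z \<in> S \<Longrightarrow> X' (T z) = frechet_derivative T (at z) (X z)"
    and TY: "\<And>z. z \<in> S \<Longrightarrow> Y' (T z) = frechet_derivative T (at z) (Y z)"
  shows "frechet_derivative Y' (at (T u)) (X' (T u)) - frechet_derivative X' (at (T u)) (Y' (T u)) =
    frechet_derivative T (at u) (frechet_derivative Y (at u) (X u) - frechet_derivative X (at u) (Y u))"
proof -
  define Q where "Q = (\<lambda>h k. frechet_derivative (\<lambda>z. frechet_derivative T (at z) k) (at u) h)"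
  have Q_sym: "Q h k = Q k h" for h k
    unfolding Q_def by (rule symmetric_second_derivative[OF T S])
  have Q_lin: "linear (\<lambda>h. Q h k)" for k
    unfolding Q_def by (rule smooth_on_linear_derivative[OF smooth_on_derivative[OF T] S(2)])
  have DT: "linear (frechet_derivative T (at z))" if "z \<in> S" for z
    using smooth_on_linear_derivative[OF T that] .
  have key: "frechet_derivative X' (at (T u)) (frechet_derivative T (at u) h) =
      Q h (X u) + frechet_derivative T (at u) (frechet_derivative X (at u) h)"
    if X: "X differentiable (at u)" and X': "X' differentiable (at (T u))"
      and TX: "\<And>z. z \<in> S \<Longrightarrow> X' (T z) = frechet_derivative T (at z) (X z)"
    for h and X :: "'a \<Rightarrow> 'a" and X' :: "'b \<Rightarrow> 'b"
  proof -
    have 1: "((\<lambda>z. X' (T z)) has_derivative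
        (\<lambda>h. frechet_derivative X' (at (T u)) (frechet_derivative T (at u) h))) (at u)"
      using has_derivative_compose[OF smooth_on_has_derivative[OF T S(2)]
        X'[unfolded frechet_derivative_works]] .
    have "((\<lambda>z. \<Sum>b\<in>Basis. (X z \<bullet> b) *\<^sub>R frechet_derivative T (at z) b) has_derivative
        (\<lambda>h. \<Sum>b\<in>Basis. (X u \<bullet> b) *\<^sub>R Q h b +
          (frechet_derivative X (at u) h \<bullet> b) *\<^sub>R frechet_derivative T (at u) b)) (at u)"
      unfolding Q_def
      by (intro has_derivative_sum has_derivative_scaleR has_derivative_inner_left
          X[unfolded frechet_derivative_works]
          smooth_on_has_derivative[OF smooth_on_derivative[OF T] S(2)])
    moreover have "(\<Sum>b\<in>Basis. (X z \<bullet> b) *\<^sub>R frechet_derivative T (at z) b) = X' (T z)"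
      if "z \<in> S" for z
      unfolding TX[OF that]
      by (subst (2) euclidean_representation[symmetric, of "X z"])
         (simp add: linear_sum[OF DT[OF that]] linear_cmul[OF DT[OF that]])
    ultimately have 2: "((\<lambda>z. X' (T z)) has_derivative
        (\<lambda>h. \<Sum>b\<in>Basis. (X u \<bullet> b) *\<^sub>R Q h b +
          (frechet_derivative X (at u) h \<bullet> b) *\<^sub>R frechet_derivative T (at u) b)) (at u)"
      by (rule has_derivative_transform_within_open[OF _ S])
    have "(\<Sum>b\<in>Basis. (X u \<bullet> b) *\<^sub>R Q h b) = Q h (X u)"
      unfolding Q_sym[of h]
      by (subst (2) euclidean_representation[symmetric, of "X u"])
         (simp add: linear_sum[OF Q_lin] linear_cmul[OF Q_lin])
    moreover have "(\<Sum>b\<in>Basis. (frechet_derivative X (at u) h \<bullet> b) *\<^sub>R frechet_derivative T (at u) b) =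
        frechet_derivative T (at u) (frechet_derivative X (at u) h)"
      by (subst (2) euclidean_representation[symmetric, of "frechet_derivative X (at u) h"])
         (simp add: linear_sum[OF DT[OF S(2)]] linear_cmul[OF DT[OF S(2)]])
    ultimately show ?thesis
      using fun_cong[OF has_derivative_unique[OF 1 2], of h] by (simp add: sum.distrib)
  qed
  show ?thesis
    using key[OF X X' TX, of "Y u"] key[OF Y Y' TY, of "X u"] Q_sym[of "X u" "Y u"]
      TX[OF S(2)] TY[OF S(2)] linear_diff[OF DT[OF S(2)]]
    by simp
qed

text \<open>Invariance of domain makes the image open and the inverse map differentiable as soon as the
  derivative is invertible. Then \<open>D(f\<inverse>) = (Df)\<inverse> \<circ> f\<inverse>\<close>, so that \<open>f\<inverse>\<close> gains one order of
  smoothness at a time.\<close>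

lemma smooth_on_inverse_map:
  fixes f :: "'a::euclidean_space \<Rightarrow> 'a"
  assumes f: "smooth_on S f" and S: "open S" and g: "\<And>x. x \<in> S \<Longrightarrow> g (f x) = x"
    and I: "\<And>x w. x \<in> S \<Longrightarrow> frechet_derivative f (at x) (I x w) = w"
    and I_smooth: "\<And>w. smooth_on S (\<lambda>x. I x w)"
  shows "smooth_on (f ` S) g"
proof (rule smooth_onI)
  have "inj_on f S" using g by (metis inj_onI)
  then have op: "open (f ` S)"
    by (rule invariance_of_domain[OF smooth_on_continuous[OF f] S])
  have D: "(g has_derivative I (g z)) (at z)" if "z \<in> f ` S" for z
  proof -
    from that obtain x where x: "x \<in> S" "z = f x" by auto
    have "(g has_derivative I x) (at (f x))"
      by (rule has_derivative_inverse_strong[OF S x(1) smooth_on_continuous[OF f] g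
            smooth_on_has_derivative[OF f x(1)]])
         (use I x in \<open>auto simp: fun_eq_iff\<close>)
    then show ?thesis using x g by simp
  qed
  have gS: "g ` f ` S \<subseteq> S" using g by auto
  show "Ck_on k g (f ` S)" for k
  proof (induction k)
    case 0
    show ?case
      using has_derivative_continuous[OF D] by (auto intro!: continuous_at_imp_continuous_on)
  next
    case (Suc k)
    show ?case
      by (rule Ck_on_SucI'[OF D Ck_on_compose[OF Suc smooth_onD[OF I_smooth] gS op S] op op])
         auto
  qed
qed

section \<open>Homogeneous functions in coordinates\<close>

lemma smooth_on_det:
  fixes M :: "'a::euclidean_space \<Rightarrow> real^'n^'n"
  assumes "\<And>i j. smooth_on S (\<lambda>x. M x $ i $ j)" "open S"
  shows "smooth_on S (\<lambda>x. det (M x))"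
  unfolding det_def
  by (intro smooth_on_sum smooth_on_mult smooth_on_const smooth_on_prod assms)

lemma has_derivative_unique_apply:
  "(f has_derivative F) (at x) \<Longrightarrow> (f has_derivative G) (at x) \<Longrightarrow> F w = G w"
  by (metis has_derivative_unique)

lemma frechet_derivative_axis_expansion:
  fixes h :: "(real^'n) \<times> (real^'n) \<Rightarrow> real"
  assumes "h differentiable (at x)"
  shows "frechet_derivative h (at x) (0, w) = (\<Sum>j\<in>UNIV. w $ j * frechet_derivative h (at x) (0, axis j 1))"
proof -
  have lin: "linear (frechet_derivative h (at x))"
    by (rule linear_frechet_derivative[OF assms])
  have expand: "(0, w) = (\<Sum>j\<in>UNIV. w $ j *\<^sub>R (0 :: real^'n, axis j 1 :: real^'n))"
    using basis_expansion[of w] by (simp add: sum_prod scalar_mult_eq_scaleR)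
  show ?thesis
    unfolding expand by (simp only: linear_sum[OF lin] linear_cmul[OF lin] real_scaleR_def)
qed

lemma has_derivative_slice:
  assumes "h differentiable (at (u, v))"
  shows "((\<lambda>\<zeta>. h (u, \<zeta>)) has_derivative (\<lambda>w. frechet_derivative h (at (u, v)) (0, w))) (at v)"
proof -
  have "((\<lambda>\<zeta>. (u, \<zeta>)) has_derivative (\<lambda>w. (0, w))) (at v)"
    by (intro has_derivative_Pair has_derivative_const has_derivative_ident)
  from has_derivative_compose[OF this assms[unfolded frechet_derivative_works]]
  show ?thesis by simp
qed

lemma partial_slice:
  assumes "h differentiable (at (u, v))"
  shows "partial i (\<lambda>\<zeta>. h (u, \<zeta>)) v = frechet_derivative h (at (u, v)) (0, axis i 1)"
  unfolding partial_def frechet_derivative_eq[OF has_derivative_slice[OF assms]] ..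

text \<open>The coordinate form shared by a Finsler structure and a Cartan structure, so that Euler's
  relations serve both. The zero section is removed because smoothness fails there.\<close>

locale fibre_homogeneous =
  fixes U :: "(real^'n) set" and f :: "(real^'n) \<times> (real^'n) \<Rightarrow> real"
  assumes open_base: "open U"
    and smooth: "smooth_on (U \<times> - {0}) f"
    and homogeneous: "u \<in> U \<Longrightarrow> v \<noteq> 0 \<Longrightarrow> t > 0 \<Longrightarrow> f (u, t *\<^sub>R v) = t * f (u, v)"
begin

definition energy :: "(real^'n) \<times> (real^'n) \<Rightarrow> real" where
  "energy z = (f z)\<^sup>2"

definition grad :: "'n \<Rightarrow> (real^'n) \<times> (real^'n) \<Rightarrow> real" where
  "grad i z = frechet_derivative energy (at z) (0, axis i 1)"

text \<open>The fibre gradient of \<open>f\<^sup>2/2\<close>.\<close>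

definition legendre :: "(real^'n) \<times> (real^'n) \<Rightarrow> real^'n" where
  "legendre z = (\<chi> i. grad i z / 2)"

lemma open_slit: "open (U \<times> (- {0} :: (real^'n) set))"
  by (intro open_Times open_base) (simp add: open_Compl)

lemma smooth_energy: "smooth_on (U \<times> - {0}) energy"
  unfolding energy_def power2_eq_square by (intro smooth_on_mult smooth open_slit)

lemma smooth_grad: "smooth_on (U \<times> - {0}) (grad i)"
  unfolding grad_def by (rule smooth_on_derivative[OF smooth_energy])

lemma smooth_legendre: "smooth_on (U \<times> - {0}) legendre"
  unfolding legendre_def divide_inverse
  by (intro smooth_on_vec_lambda smooth_on_mult smooth_on_const smooth_grad open_slit)

lemma differentiable_energy: "u \<in> U \<Longrightarrow> v \<noteq> 0 \<Longrightarrow> energy differentiable (at (u, v))"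
  by (rule smooth_on_differentiable[OF smooth_energy]) simp

lemma differentiable_grad: "u \<in> U \<Longrightarrow> v \<noteq> 0 \<Longrightarrow> grad i differentiable (at (u, v))"
  by (rule smooth_on_differentiable[OF smooth_grad]) simp

lemma energy_derivative:
  "u \<in> U \<Longrightarrow> v \<noteq> 0 \<Longrightarrow>
    frechet_derivative energy (at (u, v)) (0, w) = (\<Sum>j\<in>UNIV. w $ j * grad j (u, v))"
  unfolding grad_def by (rule frechet_derivative_axis_expansion[OF differentiable_energy])

lemma inner_legendre:
  "u \<in> U \<Longrightarrow> v \<noteq> 0 \<Longrightarrow> w \<bullet> legendre (u, v) = frechet_derivative energy (at (u, v)) (0, w) / 2"
  by (simp add: energy_derivative legendre_def inner_vec_def sum_divide_distrib)

lemma energy_homogeneous: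
  "u \<in> U \<Longrightarrow> v \<noteq> 0 \<Longrightarrow> t > 0 \<Longrightarrow> energy (u, t *\<^sub>R v) = t\<^sup>2 * energy (u, v)"
  by (simp add: energy_def homogeneous power_mult_distrib)

lemma euler_energy:
  assumes "u \<in> U" "v \<noteq> 0"
  shows "frechet_derivative energy (at (u, v)) (0, v) = 2 * energy (u, v)"
proof -
  have "((\<lambda>t. energy (u, t *\<^sub>R v)) has_derivative
      (\<lambda>s. frechet_derivative energy (at (u, 1 *\<^sub>R v)) (0, s *\<^sub>R v))) (at 1)"
    by (rule has_derivative_compose[OF _ has_derivative_slice])
       (use assms in \<open>auto intro!: derivative_eq_intros differentiable_energy\<close>)
  moreover have "((\<lambda>t. energy (u, t *\<^sub>R v)) has_derivative (\<lambda>s. 2 * s * energy (u, v))) (at 1)"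
    by (rule has_derivative_transform_within_open[where f = "\<lambda>t. t\<^sup>2 * energy (u, v)" and s = "{0<..}"])
       (auto intro!: derivative_eq_intros simp: energy_homogeneous[OF assms])
  ultimately have "(\<lambda>s. frechet_derivative energy (at (u, 1 *\<^sub>R v)) (0, s *\<^sub>R v)) =
      (\<lambda>s. 2 * s * energy (u, v))"
    by (rule has_derivative_unique)
  from fun_cong[OF this, of 1] show ?thesis by simp
qed

lemma fibre_metric_eq:
  assumes "u \<in> U" "v \<noteq> 0"
  shows "fibre_metric f u v $ i $ j = frechet_derivative (grad j) (at (u, v)) (0, axis i 1) / 2"
proof -
  have 1: "partial j (\<lambda>\<zeta>. (f (u, \<zeta>))\<^sup>2) \<zeta> = grad j (u, \<zeta>)" if "\<zeta> \<noteq> 0" for \<zeta>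
    using partial_slice[OF differentiable_energy[OF assms(1) that]]
    by (simp add: energy_def grad_def)
  have "frechet_derivative (\<lambda>\<zeta>. grad j (u, \<zeta>)) (at v) =
      frechet_derivative (partial j (\<lambda>\<zeta>. (f (u, \<zeta>))\<^sup>2)) (at v)"
    by (rule frechet_derivative_cong[where S = "- {0}"])
       (use assms 1 has_derivative_slice[OF differentiable_grad[OF assms]] in
         \<open>auto simp: open_Compl differentiable_def\<close>)
  then show ?thesis
    using partial_slice[OF differentiable_grad[OF assms], of i j]
    by (simp add: fibre_metric_def partial_def[of i])
qed

text \<open>Differentiating Euler's relation \<open>\<Sum>\<^sub>j v\<^sup>j \<partial>\<^sub>j f\<^sup>2 = 2 f\<^sup>2\<close> once more shows that contracting the
  fibre metric with the position vector gives the fibre derivative of \<open>f\<^sup>2/2\<close>.\<close>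

lemma fibre_metric_contract:
  assumes "u \<in> U" "v \<noteq> 0"
  shows "(\<Sum>j\<in>UNIV. fibre_metric f u v $ i $ j * v $ j) = legendre (u, v) $ i"
proof -
  have "((\<lambda>\<zeta>. \<Sum>j\<in>UNIV. \<zeta> $ j * grad j (u, \<zeta>)) has_derivative
      (\<lambda>w. \<Sum>j\<in>UNIV. v $ j * frechet_derivative (grad j) (at (u, v)) (0, w) + w $ j * grad j (u, v))) (at v)"
    by (intro has_derivative_sum has_derivative_mult has_derivative_slice differentiable_grad assms
        bounded_linear_imp_has_derivative bounded_linear_vec_nth)
  moreover have "((\<lambda>\<zeta>. \<Sum>j\<in>UNIV. \<zeta> $ j * grad j (u, \<zeta>)) has_derivative
      (\<lambda>w. 2 * frechet_derivative energy (at (u, v)) (0, w))) (at v)"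
    by (rule has_derivative_transform_within_open[where f = "\<lambda>\<zeta>. 2 * energy (u, \<zeta>)" and s = "- {0}",
          OF has_derivative_mult_right[OF has_derivative_slice[OF differentiable_energy]]])
       (use assms in \<open>auto simp: open_Compl euler_energy energy_derivative[symmetric]\<close>)
  ultimately have "(\<Sum>j\<in>UNIV. v $ j * frechet_derivative (grad j) (at (u, v)) (0, axis i 1) +
      axis i 1 $ j * grad j (u, v)) = 2 * frechet_derivative energy (at (u, v)) (0, axis i 1)"
    by (rule has_derivative_unique_apply)
  moreover have "(\<Sum>j\<in>UNIV. axis i 1 $ j * grad j (u, v)) = grad i (u, v)"
    unfolding energy_derivative[OF assms, symmetric] by (simp add: grad_def)
  ultimately have "(\<Sum>j\<in>UNIV. v $ j * frechet_derivative (grad j) (at (u, v)) (0, axis i 1)) = grad i (u, v)"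
    by (simp add: sum.distrib grad_def)
  then show ?thesis
    by (simp add: fibre_metric_eq[OF assms] legendre_def sum_divide_distrib[symmetric] mult.commute)
qed

lemma fibre_metric_contract2:
  assumes "u \<in> U" "v \<noteq> 0"
  shows "(\<Sum>i\<in>UNIV. \<Sum>j\<in>UNIV. fibre_metric f u v $ i $ j * w $ i * v $ j) =
    frechet_derivative energy (at (u, v)) (0, w) / 2"
proof -
  have "(\<Sum>i\<in>UNIV. \<Sum>j\<in>UNIV. fibre_metric f u v $ i $ j * w $ i * v $ j) = w \<bullet> legendre (u, v)"
    unfolding inner_vec_def fibre_metric_contract[OF assms, symmetric]
    by (simp add: sum_distrib_left mult_ac)
  then show ?thesis by (simp add: inner_legendre[OF assms])
qed

lemma legendre_homogeneous:
  assumes "u \<in> U" "v \<noteq> 0" "t > 0"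
  shows "legendre (u, t *\<^sub>R v) = t *\<^sub>R legendre (u, v)"
proof -
  have "((\<lambda>\<zeta>. energy (u, t *\<^sub>R \<zeta>)) has_derivative
      (\<lambda>w. frechet_derivative energy (at (u, t *\<^sub>R v)) (0, t *\<^sub>R w))) (at v)"
    by (rule has_derivative_compose[OF _ has_derivative_slice])
       (use assms in \<open>auto intro!: derivative_eq_intros differentiable_energy\<close>)
  moreover have "((\<lambda>\<zeta>. energy (u, t *\<^sub>R \<zeta>)) has_derivative
      (\<lambda>w. t\<^sup>2 * frechet_derivative energy (at (u, v)) (0, w))) (at v)"
    by (rule has_derivative_transform_within_open[where f = "\<lambda>\<zeta>. t\<^sup>2 * energy (u, \<zeta>)" and s = "- {0}",
          OF has_derivative_mult_right[OF has_derivative_slice[OF differentiable_energy]]])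
       (use assms in \<open>auto simp: open_Compl energy_homogeneous\<close>)
  ultimately have D: "frechet_derivative energy (at (u, t *\<^sub>R v)) (0, t *\<^sub>R w) =
      t\<^sup>2 * frechet_derivative energy (at (u, v)) (0, w)" for w
    by (rule has_derivative_unique_apply)
  show ?thesis
  proof (rule vector_eq_rdot[THEN iffD1, rule_format])
    fix w
    have "t *\<^sub>R w \<bullet> legendre (u, t *\<^sub>R v) = t\<^sup>2 * (w \<bullet> legendre (u, v))"
      using assms by (subst (1 2) inner_legendre) (simp_all add: D)
    then show "legendre (u, t *\<^sub>R v) \<bullet> w = t *\<^sub>R legendre (u, v) \<bullet> w"
      using assms(3) by (simp add: power2_eq_square inner_commute)
  qed
qed

end

section \<open>The Legendre transformation in coordinates\<close>

locale fibre_finsler = fibre_homogeneous U f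
  for U :: "(real^'n) set" and f :: "(real^'n) \<times> (real^'n) \<Rightarrow> real" +
  assumes nonneg: "u \<in> U \<Longrightarrow> v \<noteq> 0 \<Longrightarrow> f (u, v) \<ge> 0"
    and positive: "u \<in> U \<Longrightarrow> v \<noteq> 0 \<Longrightarrow> w \<noteq> 0 \<Longrightarrow>
      (\<Sum>i\<in>UNIV. \<Sum>j\<in>UNIV. fibre_metric f u v $ i $ j * w $ i * w $ j) > 0"
begin

lemma energy_pos: "u \<in> U \<Longrightarrow> v \<noteq> 0 \<Longrightarrow> energy (u, v) > 0"
  using positive[of u v v] fibre_metric_contract2[of u v v] by (simp add: euler_energy)

lemma f_pos: "u \<in> U \<Longrightarrow> v \<noteq> 0 \<Longrightarrow> f (u, v) > 0"
  using energy_pos[of u v] nonneg[of u v] by (simp add: energy_def less_le)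

lemma legendre_nonzero: "u \<in> U \<Longrightarrow> v \<noteq> 0 \<Longrightarrow> legendre (u, v) \<noteq> 0"
  using inner_legendre[of u v v] energy_pos[of u v] by (auto simp: euler_energy)

text \<open>The Jacobian matrix of the Legendre transformation along the fibre. It is the transpose of the
  fibre metric and therefore has the same quadratic form.\<close>

definition hessian :: "(real^'n) \<times> (real^'n) \<Rightarrow> real^'n^'n" where
  "hessian z = (\<chi> i j. frechet_derivative (grad i) (at z) (0, axis j 1) / 2)"

lemma legendre_derivative:
  assumes "u \<in> U" "v \<noteq> 0"
  shows "frechet_derivative legendre (at (u, v)) (0, w) = hessian (u, v) *v w"
proof -
  have "frechet_derivative legendre (at (u, v)) a $ i = frechet_derivative (grad i) (at (u, v)) a / 2" for i a
  proof -
    have "((\<lambda>z. legendre z $ i) has_derivative (\<lambda>a. frechet_derivative legendre (at (u, v)) a $ i)) (at (u, v))"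
      by (intro bounded_linear.has_derivative[OF bounded_linear_vec_nth]
          smooth_on_has_derivative[OF smooth_legendre]) (use assms in simp)
    moreover have "((\<lambda>z. legendre z $ i) has_derivative (\<lambda>a. frechet_derivative (grad i) (at (u, v)) a / 2)) (at (u, v))"
      using bounded_linear.has_derivative[OF bounded_linear_divide[of 2]
          differentiable_grad[OF assms, unfolded frechet_derivative_works]]
      by (simp add: legendre_def)
    ultimately show ?thesis by (rule has_derivative_unique_apply)
  qed
  moreover have "frechet_derivative (grad i) (at (u, v)) (0, w) / 2 = (hessian (u, v) *v w) $ i" for i
    by (subst frechet_derivative_axis_expansion[OF differentiable_grad[OF assms]])
       (simp add: hessian_def matrix_vector_mult_def sum_divide_distrib mult.commute)
  ultimately show ?thesis unfolding vec_eq_iff by metis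
qed

lemma hessian_positive:
  assumes "u \<in> U" "v \<noteq> 0" "w \<noteq> 0"
  shows "w \<bullet> (hessian (u, v) *v w) > 0"
proof -
  have "w \<bullet> (hessian (u, v) *v w) =
      (\<Sum>j\<in>UNIV. \<Sum>i\<in>UNIV. fibre_metric f u v $ i $ j * w $ i * w $ j)"
    by (simp add: inner_vec_def matrix_vector_mult_def hessian_def fibre_metric_eq assms
        sum_distrib_left mult_ac)
  also have "\<dots> = (\<Sum>i\<in>UNIV. \<Sum>j\<in>UNIV. fibre_metric f u v $ i $ j * w $ i * w $ j)"
    by (rule sum.swap)
  finally show ?thesis using positive[OF assms] by simp
qed

lemma hessian_det: "u \<in> U \<Longrightarrow> v \<noteq> 0 \<Longrightarrow> det (hessian (u, v)) \<noteq> 0"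
  using hessian_positive[of u v]
  by (metis inner_zero_right invertible_det_nz invertible_left_inverse less_irrefl
      matrix_left_invertible_ker)

text \<open>Along the segment from \<open>v\<close> to \<open>w\<close> the product of \<open>w - v\<close> with the Legendre covector is strictly
  increasing by positivity of the Hessian. This fails when the segment meets the origin, where no
  Hessian is available; but then \<open>w\<close> is a negative multiple of \<open>v\<close>, and Euler's relation excludes equal
  covectors because \<open>v \<bullet> legendre v\<close> and \<open>w \<bullet> legendre w\<close> are both positive.\<close>

lemma legendre_inj:
  assumes u: "u \<in> U" and v: "v \<noteq> 0" and w: "w \<noteq> 0" and eq: "legendre (u, v) = legendre (u, w)"
  shows "v = w"
proof (rule ccontr)
  assume "v \<noteq> w"
  show False
  proof (cases "\<exists>s\<in>{0..1}. v + s *\<^sub>R (w - v) = 0")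
    case False
    define \<phi> where "\<phi> = (\<lambda>s. (w - v) \<bullet> legendre (u, v + s *\<^sub>R (w - v)))"
    have "\<phi> 0 < \<phi> 1"
    proof (rule DERIV_pos_imp_increasing[OF zero_less_one])
      fix s :: real assume s: "0 \<le> s" "s \<le> 1"
      define z where "z = v + s *\<^sub>R (w - v)"
      have z: "z \<noteq> 0" using False s by (auto simp: z_def)
      have "((\<lambda>s. (w - v) \<bullet> legendre (u, v + s *\<^sub>R (w - v))) has_derivative
          (\<lambda>t. (w - v) \<bullet> frechet_derivative legendre (at (u, z)) (0, t *\<^sub>R (w - v)))) (at s)"
        unfolding z_def
        by (intro has_derivative_inner_right has_derivative_compose[OF _ has_derivative_slice]
            smooth_on_differentiable[OF smooth_legendre])
           (use u z in \<open>auto intro!: derivative_eq_intros simp: z_def\<close>)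
      then have "(\<phi> has_real_derivative (w - v) \<bullet> (hessian (u, z) *v (w - v))) (at s)"
        unfolding has_field_derivative_def \<phi>_def legendre_derivative[OF u z]
        by (simp add: matrix_vector_mult_scaleR mult_commute_abs)
      then show "\<exists>y. (\<phi> has_real_derivative y) (at s) \<and> 0 < y"
        using hessian_positive[OF u z] \<open>v \<noteq> w\<close> by auto
    qed
    then show False using eq by (simp add: \<phi>_def)
  next
    case True
    then obtain s where s: "0 \<le> s" "s \<le> 1" "(1 - s) *\<^sub>R v + s *\<^sub>R w = 0"
      by (auto simp: algebra_simps)
    have pos: "z \<bullet> legendre (u, z) > 0" if "z \<noteq> 0" for z
      using energy_pos[OF u that] by (simp add: inner_legendre[OF u that] euler_energy[OF u that])
    have "v \<bullet> legendre (u, v) > 0" "w \<bullet> legendre (u, v) > 0"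
      using pos[OF v] pos[OF w] eq by simp_all
    then have "(1 - s) * (v \<bullet> legendre (u, v)) + s * (w \<bullet> legendre (u, v)) > 0"
      using s(1,2) by (cases "s = 0") (auto intro!: add_nonneg_pos)
    moreover have "((1 - s) *\<^sub>R v + s *\<^sub>R w) \<bullet> legendre (u, v) = 0" using s(3) by simp
    ultimately show False by (simp add: inner_add_left)
  qed
qed

text \<open>Let \<open>v\<close> be a point of the unit sphere where \<open>q \<bullet> v / f v\<close> is largest. By homogeneity it is a
  maximum over the whole fibre, so that \<open>w \<mapsto> (q \<bullet> w) f v - (q \<bullet> v) f w\<close> is stationary at \<open>v\<close>. This
  makes \<open>q\<close> a positive multiple of the derivative of \<open>f\<close>, hence of the Legendre transform of \<open>v\<close>,
  and homogeneity absorbs the factor.\<close>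

lemma legendre_surj:
  assumes u: "u \<in> U" and q: "q \<noteq> 0"
  shows "\<exists>v. v \<noteq> 0 \<and> legendre (u, v) = q"
proof -
  have cont: "continuous_on (- {0}) (\<lambda>v. f (u, v))"
    by (rule continuous_on_compose2[OF smooth_on_continuous[OF smooth]])
       (use u in \<open>auto intro!: continuous_intros\<close>)
  have sup: "continuous_on (sphere 0 1) (\<lambda>v. (q \<bullet> v) / f (u, v))"
    by (intro continuous_intros continuous_on_subset[OF cont] ballI less_imp_neq[OF f_pos[OF u], symmetric])
       auto
  have "sphere (0 :: real^'n) 1 \<noteq> {}" by simp
  from continuous_attains_sup[OF compact_sphere this sup]
  obtain v where "v \<in> sphere 0 1" and
    max: "\<And>w. w \<in> sphere 0 1 \<Longrightarrow> (q \<bullet> w) / f (u, w) \<le> (q \<bullet> v) / f (u, v)"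
    by blast
  then have v: "v \<noteq> 0" by auto
  have max': "(q \<bullet> w) / f (u, w) \<le> (q \<bullet> v) / f (u, v)" if "w \<noteq> 0" for w
    using max[of "(1 / norm w) *\<^sub>R w"] homogeneous[OF u that, of "1 / norm w"] that by simp
  have fv: "f (u, v) > 0" by (rule f_pos[OF u v])
  have "0 < (q \<bullet> q) / f (u, q)" using q f_pos[OF u q] by simp
  also have "\<dots> \<le> (q \<bullet> v) / f (u, v)" by (rule max'[OF q])
  finally have qv: "q \<bullet> v > 0" using fv by (simp add: zero_less_divide_iff)
  define c where "c = (q \<bullet> v) / energy (u, v)"
  have c: "c > 0" using qv energy_pos[OF u v] by (simp add: c_def)
  have fd: "f differentiable (at (u, v))"
    by (rule smooth_on_differentiable[OF smooth]) (use u v in simp)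
  \<comment> \<open>the maximum condition without denominators\<close>
  have "(\<lambda>w. (q \<bullet> w) * f (u, v) - (q \<bullet> v) * frechet_derivative f (at (u, v)) (0, w)) = (\<lambda>w. 0)"
  proof (rule differential_zero_maxmin[where S = "- {0}" and x = v and
        f = "\<lambda>w. (q \<bullet> w) * f (u, v) - (q \<bullet> v) * f (u, w)"])
    show "((\<lambda>w. (q \<bullet> w) * f (u, v) - (q \<bullet> v) * f (u, w)) has_derivative
        (\<lambda>w. (q \<bullet> w) * f (u, v) - (q \<bullet> v) * frechet_derivative f (at (u, v)) (0, w))) (at v)"
      by (intro has_derivative_diff has_derivative_mult_left has_derivative_mult_right
          has_derivative_inner_right has_derivative_ident has_derivative_slice fd)
    have "(q \<bullet> w) * f (u, v) \<le> (q \<bullet> v) * f (u, w)" if "w \<noteq> 0" for w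
      using max'[OF that] fv f_pos[OF u that] by (simp add: field_simps)
    then show "(\<forall>w\<in>- {0}. (q \<bullet> w) * f (u, v) - (q \<bullet> v) * f (u, w)
          \<le> (q \<bullet> v) * f (u, v) - (q \<bullet> v) * f (u, v)) \<or>
        (\<forall>w\<in>- {0}. (q \<bullet> v) * f (u, v) - (q \<bullet> v) * f (u, v)
          \<le> (q \<bullet> w) * f (u, v) - (q \<bullet> v) * f (u, w))"
      by simp
  qed (use v in \<open>auto simp: open_Compl\<close>)
  then have crit: "(q \<bullet> w) * f (u, v) = (q \<bullet> v) * frechet_derivative f (at (u, v)) (0, w)" for w
    by (auto dest!: fun_cong[where x = w])
  have dE: "frechet_derivative energy (at (u, v)) (0, w) = 2 * f (u, v) * frechet_derivative f (at (u, v)) (0, w)" for w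
  proof -
    have "(energy has_derivative (\<lambda>a. 2 * f (u, v) * frechet_derivative f (at (u, v)) a)) (at (u, v))"
      unfolding energy_def
      by (rule derivative_eq_intros refl fd[unfolded frechet_derivative_works])+
        (simp add: fun_eq_iff)
    then show ?thesis by (simp add: frechet_derivative_eq)
  qed
  have "legendre (u, c *\<^sub>R v) = q"
  proof (rule vector_eq_rdot[THEN iffD1, rule_format])
    fix w
    have "legendre (u, c *\<^sub>R v) \<bullet> w = c * (f (u, v) * frechet_derivative f (at (u, v)) (0, w))"
      by (simp add: legendre_homogeneous[OF u v c] inner_commute[of _ w] inner_legendre[OF u v] dE)
    also have "\<dots> = ((q \<bullet> v) * frechet_derivative f (at (u, v)) (0, w)) / f (u, v)"
      using fv by (simp add: c_def energy_def power2_eq_square)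
    also have "\<dots> = q \<bullet> w" using fv by (simp add: crit[symmetric])
    finally show "legendre (u, c *\<^sub>R v) \<bullet> w = q \<bullet> w" .
  qed
  then show ?thesis using c v by (intro exI[of _ "c *\<^sub>R v"]) simp
qed

definition legendre_inv :: "(real^'n) \<times> (real^'n) \<Rightarrow> real^'n" where
  "legendre_inv = (\<lambda>(u, q). SOME v. v \<noteq> 0 \<and> legendre (u, v) = q)"

lemma legendre_inv:
  assumes "u \<in> U" "q \<noteq> 0"
  shows "legendre_inv (u, q) \<noteq> 0" "legendre (u, legendre_inv (u, q)) = q"
  using someI_ex[OF legendre_surj[OF assms]] by (simp_all add: legendre_inv_def)

lemma legendre_inv_legendre:
  "u \<in> U \<Longrightarrow> v \<noteq> 0 \<Longrightarrow> legendre_inv (u, legendre (u, v)) = v"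
  using legendre_inv legendre_nonzero legendre_inj by metis

text \<open>The map \<open>(u, v) \<mapsto> (u, legendre (u, v))\<close> permutes \<open>U \<times> - {0}\<close>, and its derivative is block triangular
  with the identity and the Hessian on the diagonal. Cramer's rule exhibits the inverse of the
  derivative as a smooth function of the point.\<close>

lemma smooth_legendre_inv: "smooth_on (U \<times> - {0}) legendre_inv"
proof -
  define \<Phi> where "\<Phi> = (\<lambda>z. (fst z, legendre z))"
  define \<Psi> where "\<Psi> = (\<lambda>z. (fst z, legendre_inv z))"
  define solve where "solve = (\<lambda>z b. (\<chi> k. det (\<chi> i j. if j = k then b $ i else hessian z $ i $ j) / det (hessian z)) :: real^'n)"
  define I where "I = (\<lambda>z (a, b). (a, solve z (b - frechet_derivative legendre (at z) (a, 0))))"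
  have solve: "hessian z *v solve z b = b" if "z \<in> U \<times> - {0}" for z b
    using cramer[of "hessian z" "solve z b" b] hessian_det that by (auto simp: solve_def)
  have sl: "frechet_derivative legendre (at z) (a, b) =
      frechet_derivative legendre (at z) (a, 0) + hessian z *v b" if "z \<in> U \<times> - {0}" for z a b
  proof -
    have "frechet_derivative legendre (at z) ((a, 0) + (0, b)) =
        frechet_derivative legendre (at z) (a, 0) + frechet_derivative legendre (at z) (0, b)"
      by (rule linear_add[OF smooth_on_linear_derivative[OF smooth_legendre that]])
    then show ?thesis using legendre_derivative that by auto
  qed
  have "smooth_on (\<Phi> ` (U \<times> - {0})) \<Psi>"
  proof (rule smooth_on_inverse_map[where I = I])
    show "smooth_on (U \<times> - {0}) \<Phi>"
      unfolding \<Phi>_def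
      by (intro smooth_on_Pair smooth_on_fst smooth_on_ident smooth_legendre open_slit)
    show "\<Psi> (\<Phi> z) = z" if "z \<in> U \<times> - {0}" for z
      using that legendre_inv_legendre by (auto simp: \<Phi>_def \<Psi>_def)
    show "frechet_derivative \<Phi> (at z) (I z w) = w" if z: "z \<in> U \<times> - {0}" for z w
    proof -
      obtain a b where w: "w = (a, b)" by (cases w)
      have "(\<Phi> has_derivative (\<lambda>h. (fst h, frechet_derivative legendre (at z) h))) (at z)"
        unfolding \<Phi>_def
        by (intro has_derivative_Pair has_derivative_fst has_derivative_ident
            smooth_on_has_derivative[OF smooth_legendre z])
      then have "frechet_derivative \<Phi> (at z) (I z w) = (a, frechet_derivative legendre (at z)
          (a, solve z (b - frechet_derivative legendre (at z) (a, 0))))"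
        by (simp add: frechet_derivative_eq I_def w)
      also have "\<dots> = w"
        unfolding sl[OF z, of a "solve _ _"] solve[OF z] by (simp add: w)
      finally show ?thesis .
    qed
    show "smooth_on (U \<times> - {0}) (\<lambda>z. I z w)" for w
    proof -
      obtain a b where w: "w = (a, b)" by (cases w)
      have h: "smooth_on (U \<times> - {0}) (\<lambda>z. hessian z $ i $ j)" for i j
      proof -
        have "smooth_on (U \<times> - {0}) (\<lambda>z. frechet_derivative (grad i) (at z) (0, axis j 1) * (1 / 2))"
          by (intro smooth_on_mult smooth_on_const smooth_on_derivative smooth_grad open_slit)
        then show ?thesis by (simp add: hessian_def)
      qed
      have r: "smooth_on (U \<times> - {0}) (\<lambda>z. (b - frechet_derivative legendre (at z) (a, 0)) $ i)" for i
        by (intro smooth_on_nth smooth_on_diff smooth_on_const smooth_on_derivative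
            smooth_legendre open_slit)
      have "smooth_on (U \<times> - {0}) (\<lambda>z. if j = k then (b - frechet_derivative legendre (at z) (a, 0)) $ i
          else hessian z $ i $ j)" for i j k
        using h r by (cases "j = k") simp_all
      then have "smooth_on (U \<times> - {0}) (\<lambda>z. solve z (b - frechet_derivative legendre (at z) (a, 0)))"
        unfolding solve_def using hessian_det
        by (intro smooth_on_vec_lambda smooth_on_divide smooth_on_det open_slit h) auto
      then show ?thesis
        unfolding I_def w by (simp, intro smooth_on_Pair smooth_on_const open_slit)
    qed
  qed (rule open_slit)
  moreover have "\<Phi> ` (U \<times> - {0}) = U \<times> - {0}"
  proof (intro equalityI subsetI)
    fix z assume "z \<in> U \<times> (- {0} :: (real^'n) set)"
    then have "z = \<Phi> (\<Psi> z)" "\<Psi> z \<in> U \<times> - {0}"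
      using legendre_inv by (auto simp: \<Phi>_def \<Psi>_def)
    then show "z \<in> \<Phi> ` (U \<times> - {0})" by (rule image_eqI)
  qed (use legendre_nonzero in \<open>auto simp: \<Phi>_def\<close>)
  ultimately have "smooth_on (U \<times> - {0}) (\<lambda>z. snd (\<Psi> z))"
    by (intro smooth_on_snd open_slit) simp
  then show ?thesis by (simp add: \<Psi>_def)
qed

lemma legendre_inv_homogeneous:
  assumes "u \<in> U" "q \<noteq> 0" "t > 0"
  shows "legendre_inv (u, t *\<^sub>R q) = t *\<^sub>R legendre_inv (u, q)"
proof (rule legendre_inj[OF assms(1)])
  show "legendre (u, legendre_inv (u, t *\<^sub>R q)) = legendre (u, t *\<^sub>R legendre_inv (u, q))"
    using legendre_inv assms by (simp add: legendre_homogeneous)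
qed (use legendre_inv assms in auto)

text \<open>The function is the coordinate form of the dual Cartan structure. Smoothness and homogeneity, hence
  Euler's relations, are all that this structure contributes to the distribution.\<close>

lemma fibre_homogeneous_dual: "fibre_homogeneous U (\<lambda>(u, q). f (u, legendre_inv (u, q)))"
proof
  have "smooth_on (U \<times> - {0}) (\<lambda>z. f (fst z, legendre_inv z))"
    by (rule smooth_on_compose[OF smooth])
       (use legendre_inv in \<open>auto intro!: smooth_on_Pair smooth_on_fst smooth_on_ident
          smooth_legendre_inv open_slit\<close>)
  moreover have "(\<lambda>(u, q). f (u, legendre_inv (u, q))) = (\<lambda>z. f (fst z, legendre_inv z))"
    by (simp add: fun_eq_iff)
  ultimately show "smooth_on (U \<times> - {0}) (\<lambda>(u, q). f (u, legendre_inv (u, q)))"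
    by simp
qed (use open_base legendre_inv in \<open>auto simp: legendre_inv_homogeneous homogeneous\<close>)

end

section \<open>Charts, tangent vectors and the bracket on a manifold\<close>

locale charted =
  fixes A :: "('m, 'e::euclidean_space) chart set"
  assumes atlas: "smooth_atlas A"
begin

abbreviation jacobian :: "('m, 'e) chart \<Rightarrow> ('m, 'e) chart \<Rightarrow> 'm \<Rightarrow> 'e \<Rightarrow> 'e" where
  "jacobian c d x \<equiv> frechet_derivative (transition c d) (at (snd c x))"

lemma chart_inj: "c \<in> A \<Longrightarrow> inj_on (snd c) (fst c)"
  using atlas by (simp add: smooth_atlas_def)

lemma open_overlap: "c \<in> A \<Longrightarrow> d \<in> A \<Longrightarrow> open (snd c ` (fst c \<inter> fst d))"
  using atlas by (simp add: smooth_atlas_def)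

lemma open_chart_image: "c \<in> A \<Longrightarrow> open (snd c ` fst c)"
  using atlas by (simp add: smooth_atlas_def)

lemma smooth_transition: "c \<in> A \<Longrightarrow> d \<in> A \<Longrightarrow> smooth_on (snd c ` (fst c \<inter> fst d)) (transition c d)"
  using atlas by (simp add: smooth_atlas_def)

lemma chart_inv_chart: "c \<in> A \<Longrightarrow> x \<in> fst c \<Longrightarrow> chart_inv c (snd c x) = x"
  by (simp add: chart_inv_def chart_inj)

lemma transition_chart: "c \<in> A \<Longrightarrow> x \<in> fst c \<Longrightarrow> transition c d (snd c x) = snd d x"
  by (simp add: transition_def chart_inv_chart)

lemma charts_atD: "c \<in> charts_at A x \<Longrightarrow> c \<in> A" "c \<in> charts_at A x \<Longrightarrow> x \<in> fst c"
  by (simp_all add: charts_at_def)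

lemma transition_has_derivative:
  "c \<in> charts_at A x \<Longrightarrow> d \<in> charts_at A x \<Longrightarrow>
    (transition c d has_derivative jacobian c d x) (at (snd c x))"
  by (rule smooth_on_has_derivative[OF smooth_transition]) (auto simp: charts_at_def)

lemma linear_jacobian: "c \<in> charts_at A x \<Longrightarrow> d \<in> charts_at A x \<Longrightarrow> linear (jacobian c d x)"
  by (rule has_derivative_linear[OF transition_has_derivative])

lemma function_in_chart_has_derivative:
  assumes c: "c \<in> charts_at A x" and d: "d \<in> charts_at A x"
    and g: "(g \<circ> chart_inv d) differentiable (at (snd d x))"
  shows "((g \<circ> chart_inv c) has_derivative
    (\<lambda>w. frechet_derivative (g \<circ> chart_inv d) (at (snd d x)) (jacobian c d x w))) (at (snd c x))"
proof (rule has_derivative_transform_within_open[where s = "snd c ` (fst c \<inter> fst d)"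
      and f = "\<lambda>u. (g \<circ> chart_inv d) (transition c d u)"])
  have "transition c d (snd c x) = snd d x"
    using c by (simp add: transition_chart charts_at_def)
  then show "((\<lambda>u. (g \<circ> chart_inv d) (transition c d u)) has_derivative
      (\<lambda>w. frechet_derivative (g \<circ> chart_inv d) (at (snd d x)) (jacobian c d x w))) (at (snd c x))"
    using has_derivative_compose[OF transition_has_derivative[OF c d],
        of "g \<circ> chart_inv d" "frechet_derivative (g \<circ> chart_inv d) (at (snd d x))"] g
    by (simp add: frechet_derivative_works)
qed (use c d in \<open>auto simp: open_overlap charts_at_def transition_chart chart_inv_chart\<close>)

lemma jacobian_refl:
  assumes "c \<in> charts_at A x"
  shows "jacobian c c x w = w"
proof -
  have "(transition c c has_derivative (\<lambda>w. w)) (at (snd c x))"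
    by (rule has_derivative_transform_within_open[where f = "\<lambda>u. u" and s = "snd c ` fst c"])
       (use assms in \<open>auto simp: open_chart_image charts_at_def transition_chart\<close>)
  then show ?thesis by (simp add: frechet_derivative_eq)
qed

lemma jacobian_comp:
  assumes c: "c \<in> charts_at A x" and d: "d \<in> charts_at A x" and e: "e \<in> charts_at A x"
  shows "jacobian d e x (jacobian c d x w) = jacobian c e x w"
proof -
  have "((snd e \<circ> chart_inv c) has_derivative
      (\<lambda>w. frechet_derivative (snd e \<circ> chart_inv d) (at (snd d x)) (jacobian c d x w))) (at (snd c x))"
    by (rule function_in_chart_has_derivative[OF c d])
       (rule differentiableI[OF transition_has_derivative[OF d e, unfolded transition_def[of d e]]])
  from frechet_derivative_eq[OF this] show ?thesis by (simp add: transition_def)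
qed

lemma tangent_spaceD:
  "v \<in> tangent_space A x \<Longrightarrow> c \<in> charts_at A x \<Longrightarrow> d \<in> charts_at A x \<Longrightarrow> v d = jacobian c d x (v c)"
  unfolding tangent_space_def by blast

lemma tangent_space_outside: "v \<in> tangent_space A x \<Longrightarrow> c \<notin> charts_at A x \<Longrightarrow> v c = 0"
  unfolding tangent_space_def by blast

lemma tangent_spaceI:
  "(\<And>c d. c \<in> charts_at A x \<Longrightarrow> d \<in> charts_at A x \<Longrightarrow> v d = jacobian c d x (v c)) \<Longrightarrow>
    (\<And>c. c \<notin> charts_at A x \<Longrightarrow> v c = 0) \<Longrightarrow> v \<in> tangent_space A x"
  unfolding tangent_space_def by blast

lemma tangent_eqI:
  assumes "v \<in> tangent_space A x" "w \<in> tangent_space A x" "c \<in> charts_at A x" "v c = w c"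
  shows "v = w"
proof
  fix d show "v d = w d"
  proof (cases "d \<in> charts_at A x")
    case True
    then show ?thesis
      using tangent_spaceD[OF assms(1,3)] tangent_spaceD[OF assms(2,3)] assms(4) by metis
  qed (use assms tangent_space_outside in metis)
qed

definition tangent_vector :: "('m, 'e) chart \<Rightarrow> 'm \<Rightarrow> 'e \<Rightarrow> ('m, 'e) chart_vec" where
  "tangent_vector c x w = (\<lambda>d. if d \<in> charts_at A x then jacobian c d x w else 0)"

lemma tangent_vector: "c \<in> charts_at A x \<Longrightarrow> tangent_vector c x w \<in> tangent_space A x"
  by (rule tangent_spaceI) (simp_all add: tangent_vector_def jacobian_comp)

lemma tangent_vector_component: "c \<in> charts_at A x \<Longrightarrow> tangent_vector c x w c = w"
  by (simp add: tangent_vector_def jacobian_refl)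

lemma tangent_vector_of_component:
  "v \<in> tangent_space A x \<Longrightarrow> c \<in> charts_at A x \<Longrightarrow> tangent_vector c x (v c) = v"
  by (rule tangent_eqI[of _ x _ c]) (simp_all add: tangent_vector tangent_vector_component)

lemma vec_zero_tangent: "vec_zero \<in> tangent_space A x"
  by (rule tangent_spaceI) (simp_all add: vec_zero_def linear_0[OF linear_jacobian])

lemma tangent_zero_iff:
  "v \<in> tangent_space A x \<Longrightarrow> c \<in> charts_at A x \<Longrightarrow> v = vec_zero \<longleftrightarrow> v c = 0"
  using tangent_eqI[OF _ vec_zero_tangent, of v x c] by (auto simp: vec_zero_def)

lemma vec_scale_tangent: "v \<in> tangent_space A x \<Longrightarrow> vec_scale t v \<in> tangent_space A x"
  by (rule tangent_spaceI)
     (simp_all add: vec_scale_def tangent_space_outside linear_cmul[OF linear_jacobian]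
       tangent_spaceD[symmetric])

lemma cotangent_spaceD:
  "p \<in> cotangent_space A x \<Longrightarrow> c \<in> charts_at A x \<Longrightarrow> d \<in> charts_at A x \<Longrightarrow>
    p c \<bullet> w = p d \<bullet> jacobian c d x w"
  unfolding cotangent_space_def by blast

lemma cotangent_space_outside: "p \<in> cotangent_space A x \<Longrightarrow> c \<notin> charts_at A x \<Longrightarrow> p c = 0"
  unfolding cotangent_space_def by blast

lemma cotangent_spaceI:
  "(\<And>c d w. c \<in> charts_at A x \<Longrightarrow> d \<in> charts_at A x \<Longrightarrow> p c \<bullet> w = p d \<bullet> jacobian c d x w) \<Longrightarrow>
    (\<And>c. c \<notin> charts_at A x \<Longrightarrow> p c = 0) \<Longrightarrow> p \<in> cotangent_space A x"
  unfolding cotangent_space_def by blast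

lemma cotangent_eqI:
  assumes "p \<in> cotangent_space A x" "q \<in> cotangent_space A x" "c \<in> charts_at A x" "p c = q c"
  shows "p = q"
proof
  fix d show "p d = q d"
  proof (cases "d \<in> charts_at A x")
    case True
    then have "p d \<bullet> w = q d \<bullet> w" for w
      using cotangent_spaceD[OF assms(1) True assms(3)] cotangent_spaceD[OF assms(2) True assms(3)]
        assms(4) by metis
    then show ?thesis using vector_eq_rdot by blast
  qed (use assms cotangent_space_outside in metis)
qed

text \<open>The transformation law of covectors prescribes inner products only, so that the components in
  the other charts are given by adjoint Jacobians.\<close>

definition covector :: "('m, 'e) chart \<Rightarrow> 'm \<Rightarrow> 'e \<Rightarrow> ('m, 'e) chart_vec" where
  "covector c x q = (\<lambda>d. if d \<in> charts_at A x then adjoint (jacobian d c x) q else 0)"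

lemma covector_inner:
  "c \<in> charts_at A x \<Longrightarrow> d \<in> charts_at A x \<Longrightarrow> covector c x q d \<bullet> w = q \<bullet> jacobian d c x w"
  by (simp add: covector_def adjoint_clauses[OF linear_jacobian])

lemma covector: "c \<in> charts_at A x \<Longrightarrow> covector c x q \<in> cotangent_space A x"
  by (rule cotangent_spaceI) (simp_all add: covector_inner jacobian_comp, simp add: covector_def)

lemma covector_component:
  assumes "c \<in> charts_at A x"
  shows "covector c x q c = q"
proof -
  have "\<forall>w. covector c x q c \<bullet> w = q \<bullet> w"
    by (simp add: covector_inner[OF assms assms] jacobian_refl[OF assms])
  then show ?thesis using vector_eq_rdot by blast
qed

lemma covector_of_component:
  "p \<in> cotangent_space A x \<Longrightarrow> c \<in> charts_at A x \<Longrightarrow> covector c x (p c) = p"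
  by (rule cotangent_eqI[of _ x _ c]) (simp_all add: covector covector_component)

lemma vec_zero_cotangent: "vec_zero \<in> cotangent_space A x"
  by (rule cotangent_spaceI) (simp_all add: vec_zero_def)

lemma cotangent_zero_iff:
  "p \<in> cotangent_space A x \<Longrightarrow> c \<in> charts_at A x \<Longrightarrow> p = vec_zero \<longleftrightarrow> p c = 0"
  using cotangent_eqI[OF _ vec_zero_cotangent, of p x c] by (auto simp: vec_zero_def)

text \<open>The Jacobian in the transformation law of the vector is the one that the chain rule produces,
  which makes the derivative of a function along a tangent vector meaningful on the manifold.\<close>

lemma derivative_along_tangent_vector:
  assumes "v \<in> tangent_space A x" "c \<in> charts_at A x" "d \<in> charts_at A x"
    and "(g \<circ> chart_inv d) differentiable (at (snd d x))"
  shows "frechet_derivative (g \<circ> chart_inv c) (at (snd c x)) (v c) =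
    frechet_derivative (g \<circ> chart_inv d) (at (snd d x)) (v d)"
  using function_in_chart_has_derivative[OF assms(2-4)] tangent_spaceD[OF assms(1-3)]
  by (simp add: frechet_derivative_eq)

lemma lie_bracket_component:
  "c \<in> charts_at A x \<Longrightarrow> lie_bracket A X Y x c =
    frechet_derivative (\<lambda>u. Y (chart_inv c u) c) (at (snd c x)) (X x c) -
    frechet_derivative (\<lambda>u. X (chart_inv c u) c) (at (snd c x)) (Y x c)"
  by (simp add: lie_bracket_def)

lemma open_chart_restrict:
  "openin (atlas_topology A) W \<Longrightarrow> c \<in> A \<Longrightarrow> open (snd c ` (fst c \<inter> W))"
  by (simp add: openin_atlas_topology[OF atlas])

lemma section_component_differentiable:
  assumes "smooth_section_on A D W X" "x \<in> W" "c \<in> charts_at A x"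
  shows "(\<lambda>u. X (chart_inv c u) c) differentiable (at (snd c x))"
  by (rule smooth_on_differentiable[where S = "snd c ` (fst c \<inter> W)"])
     (use assms in \<open>auto simp: smooth_section_on_def charts_at_def\<close>)

lemma lie_bracket_tangent:
  assumes W: "openin (atlas_topology A) W" "x \<in> W"
    and X: "smooth_section_on A D W X" and Y: "smooth_section_on A D W Y"
  shows "lie_bracket A X Y x \<in> tangent_space A x"
proof -
  have "lie_bracket A X Y x d = jacobian c d x (lie_bracket A X Y x c)"
    if c: "c \<in> charts_at A x" and d: "d \<in> charts_at A x" for c d
  proof -
    define S where "S = snd c ` (fst c \<inter> W) \<inter> snd c ` (fst c \<inter> fst d)"
    have S: "open S" "snd c x \<in> S"
      using c d W by (auto simp: S_def charts_at_def open_chart_restrict open_overlap)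
    have T: "smooth_on S (transition c d)"
      by (rule smooth_on_subset[OF smooth_transition]) (use c d in \<open>auto simp: S_def charts_at_def\<close>)
    have Tx: "transition c d (snd c x) = snd d x"
      using c by (simp add: transition_chart charts_at_def)
    have rel: "Z (chart_inv d (transition c d z)) d =
        frechet_derivative (transition c d) (at z) (Z (chart_inv c z) c)"
      if Z: "smooth_section_on A D W Z" and z: "z \<in> S" for Z z
    proof -
      obtain m where m: "m \<in> fst c" "m \<in> fst d" "m \<in> W" "z = snd c m"
        using z chart_inj[OF charts_atD(1)[OF c]] unfolding S_def
        by (auto dest: inj_onD)
      then have "Z m d = jacobian c d m (Z m c)"
        using Z c d by (intro tangent_spaceD) (auto simp: smooth_section_on_def charts_at_def)
      then show ?thesis
        using m c d by (simp add: charts_at_def transition_chart chart_inv_chart)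
    qed
    note diff = section_component_differentiable[OF _ W(2)]
    have "frechet_derivative (\<lambda>u. Y (chart_inv d u) d) (at (snd d x)) (X x d) -
        frechet_derivative (\<lambda>u. X (chart_inv d u) d) (at (snd d x)) (Y x d) =
        jacobian c d x (frechet_derivative (\<lambda>u. Y (chart_inv c u) c) (at (snd c x)) (X x c) -
          frechet_derivative (\<lambda>u. X (chart_inv c u) c) (at (snd c x)) (Y x c))"
      using bracket_related[OF T S, of "\<lambda>u. X (chart_inv c u) c" "\<lambda>u. Y (chart_inv c u) c"
          "\<lambda>u. X (chart_inv d u) d" "\<lambda>u. Y (chart_inv d u) d",
          OF diff[OF X c] diff[OF Y c] _ _ rel[OF X] rel[OF Y]]
        diff[OF X d] diff[OF Y d] c d
      by (simp add: Tx chart_inv_chart charts_at_def)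
    then show ?thesis by (simp add: lie_bracket_component c d)
  qed
  then show ?thesis by (rule tangent_spaceI) (simp_all add: lie_bracket_def)
qed

lemma lie_bracket_annihilates:
  fixes g :: "'m \<Rightarrow> 'f::euclidean_space"
  assumes W: "openin (atlas_topology A) W" "x \<in> W" and c: "c \<in> charts_at A x"
    and X: "smooth_section_on A D W X" and Y: "smooth_section_on A D W Y"
    and g: "smooth_on (snd c ` fst c) (g \<circ> chart_inv c)"
    and D: "\<And>m v. m \<in> W \<Longrightarrow> c \<in> charts_at A m \<Longrightarrow> v \<in> D m \<Longrightarrow>
      frechet_derivative (g \<circ> chart_inv c) (at (snd c m)) (v c) = 0"
  shows "frechet_derivative (g \<circ> chart_inv c) (at (snd c x)) (lie_bracket A X Y x c) = 0"
proof -
  have S: "open (snd c ` (fst c \<inter> W))" "snd c x \<in> snd c ` (fst c \<inter> W)"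
    using W c by (auto simp: open_chart_restrict charts_at_def)
  have T: "smooth_on (snd c ` (fst c \<inter> W)) (g \<circ> chart_inv c)"
    by (rule smooth_on_subset[OF g]) auto
  have rel: "0 = frechet_derivative (g \<circ> chart_inv c) (at z) (Z (chart_inv c z) c)"
    if "smooth_section_on A D W Z" "z \<in> snd c ` (fst c \<inter> W)" for Z z
    using that D c by (auto simp: smooth_section_on_def charts_at_def chart_inv_chart)
  note diff = section_component_differentiable[OF _ W(2) c]
  show ?thesis
    using bracket_related[OF T S diff[OF X] diff[OF Y], of "\<lambda>_. 0" "\<lambda>_. 0", OF _ _ rel[OF X] rel[OF Y]] c
    by (simp add: lie_bracket_component chart_inv_chart charts_at_def)
qed

end

section \<open>Changing the coordinates of a chart\<close>

definition recoordinatize ::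
    "('m, 'e) chart \<Rightarrow> 'e set \<Rightarrow> ('e \<Rightarrow> 'e) \<Rightarrow> ('m, 'e) chart" where
  "recoordinatize c P \<phi> = ({m \<in> fst c. snd c m \<in> P}, \<phi> \<circ> snd c)"

text \<open>Composing a chart with a diffeomorphism of an open part of its image gives a chart of the same
  smooth structure: its transition maps are compositions of old transition maps with \<open>\<phi>\<close>
  and \<open>\<psi>\<close>.\<close>

locale coordinate_change = charted A
  for A :: "('m, 'e::euclidean_space) chart set" +
  fixes c :: "('m, 'e) chart" and P :: "'e set" and \<phi> \<psi> :: "'e \<Rightarrow> 'e"
  assumes c: "c \<in> A" and P: "open P" "P \<subseteq> snd c ` fst c"
    and \<phi>: "smooth_on P \<phi>" and \<psi>: "smooth_on (\<phi> ` P) \<psi>" and op: "open (\<phi> ` P)"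
    and \<psi>\<phi>: "\<And>z. z \<in> P \<Longrightarrow> \<psi> (\<phi> z) = z"
begin

abbreviation "c' \<equiv> recoordinatize c P \<phi>"

lemma open_image_restrict:
  assumes "open (snd c ` (fst c \<inter> W))"
  shows "open (snd c' ` (fst c' \<inter> W))"
proof -
  have "snd c' ` (fst c' \<inter> W) = \<phi> ` P \<inter> \<psi> -` (P \<inter> snd c ` (fst c \<inter> W))"
  proof (intro equalityI subsetI)
    fix z assume "z \<in> \<phi> ` P \<inter> \<psi> -` (P \<inter> snd c ` (fst c \<inter> W))"
    then obtain m where "m \<in> fst c" "m \<in> W" "snd c m \<in> P" "z = \<phi> (snd c m)"
      using \<psi>\<phi> by auto
    then show "z \<in> snd c' ` (fst c' \<inter> W)" by (auto simp: recoordinatize_def)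
  qed (auto simp: recoordinatize_def \<psi>\<phi>)
  moreover have "open (\<phi> ` P \<inter> \<psi> -` (P \<inter> snd c ` (fst c \<inter> W)))"
    by (rule continuous_open_preimage[OF smooth_on_continuous[OF \<psi>] op]) (use assms P in auto)
  ultimately show ?thesis by simp
qed

lemma recoordinatize_inj: "inj_on (snd c') (fst c')"
proof (rule inj_onI)
  fix m m' assume "m \<in> fst c'" "m' \<in> fst c'" "snd c' m = snd c' m'"
  then have "m \<in> fst c" "m' \<in> fst c" "snd c m = snd c m'"
    using \<psi>\<phi> by (auto simp: recoordinatize_def) metis
  then show "m = m'" using chart_inj[OF c] by (auto dest: inj_onD)
qed

lemma recoordinatize_inv: "m \<in> fst c' \<Longrightarrow> chart_inv c' (snd c' m) = m"
  by (simp add: chart_inv_def recoordinatize_inj)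

lemma recoordinatize_maximal_atlas: "c' \<in> maximal_atlas A"
proof -
  have sub: "fst c' \<subseteq> fst c" by (auto simp: recoordinatize_def)
  have op1: "open (snd c' ` (fst c' \<inter> fst d))" if "d \<in> insert c' A" for d
  proof (cases "d = c'")
    case True
    have "open (snd c' ` (fst c' \<inter> UNIV))"
      by (rule open_image_restrict) (simp add: open_chart_image c)
    then show ?thesis using True by simp
  qed (use that c in \<open>auto intro!: open_image_restrict open_overlap\<close>)
  have img: "snd d ` (fst d \<inter> fst c') = snd d ` (fst d \<inter> fst c) \<inter> transition d c -` P" if d: "d \<in> A" for d
    by (auto simp: recoordinatize_def transition_chart[OF d])
  have op2: "open (snd d ` (fst d \<inter> fst c'))" if d: "d \<in> A" for d
    unfolding img[OF d]
    by (rule continuous_open_preimage[OF smooth_on_continuous[OF smooth_transition] _ P(1)])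
       (use c d in \<open>auto simp: open_overlap\<close>)
  have sm1: "smooth_on (snd c' ` (fst c' \<inter> fst d)) (transition c' d)" if d: "d \<in> A" for d
  proof (rule smooth_on_cong[OF op1, rotated])
    show "smooth_on (snd c' ` (fst c' \<inter> fst d)) (\<lambda>z. transition c d (\<psi> z))"
      by (rule smooth_on_compose[OF smooth_transition[OF c d] smooth_on_subset[OF \<psi>]])
         (use c d op1 in \<open>auto simp: recoordinatize_def \<psi>\<phi> open_overlap\<close>)
    show "transition c d (\<psi> z) = transition c' d z" if "z \<in> snd c' ` (fst c' \<inter> fst d)" for z
    proof -
      from that obtain m where m: "m \<in> fst c'" "z = snd c' m" by auto
      then have "transition c' d z = snd d m" by (simp add: transition_def recoordinatize_inv)
      moreover have "\<psi> z = snd c m" "m \<in> fst c"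
        using m by (auto simp: recoordinatize_def \<psi>\<phi>)
      ultimately show ?thesis by (simp add: transition_chart c)
    qed
  qed (use d in simp)
  have sm2: "smooth_on (snd d ` (fst d \<inter> fst c')) (transition d c')" if d: "d \<in> A" for d
  proof (rule smooth_on_cong[OF op2[OF d], rotated])
    show "smooth_on (snd d ` (fst d \<inter> fst c')) (\<lambda>z. \<phi> (transition d c z))"
      by (rule smooth_on_compose[OF \<phi> smooth_on_subset[OF smooth_transition[OF d c]]])
         (use op2[OF d] P in \<open>auto simp: img[OF d]\<close>)
    show "\<phi> (transition d c z) = transition d c' z" for z
      by (simp add: transition_def recoordinatize_def)
  qed
  have sm3: "smooth_on (snd c' ` (fst c' \<inter> fst c')) (transition c' c')"
    by (rule smooth_on_cong[OF op1 _ smooth_on_ident[OF op1]])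
       (auto simp: transition_def recoordinatize_inv)
  have "smooth_atlas (insert c' A)"
    unfolding smooth_atlas_def
  proof (intro conjI ballI)
    fix d assume d: "d \<in> insert c' A"
    show "inj_on (snd d) (fst d)"
      using d recoordinatize_inj chart_inj by blast
    show "open (snd d ` fst d)"
      using d open_chart_image op1[of c'] by (metis Int_absorb insert_iff)
    fix e assume e: "e \<in> insert c' A"
    show "open (snd d ` (fst d \<inter> fst e))"
      using d e op1 op2 open_overlap by blast
    show "smooth_on (snd d ` (fst d \<inter> fst e)) (transition d e)"
      using d e sm1 sm2 sm3 smooth_transition by blast
  qed
  then show ?thesis
    using sub c by (auto simp: maximal_atlas_def atlas_carrier_def)
qed

end

section \<open>Straightening the level sets of a homogeneous function\<close>

definition leaf_space :: "'n::finite \<Rightarrow> 'n big_coord set" where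
  "leaf_space k = {z. fst z = 0 \<and> fst (snd z) $ k = 0}"

lemma subspace_leaf_space: "subspace (leaf_space k)"
  by (auto simp: leaf_space_def subspace_def)

lemma dim_leaf_space: "dim (leaf_space (k :: 'n::finite)) = 2 * CARD('n) - 1"
proof -
  have eq: "leaf_space k = {0} \<times> ({w. axis k 1 \<bullet> w = 0} \<times> UNIV)"
    by (auto simp: leaf_space_def inner_axis')
  have sub: "subspace {w :: real^'n. axis k 1 \<bullet> w = 0}"
    by (rule subspace_hyperplane)
  have "dim {w :: real^'n. axis k 1 \<bullet> w = 0} = CARD('n) - 1"
    by (subst dim_special_hyperplane) (auto simp: axis_in_Basis_iff)
  moreover have "CARD('n) \<ge> 1"
    by (simp add: Suc_leI)
  ultimately show ?thesis
    unfolding eq by (simp add: dim_Times sub subspace_Times)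
qed

text \<open>If \<open>h\<close> is positive and homogeneous in the fibre variables, a point is determined by the ray
  through it and the value of \<open>h\<close>. The rays with \<open>T v $ k > 0\<close> have affine coordinates, obtained
  by dividing by \<open>T v $ k\<close>; the coordinate \<open>k\<close> of \<open>T v\<close>, which becomes \<open>1\<close>, leaves room for the
  value of \<open>h\<close>. In these coordinates the sets \<open>u = const, h = const\<close> are parallel to
  \<open>leaf_space k\<close>. Every point satisfies \<open>T v $ k > 0\<close> for a suitable orthogonal \<open>T\<close>.\<close>

locale cone_function =
  fixes U :: "(real^'n) set" and h :: "'n big_coord \<Rightarrow> real" and k :: 'n
    and T :: "real^'n \<Rightarrow> real^'n"
  assumes base: "open U"
    and smooth: "smooth_on (U \<times> (- {0}) \<times> - {0}) h"
    and pos: "u \<in> U \<Longrightarrow> v \<noteq> 0 \<Longrightarrow> q \<noteq> 0 \<Longrightarrow> h (u, v, q) > 0"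
    and hom: "u \<in> U \<Longrightarrow> v \<noteq> 0 \<Longrightarrow> q \<noteq> 0 \<Longrightarrow> t > 0 \<Longrightarrow>
      h (u, t *\<^sub>R v, t *\<^sub>R q) = t\<^sup>2 * h (u, v, q)"
    and T: "orthogonal_transformation T"
begin

definition region :: "'n big_coord set" where
  "region = {(u, v, q). u \<in> U \<and> T v $ k > 0 \<and> q \<noteq> 0}"

definition straighten :: "'n big_coord \<Rightarrow> 'n big_coord" where
  "straighten = (\<lambda>(u, v, q). (u, \<chi> i. if i = k then h (u, v, q) else T v $ i / T v $ k,
    (1 / T v $ k) *\<^sub>R q))"

definition ray_point :: "real^'n \<Rightarrow> real^'n" where
  "ray_point w = inv T (\<chi> i. if i = k then 1 else w $ i)"

text \<open>The radius is found from \<open>h (u, r v, r s) = r\<^sup>2 h (u, v, s)\<close>, which has to be the stored value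
  \<open>w $ k\<close>.\<close>

definition unstraighten :: "'n big_coord \<Rightarrow> 'n big_coord" where
  "unstraighten = (\<lambda>(u, w, s). let r = sqrt (w $ k / h (u, ray_point w, s))
    in (u, r *\<^sub>R ray_point w, r *\<^sub>R s))"

definition straight_region :: "'n big_coord set" where
  "straight_region = {(u, w, s). u \<in> U \<and> w $ k > 0 \<and> s \<noteq> 0}"

lemma T_inv: "T (inv T w) = w" "inv T (T v) = v"
  using orthogonal_transformation_bij[OF T] by (simp_all add: bij_is_surj surj_f_inv_f bij_is_inj)

lemma linear_T: "linear T" "linear (inv T)"
  using T orthogonal_transformation_inv[OF T] by (simp_all add: orthogonal_transformation_linear)

lemma T_ray_point: "T (ray_point w) $ i = (if i = k then 1 else w $ i)"
  by (simp add: ray_point_def T_inv)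

lemma ray_point_nonzero: "ray_point w \<noteq> 0"
  using T_ray_point[of w k] linear_0[OF linear_T(1)] by auto

lemma region_nonzero: "(u, v, q) \<in> region \<Longrightarrow> v \<noteq> 0"
  using linear_0[OF linear_T(1)] by (auto simp: region_def)

lemma region_subset: "region \<subseteq> U \<times> (- {0}) \<times> - {0}"
  using region_nonzero by (auto simp: region_def)

lemma open_slit: "open (U \<times> (- {0} :: (real^'n) set) \<times> (- {0} :: (real^'n) set))"
  by (intro open_Times base) (simp_all add: open_Compl)

lemma open_region: "open region"
proof -
  have "region = U \<times> {v. T v $ k > 0} \<times> - {0}"
    by (auto simp: region_def)
  moreover have "open {v. T v $ k > 0}"
    by (intro open_Collect_less continuous_intros linear_continuous_on linear_T(1)
        linear_conv_bounded_linear[THEN iffD1])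
  ultimately show ?thesis by (simp add: open_Times base open_Compl)
qed

lemma open_straight_region: "open straight_region"
proof -
  have "straight_region = U \<times> {w. w $ k > 0} \<times> - {0}"
    by (auto simp: straight_region_def)
  moreover have "open {w :: real^'n. w $ k > 0}"
    by (intro open_Collect_less continuous_intros)
  ultimately show ?thesis by (simp add: open_Times base open_Compl)
qed

lemma unstraighten_straighten:
  assumes "z \<in> region"
  shows "unstraighten (straighten z) = z"
proof -
  obtain u v q where z: "z = (u, v, q)" by (cases z)
  define t where "t = T v $ k"
  have t: "t > 0" and u: "u \<in> U" and q: "q \<noteq> 0" and v: "v \<noteq> 0"
    using assms region_nonzero[OF assms[unfolded z]] by (simp_all add: z region_def t_def)
  define w where "w = fst (snd (straighten z))"
  have "(\<chi> i. if i = k then 1 else w $ i) = T ((1 / t) *\<^sub>R v)"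
    using t by (simp add: w_def straighten_def z vec_eq_iff linear_cmul[OF linear_T(1)] t_def)
  then have ray: "ray_point w = (1 / t) *\<^sub>R v"
    by (simp add: ray_point_def T_inv)
  have "h (u, (1 / t) *\<^sub>R v, (1 / t) *\<^sub>R q) = h z / t\<^sup>2"
    using hom[OF u v q, of "1 / t"] t by (simp add: z power_divide)
  moreover have "w $ k = h z" by (simp add: w_def straighten_def z)
  ultimately have "sqrt (w $ k / h (u, ray_point w, (1 / t) *\<^sub>R q)) = t"
    using t pos[OF u v q] by (simp add: ray z)
  moreover have "straighten z = (u, w, (1 / t) *\<^sub>R q)"
    by (simp add: straighten_def z w_def t_def)
  ultimately show ?thesis
    using t by (simp add: unstraighten_def Let_def ray z)
qed

lemma straighten_unstraighten:
  assumes "z \<in> straight_region"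
  shows "straighten (unstraighten z) = z" "unstraighten z \<in> region"
proof -
  obtain u w s where z: "z = (u, w, s)" by (cases z)
  have u: "u \<in> U" and w: "w $ k > 0" and s: "s \<noteq> 0"
    using assms by (auto simp: z straight_region_def)
  define v where "v = ray_point w"
  define r where "r = sqrt (w $ k / h (u, v, s))"
  have v: "v \<noteq> 0" by (simp add: v_def ray_point_nonzero)
  have h: "h (u, v, s) > 0" by (rule pos[OF u v s])
  have r: "r > 0" using w h by (simp add: r_def)
  have un: "unstraighten z = (u, r *\<^sub>R v, r *\<^sub>R s)"
    by (simp add: unstraighten_def z v_def r_def Let_def)
  have Tk: "T (r *\<^sub>R v) $ i = r * (if i = k then 1 else w $ i)" for i
    by (simp add: linear_cmul[OF linear_T(1)] v_def T_ray_point)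
  show "unstraighten z \<in> region"
    using u r s by (simp add: un region_def Tk)
  have "h (u, r *\<^sub>R v, r *\<^sub>R s) = w $ k"
    using w h by (simp add: hom[OF u v s r]) (simp add: r_def)
  then show "straighten (unstraighten z) = z"
    using r unfolding un by (simp add: straighten_def z vec_eq_iff Tk)
qed

lemma straighten_image: "straighten ` region = straight_region"
proof (intro equalityI subsetI)
  fix z assume "z \<in> straighten ` region"
  then obtain u v q where z: "(u, v, q) \<in> region" "z = straighten (u, v, q)" by auto
  then have "u \<in> U" "T v $ k > 0" "q \<noteq> 0" by (simp_all add: region_def)
  then show "z \<in> straight_region"
    using pos[OF _ region_nonzero[OF z(1)]] by (simp add: z(2) straighten_def straight_region_def)
next
  fix z assume "z \<in> straight_region"
  then show "z \<in> straighten ` region"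
    using straighten_unstraighten by (metis image_eqI)
qed

lemma smooth_straighten: "smooth_on region straighten"
proof -
  have lin: "bounded_linear (\<lambda>v. T v $ i)" for i
    using bounded_linear_compose[OF bounded_linear_vec_nth linear_T(1)[unfolded linear_conv_bounded_linear]] .
  have coord: "smooth_on region (\<lambda>z. T (fst (snd z)) $ i)" for i
    by (intro smooth_on_linear_compose[OF lin] smooth_on_fst smooth_on_snd smooth_on_ident open_region)
  have comp: "smooth_on region (\<lambda>z. if i = k then h z else T (fst (snd z)) $ i / T (fst (snd z)) $ k)" for i
  proof (cases "i = k")
    case True
    then show ?thesis using smooth_on_subset[OF smooth region_subset] by simp
  next
    case False
    then show ?thesis
      by (simp, intro smooth_on_divide coord open_region) (auto simp: region_def)
  qed
  have "smooth_on region (\<lambda>z. (fst z, \<chi> i. if i = k then h z else T (fst (snd z)) $ i / T (fst (snd z)) $ k,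
      (1 / T (fst (snd z)) $ k) *\<^sub>R snd (snd z)))"
    by (intro smooth_on_Pair smooth_on_fst smooth_on_snd smooth_on_ident smooth_on_vec_lambda comp
        smooth_on_scaleR smooth_on_divide smooth_on_const coord open_region) (auto simp: region_def)
  moreover have "straighten = (\<lambda>z. (fst z,
      \<chi> i. if i = k then h z else T (fst (snd z)) $ i / T (fst (snd z)) $ k,
      (1 / T (fst (snd z)) $ k) *\<^sub>R snd (snd z)))"
    by (auto simp: straighten_def fun_eq_iff)
  ultimately show ?thesis by simp
qed

lemma smooth_unstraighten: "smooth_on straight_region unstraighten"
proof -
  note op = open_straight_region
  have nth: "smooth_on straight_region (\<lambda>z. fst (snd z) $ i)" for i
    by (intro smooth_on_nth smooth_on_fst smooth_on_snd smooth_on_ident op)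
  have "smooth_on straight_region (\<lambda>z. if i = k then 1 else fst (snd z) $ i)" for i
    using nth by (cases "i = k") (simp_all add: smooth_on_const)
  then have ray: "smooth_on straight_region (\<lambda>z. ray_point (fst (snd z)))"
    unfolding ray_point_def
    by (intro smooth_on_linear_compose[OF linear_T(2)[unfolded linear_conv_bounded_linear]]
        smooth_on_vec_lambda op)
  have slit: "(fst z, ray_point (fst (snd z)), snd (snd z)) \<in> U \<times> (- {0}) \<times> - {0}"
    if "z \<in> straight_region" for z
    using that ray_point_nonzero by (auto simp: straight_region_def)
  have hr: "smooth_on straight_region (\<lambda>z. h (fst z, ray_point (fst (snd z)), snd (snd z)))"
    by (rule smooth_on_compose[OF smooth _ _ op open_slit])
       (use slit in \<open>auto intro!: smooth_on_Pair ray smooth_on_fst smooth_on_snd smooth_on_ident op\<close>)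
  have hpos: "h (fst z, ray_point (fst (snd z)), snd (snd z)) > 0" if "z \<in> straight_region" for z
    using slit[OF that] pos by auto
  have root: "smooth_on straight_region
      (\<lambda>z. sqrt (fst (snd z) $ k / h (fst z, ray_point (fst (snd z)), snd (snd z))))"
  proof (rule smooth_on_compose[OF smooth_on_sqrt _ _ op])
    show "smooth_on straight_region (\<lambda>z. fst (snd z) $ k / h (fst z, ray_point (fst (snd z)), snd (snd z)))"
      by (intro smooth_on_divide nth hr op) (use hpos in force)
    show "(\<lambda>z. fst (snd z) $ k / h (fst z, ray_point (fst (snd z)), snd (snd z))) ` straight_region \<subseteq> {0<..}"
      using hpos by (force simp: straight_region_def)
  qed simp
  have "smooth_on straight_region (\<lambda>z. (fst z,
      sqrt (fst (snd z) $ k / h (fst z, ray_point (fst (snd z)), snd (snd z))) *\<^sub>R ray_point (fst (snd z)),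
      sqrt (fst (snd z) $ k / h (fst z, ray_point (fst (snd z)), snd (snd z))) *\<^sub>R snd (snd z)))"
    by (intro smooth_on_Pair smooth_on_fst smooth_on_snd smooth_on_ident smooth_on_scaleR root ray op)
  then show ?thesis by (simp add: unstraighten_def case_prod_beta' Let_def)
qed

lemma straighten_coordinates:
  "fst (straighten z) = fst z" "fst (snd (straighten z)) $ k = h z"
  by (cases z; simp add: straighten_def)+

lemma straighten_derivative_leaf:
  assumes "z \<in> region"
  shows "frechet_derivative straighten (at z) a \<in> leaf_space k \<longleftrightarrow>
    fst a = 0 \<and> frechet_derivative h (at z) a = 0"
proof -
  note D = smooth_on_has_derivative[OF smooth_straighten assms]
  have "((\<lambda>z. fst (straighten z)) has_derivative (\<lambda>a. fst (frechet_derivative straighten (at z) a))) (at z)"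
    by (rule has_derivative_fst[OF D])
  moreover have "((\<lambda>z. fst (straighten z)) has_derivative fst) (at z)"
    by (simp add: straighten_coordinates bounded_linear_imp_has_derivative bounded_linear_fst)
  ultimately have 1: "fst (frechet_derivative straighten (at z) a) = fst a"
    by (rule has_derivative_unique_apply)
  have "((\<lambda>z. fst (snd (straighten z)) $ k) has_derivative
      (\<lambda>a. fst (snd (frechet_derivative straighten (at z) a)) $ k)) (at z)"
    by (intro bounded_linear.has_derivative[OF bounded_linear_vec_nth] has_derivative_fst
        has_derivative_snd D)
  then have 2: "frechet_derivative h (at z) a = fst (snd (frechet_derivative straighten (at z) a)) $ k"
    by (simp add: straighten_coordinates frechet_derivative_eq)
  show ?thesis by (simp add: leaf_space_def 1 2)
qed

end

section \<open>The big-tangent manifold\<close>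

locale big_tangent = charted A for A :: "('m, real^'n) chart set"
begin

abbreviation big_chart :: "('m, real^'n) chart \<Rightarrow> (('m, 'n) big_point, 'n big_coord) chart" where
  "big_chart c \<equiv> big_tangent_chart A c"

abbreviation slit :: "(real^'n) set \<Rightarrow> 'n big_coord set" where
  "slit U \<equiv> U \<times> (- {0}) \<times> - {0}"

definition big_point_at :: "('m, real^'n) chart \<Rightarrow> 'n big_coord \<Rightarrow> ('m, 'n) big_point" where
  "big_point_at c = (\<lambda>(u, v, q). let x = chart_inv c u in (x, tangent_vector c x v, covector c x q))"

lemma fst_big_chart: "(x, y, p) \<in> fst (big_chart c) \<longleftrightarrow>
    x \<in> fst c \<and> y \<in> tangent_space A x \<and> p \<in> cotangent_space A x \<and> y \<noteq> vec_zero \<and> p \<noteq> vec_zero"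
  by (simp add: big_tangent_chart_def)

lemma snd_big_chart: "snd (big_chart c) (x, y, p) = (snd c x, y c, p c)"
  by (simp add: big_tangent_chart_def)

lemma big_point_at_chart:
  assumes "c \<in> A" "m \<in> fst (big_chart c)"
  shows "big_point_at c (snd (big_chart c) m) = m"
proof -
  obtain x y p where m: "m = (x, y, p)" by (cases m)
  have "c \<in> charts_at A x" using assms by (simp add: m fst_big_chart charts_at_def)
  then show ?thesis
    using assms by (simp add: m snd_big_chart big_point_at_def Let_def chart_inv_chart fst_big_chart
        tangent_vector_of_component covector_of_component)
qed

lemma big_point_at:
  assumes "c \<in> A" "z \<in> slit (snd c ` fst c)"
  shows "big_point_at c z \<in> fst (big_chart c)" "snd (big_chart c) (big_point_at c z) = z"
    "fst (big_point_at c z) = chart_inv c (fst z)"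
proof -
  obtain u v q where z: "z = (u, v, q)" by (cases z)
  obtain x where x: "x \<in> fst c" "u = snd c x" using assms z by auto
  have c: "c \<in> charts_at A x" using x assms by (simp add: charts_at_def)
  have p: "big_point_at c z = (x, tangent_vector c x v, covector c x q)"
    using x assms by (simp add: z big_point_at_def Let_def chart_inv_chart)
  show "big_point_at c z \<in> fst (big_chart c)"
    unfolding p using assms x tangent_zero_iff[OF tangent_vector[OF c] c] cotangent_zero_iff[OF covector[OF c] c]
    by (simp add: fst_big_chart z tangent_vector[OF c] covector[OF c]
        tangent_vector_component[OF c] covector_component[OF c])
  show "snd (big_chart c) (big_point_at c z) = z"
    unfolding p by (simp add: snd_big_chart z x tangent_vector_component[OF c] covector_component[OF c])
  show "fst (big_point_at c z) = chart_inv c (fst z)"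
    unfolding p using x assms by (simp add: z chart_inv_chart)
qed

lemma big_chart_coordinates:
  assumes "c \<in> A" "m \<in> fst (big_chart c)"
  shows "snd (big_chart c) m \<in> slit (snd c ` fst c)" "fst (snd (big_chart c) m) = snd c (fst m)"
    "fst m \<in> fst c"
proof -
  obtain x y p where m: "m = (x, y, p)" by (cases m)
  have c: "c \<in> charts_at A x" using assms by (simp add: m fst_big_chart charts_at_def)
  show "snd (big_chart c) m \<in> slit (snd c ` fst c)"
    using assms tangent_zero_iff[OF _ c, of y] cotangent_zero_iff[OF _ c, of p]
    by (simp add: m fst_big_chart snd_big_chart)
  show "fst (snd (big_chart c) m) = snd c (fst m)" "fst m \<in> fst c"
    using assms by (simp_all add: m snd_big_chart fst_big_chart)
qed

lemma big_chart_inj: "c \<in> A \<Longrightarrow> inj_on (snd (big_chart c)) (fst (big_chart c))"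
  by (rule inj_on_inverseI[of _ "big_point_at c"]) (rule big_point_at_chart)

lemma big_chart_image:
  assumes c: "c \<in> A"
  shows "snd (big_chart c) ` {m \<in> fst (big_chart c). fst m \<in> W} = slit (snd c ` (fst c \<inter> W))"
proof (intro equalityI subsetI)
  fix z assume "z \<in> snd (big_chart c) ` {m \<in> fst (big_chart c). fst m \<in> W}"
  then obtain m where m: "m \<in> fst (big_chart c)" "fst m \<in> W" "z = snd (big_chart c) m" by auto
  then have "fst z \<in> snd c ` (fst c \<inter> W)"
    using big_chart_coordinates(2,3)[OF c m(1)] by auto
  then show "z \<in> slit (snd c ` (fst c \<inter> W))"
    using big_chart_coordinates(1)[OF c m(1)] m(3) by (auto simp: mem_Times_iff)
next
  fix z assume z: "z \<in> slit (snd c ` (fst c \<inter> W))"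
  then have z': "z \<in> slit (snd c ` fst c)" by auto
  have "fst (big_point_at c z) \<in> W"
    using z c by (auto simp: big_point_at(3)[OF c z'] chart_inv_chart)
  then show "z \<in> snd (big_chart c) ` {m \<in> fst (big_chart c). fst m \<in> W}"
    using big_point_at[OF c z'] by (intro image_eqI[of _ _ "big_point_at c z"]) auto
qed

lemma big_chart_image_all: "c \<in> A \<Longrightarrow> snd (big_chart c) ` fst (big_chart c) = slit (snd c ` fst c)"
  using big_chart_image[of c UNIV] by simp

lemma big_chart_overlap:
  "c \<in> A \<Longrightarrow> snd (big_chart c) ` (fst (big_chart c) \<inter> fst (big_chart d)) = slit (snd c ` (fst c \<inter> fst d))"
proof -
  have "fst (big_chart c) \<inter> fst (big_chart d) = {m \<in> fst (big_chart c). fst m \<in> fst d}"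
    by (auto simp: big_tangent_chart_def)
  then show "c \<in> A \<Longrightarrow> ?thesis" by (simp add: big_chart_image)
qed

lemma big_chart_inv:
  "c \<in> A \<Longrightarrow> z \<in> slit (snd c ` fst c) \<Longrightarrow> chart_inv (big_chart c) z = big_point_at c z"
  unfolding chart_inv_def
  by (rule inv_into_f_eq[OF big_chart_inj]) (simp_all add: big_point_at)

lemma open_slit: "open U \<Longrightarrow> open (slit U)"
  by (intro open_Times) (simp_all add: open_Compl)

text \<open>The fibre coordinates transform by the Jacobian of the old transition map and by the adjoint of
  the Jacobian of its inverse. The latter is expanded in the standard basis, because its smoothness
  is known only for the Jacobian applied to fixed vectors.\<close>

lemma smooth_big_transition:
  assumes c: "c \<in> A" and d: "d \<in> A"
  shows "smooth_on (slit (snd c ` (fst c \<inter> fst d))) (transition (big_chart c) (big_chart d))"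
proof -
  define S where "S = snd c ` (fst c \<inter> fst d)"
  have S: "open S" unfolding S_def by (rule open_overlap[OF c d])
  note op = open_slit[OF S]
  define t where "t = (\<lambda>z :: 'n big_coord. (transition c d (fst z),
    frechet_derivative (transition c d) (at (fst z)) (fst (snd z)),
    \<Sum>b\<in>Basis. (snd (snd z) \<bullet> frechet_derivative (transition d c) (at (transition c d (fst z))) b) *\<^sub>R b))"
  have T: "smooth_on S (transition c d)" unfolding S_def by (rule smooth_transition[OF c d])
  have Tf: "smooth_on (slit S) (\<lambda>z. transition c d (fst z))"
    by (rule smooth_on_compose[OF T smooth_on_fst[OF smooth_on_ident] _ op S]) (use op in auto)
  have "smooth_on (slit S) t"
    unfolding t_def
  proof (intro smooth_on_Pair Tf op)
    show "smooth_on (slit S) (\<lambda>z. frechet_derivative (transition c d) (at (fst z)) (fst (snd z)))"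
      by (rule smooth_on_derivative_apply[OF T _ _ _ op S])
         (auto intro!: smooth_on_fst smooth_on_snd smooth_on_ident op)
    show "smooth_on (slit S) (\<lambda>z. \<Sum>b\<in>Basis. (snd (snd z) \<bullet>
        frechet_derivative (transition d c) (at (transition c d (fst z))) b) *\<^sub>R b)"
    proof (intro smooth_on_sum smooth_on_scaleR smooth_on_inner smooth_on_const smooth_on_snd
        smooth_on_ident op)
      show "smooth_on (slit S) (\<lambda>z. frechet_derivative (transition d c) (at (transition c d (fst z))) b)" for b
        by (rule smooth_on_compose[OF smooth_on_derivative[OF smooth_transition[OF d c]] Tf _ op open_overlap[OF d c]])
           (auto simp: S_def transition_chart c)
    qed
  qed
  then have "smooth_on (slit S) (transition (big_chart c) (big_chart d))"
  proof (rule smooth_on_cong[OF op, rotated])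
    fix z assume z: "z \<in> slit S"
    then obtain m where m: "m \<in> fst (big_chart c)" "m \<in> fst (big_chart d)" "z = snd (big_chart c) m"
      unfolding S_def big_chart_overlap[OF c, symmetric] by auto
    obtain x y p where xyp: "m = (x, y, p)" by (cases m)
    have ca: "c \<in> charts_at A x" "d \<in> charts_at A x"
      using m c d by (simp_all add: xyp fst_big_chart charts_at_def)
    have y: "y d = jacobian c d x (y c)" and p: "\<And>w. p d \<bullet> w = p c \<bullet> jacobian d c x w"
      using m ca by (auto simp: xyp fst_big_chart intro: tangent_spaceD cotangent_spaceD)
    have "transition (big_chart c) (big_chart d) z = snd (big_chart d) m"
      using big_chart_inj[OF c] m by (simp add: transition_def chart_inv_def)
    also have "\<dots> = (snd d x, y d, \<Sum>b\<in>Basis. (p d \<bullet> b) *\<^sub>R b)"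
      by (simp add: xyp snd_big_chart euclidean_representation)
    also have "\<dots> = t z"
      using ca c by (simp add: t_def m(3) xyp snd_big_chart transition_chart charts_at_def y p)
    finally show "t z = transition (big_chart c) (big_chart d) z" by simp
  qed
  then show ?thesis by (simp add: S_def)
qed

lemma smooth_big_tangent_atlas: "smooth_atlas (big_tangent_atlas A)"
  unfolding smooth_atlas_def big_tangent_atlas_def ball_simps
proof (intro conjI ballI)
  fix c assume c: "c \<in> A"
  show "inj_on (snd (big_chart c)) (fst (big_chart c))" by (rule big_chart_inj[OF c])
  show "open (snd (big_chart c) ` fst (big_chart c))"
    by (simp add: big_chart_image_all c open_slit open_chart_image)
  fix d assume d: "d \<in> A"
  show "open (snd (big_chart c) ` (fst (big_chart c) \<inter> fst (big_chart d)))"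
    by (simp add: big_chart_overlap c d open_slit open_overlap)
  show "smooth_on (snd (big_chart c) ` (fst (big_chart c) \<inter> fst (big_chart d)))
      (transition (big_chart c) (big_chart d))"
    by (simp add: big_chart_overlap c d smooth_big_transition)
qed

sublocale big: charted "big_tangent_atlas A"
  by unfold_locales (rule smooth_big_tangent_atlas)

lemma charts_at_big:
  assumes "m \<in> atlas_carrier (big_tangent_atlas A)"
  shows "charts_at (big_tangent_atlas A) m = big_chart ` charts_at A (fst m)"
    "\<exists>c. c \<in> charts_at A (fst m)"
  using assms
  by (auto simp: atlas_carrier_def big_tangent_atlas_def charts_at_def big_tangent_chart_def)

text \<open>In charts the bundle projection is the first coordinate followed by a transition map of the base,
  whose Jacobian is invertible. Since the derivative of a function along a tangent vector can be
  computed in any chart, one chart suffices to test verticality.\<close>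

lemma vertical_bundle_iff:
  assumes m: "m \<in> atlas_carrier (big_tangent_atlas A)" and c: "c \<in> charts_at A (fst m)"
  shows "X \<in> vertical_bundle A m \<longleftrightarrow> X \<in> tangent_space (big_tangent_atlas A) m \<and> fst (X (big_chart c)) = 0"
proof -
  have b: "big_chart c \<in> charts_at (big_tangent_atlas A) m"
    using c by (simp add: charts_at_big[OF m])
  then have mc: "m \<in> fst (big_chart c)" by (rule big.charts_atD)
  have cA: "c \<in> A" using c by (rule charts_atD)
  have D: "((snd d \<circ> fst \<circ> chart_inv (big_chart c)) has_derivative
      (\<lambda>w. jacobian c d (fst m) (fst w))) (at (snd (big_chart c) m))" if d: "d \<in> charts_at A (fst m)" for d
  proof (rule has_derivative_transform_within_open[where f = "\<lambda>z. transition c d (fst z)"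
        and s = "slit (snd c ` (fst c \<inter> fst d))"])
    have "fst (snd (big_chart c) m) = snd c (fst m)"
      by (rule big_chart_coordinates[OF cA mc])
    then show "((\<lambda>z. transition c d (fst z)) has_derivative (\<lambda>w. jacobian c d (fst m) (fst w)))
        (at (snd (big_chart c) m))"
      using has_derivative_compose[OF has_derivative_fst[OF has_derivative_ident], of "transition c d" _ "snd (big_chart c) m"]
        transition_has_derivative[OF c d] by simp
    show "open (slit (snd c ` (fst c \<inter> fst d)))"
      by (intro open_slit open_overlap charts_atD[OF c] charts_atD[OF d])
    show "snd (big_chart c) m \<in> slit (snd c ` (fst c \<inter> fst d))"
      using mc c d unfolding big_chart_image[OF cA, symmetric] by (auto simp: charts_at_def)
    show "transition c d (fst z) = (snd d \<circ> fst \<circ> chart_inv (big_chart c)) z"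
      if z: "z \<in> slit (snd c ` (fst c \<inter> fst d))" for z
    proof -
      have z': "z \<in> slit (snd c ` fst c)" using z by auto
      show ?thesis
        by (simp add: big_chart_inv[OF cA z'] big_point_at(3)[OF cA z'] transition_def)
    qed
  qed
  show ?thesis
  proof (cases "X \<in> tangent_space (big_tangent_atlas A) m")
    case True
    have der: "frechet_derivative (snd d \<circ> fst \<circ> chart_inv b') (at (snd b' m)) (X b') =
        jacobian c d (fst m) (fst (X (big_chart c)))"
      if "b' \<in> charts_at (big_tangent_atlas A) m" "d \<in> charts_at A (fst m)" for b' d
      using big.derivative_along_tangent_vector[OF True that(1) b differentiableI[OF D[OF that(2)]]]
      by (simp add: frechet_derivative_eq[OF D[OF that(2)]])
    have "X \<in> vertical_bundle A m \<longleftrightarrow>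
        (\<forall>b'\<in>charts_at (big_tangent_atlas A) m. \<forall>d\<in>charts_at A (fst m).
          jacobian c d (fst m) (fst (X (big_chart c))) = 0)"
      using True by (simp only: vertical_bundle_def mem_Collect_eq der simp_thms cong: ball_cong)
    also have "\<dots> \<longleftrightarrow> (\<forall>d\<in>charts_at A (fst m). jacobian c d (fst m) (fst (X (big_chart c))) = 0)"
      using b by blast
    also have "\<dots> \<longleftrightarrow> fst (X (big_chart c)) = 0"
      using c jacobian_refl[OF c] linear_0[OF linear_jacobian[OF c]] by metis
    finally show ?thesis using True by simp
  qed (simp add: vertical_bundle_def)
qed

end

section \<open>The distribution as the kernel of the energy\<close>

locale finsler_space = big_tangent A for A :: "('m, real^'n) chart set" +
  fixes F K :: "'m \<times> ('m, real^'n) chart_vec \<Rightarrow> real"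
  assumes finsler: "finsler_structure A F" and cartan: "dual_cartan_structure A F K"
begin

definition F_chart :: "('m, real^'n) chart \<Rightarrow> (real^'n) \<times> (real^'n) \<Rightarrow> real" where
  "F_chart c = F \<circ> chart_inv (tangent_chart A c)"

definition K_chart :: "('m, real^'n) chart \<Rightarrow> (real^'n) \<times> (real^'n) \<Rightarrow> real" where
  "K_chart c = K \<circ> chart_inv (cotangent_chart A c)"

abbreviation legendre_chart :: "('m, real^'n) chart \<Rightarrow> (real^'n) \<times> (real^'n) \<Rightarrow> real^'n" where
  "legendre_chart c \<equiv> fibre_homogeneous.legendre (F_chart c)"

lemma tangent_chart_inv:
  assumes c: "c \<in> charts_at A x"
  shows "chart_inv (tangent_chart A c) (snd c x, v) = (x, tangent_vector c x v)"
  unfolding chart_inv_def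
proof (rule inv_into_f_eq)
  show "inj_on (snd (tangent_chart A c)) (fst (tangent_chart A c))"
    by (rule inj_on_inverseI[of _ "\<lambda>(u, v). (chart_inv c u, tangent_vector c (chart_inv c u) v)"])
       (use charts_atD(1)[OF c] in
         \<open>auto simp: tangent_chart_def chart_inv_chart charts_at_def tangent_vector_of_component\<close>)
qed (use c in \<open>auto simp: tangent_chart_def charts_at_def tangent_vector tangent_vector_component\<close>)

lemma cotangent_chart_inv:
  assumes c: "c \<in> charts_at A x"
  shows "chart_inv (cotangent_chart A c) (snd c x, q) = (x, covector c x q)"
  unfolding chart_inv_def
proof (rule inv_into_f_eq)
  show "inj_on (snd (cotangent_chart A c)) (fst (cotangent_chart A c))"
    by (rule inj_on_inverseI[of _ "\<lambda>(u, q). (chart_inv c u, covector c (chart_inv c u) q)"])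
       (use charts_atD(1)[OF c] in
         \<open>auto simp: cotangent_chart_def chart_inv_chart charts_at_def covector_of_component\<close>)
qed (use c in \<open>auto simp: cotangent_chart_def charts_at_def covector covector_component\<close>)

lemma F_chart_apply: "c \<in> charts_at A x \<Longrightarrow> F_chart c (snd c x, v) = F (x, tangent_vector c x v)"
  by (simp add: F_chart_def tangent_chart_inv)

lemma K_chart_apply: "c \<in> charts_at A x \<Longrightarrow> K_chart c (snd c x, q) = K (x, covector c x q)"
  by (simp add: K_chart_def cotangent_chart_inv)

lemma finsler_metric_eq: "finsler_metric A F c x y = fibre_metric (F_chart c) (snd c x) (y c)"
  by (simp add: finsler_metric_def F_chart_def)

lemma cartan_metric_eq: "cartan_metric A K c x p = fibre_metric (K_chart c) (snd c x) (p c)"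
  by (simp add: cartan_metric_def K_chart_def)

lemma tangent_chart_slit_image:
  assumes c: "c \<in> A"
  shows "snd (tangent_chart A c) ` (fst (tangent_chart A c) \<inter> slit_tangent_bundle A) = snd c ` fst c \<times> - {0}"
proof (intro equalityI subsetI)
  fix z assume "z \<in> snd (tangent_chart A c) ` (fst (tangent_chart A c) \<inter> slit_tangent_bundle A)"
  then obtain x y where "x \<in> fst c" "y \<in> tangent_space A x" "y \<noteq> vec_zero" "z = (snd c x, y c)"
    by (auto simp: tangent_chart_def slit_tangent_bundle_def)
  then show "z \<in> snd c ` fst c \<times> - {0}"
    using tangent_zero_iff[of y x c] c by (auto simp: charts_at_def)
next
  fix z assume "z \<in> snd c ` fst c \<times> (- {0} :: (real^'n) set)"
  then obtain x v where x: "x \<in> fst c" "v \<noteq> 0" "z = (snd c x, v)" by auto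
  have ca: "c \<in> charts_at A x" using c x by (simp add: charts_at_def)
  have "(x, tangent_vector c x v) \<in> fst (tangent_chart A c) \<inter> slit_tangent_bundle A"
    using x c tangent_zero_iff[OF tangent_vector[OF ca] ca]
    by (auto simp: tangent_chart_def slit_tangent_bundle_def tangent_vector[OF ca]
        tangent_vector_component[OF ca] atlas_carrier_def)
  moreover have "snd (tangent_chart A c) (x, tangent_vector c x v) = z"
    by (simp add: tangent_chart_def x tangent_vector_component[OF ca])
  ultimately show "z \<in> snd (tangent_chart A c) ` (fst (tangent_chart A c) \<inter> slit_tangent_bundle A)"
    by (metis image_eqI)
qed

lemma fibre_finsler_chart:
  assumes c: "c \<in> A"
  shows "fibre_finsler (snd c ` fst c) (F_chart c)"
proof
  show "open (snd c ` fst c)" by (rule open_chart_image[OF c])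
  show "smooth_on (snd c ` fst c \<times> - {0}) (F_chart c)"
    using finsler c unfolding finsler_structure_def smooth_fun_on_def F_chart_def
    by (auto simp: tangent_chart_slit_image)
  fix u v :: "real^'n" assume u: "u \<in> snd c ` fst c" and v: "v \<noteq> 0"
  then obtain x where x: "x \<in> fst c" "u = snd c x" by auto
  have ca: "c \<in> charts_at A x" using x c by (simp add: charts_at_def)
  have xA: "x \<in> atlas_carrier A" using x c by (auto simp: atlas_carrier_def)
  define y where "y = tangent_vector c x v"
  have y: "y \<in> tangent_space A x" "y c = v" "y \<noteq> vec_zero"
    using v tangent_zero_iff[OF tangent_vector[OF ca] ca]
    by (auto simp: y_def tangent_vector[OF ca] tangent_vector_component[OF ca])
  have Fy: "F_chart c (u, v) = F (x, y)" by (simp add: x F_chart_apply[OF ca] y_def)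
  show "F_chart c (u, v) \<ge> 0"
    using finsler xA y by (simp add: Fy finsler_structure_def)
  show "F_chart c (u, t *\<^sub>R v) = t * F_chart c (u, v)" if "t > 0" for t
  proof -
    have "tangent_vector c x (t *\<^sub>R v) = vec_scale t y"
      by (rule tangent_eqI[OF tangent_vector[OF ca] vec_scale_tangent[OF y(1)] ca])
         (simp add: tangent_vector_component[OF ca] vec_scale_def y(2))
    then have "F_chart c (u, t *\<^sub>R v) = F (x, vec_scale t y)"
      by (simp add: x F_chart_apply[OF ca])
    then show ?thesis
      using finsler xA y(1) that by (simp add: Fy finsler_structure_def)
  qed
  fix w :: "real^'n" assume w: "w \<noteq> 0"
  have "(x, y) \<in> slit_tangent_bundle A" using xA y by (simp add: slit_tangent_bundle_def)
  then have "(\<Sum>i\<in>UNIV. \<Sum>j\<in>UNIV. finsler_metric A F c x y $ i $ j * w $ i * w $ j) > 0"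
    using finsler ca w unfolding finsler_structure_def by blast
  then show "(\<Sum>i\<in>UNIV. \<Sum>j\<in>UNIV. fibre_metric (F_chart c) u v $ i $ j * w $ i * w $ j) > 0"
    by (simp add: finsler_metric_eq x y(2))
qed

text \<open>Being the fibre derivative of a function on the tangent bundle, the Legendre transform
  transforms like a covector.\<close>

lemma legendre_chart_covariant:
  assumes c: "c \<in> charts_at A x" and d: "d \<in> charts_at A x"
    and y: "y \<in> tangent_space A x" "y \<noteq> vec_zero"
  shows "legendre_chart c (snd c x, y c) \<bullet> w = legendre_chart d (snd d x, y d) \<bullet> jacobian c d x w"
proof -
  interpret c: fibre_finsler "snd c ` fst c" "F_chart c"
    by (rule fibre_finsler_chart[OF charts_atD(1)[OF c]])
  interpret d: fibre_finsler "snd d ` fst d" "F_chart d"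
    by (rule fibre_finsler_chart[OF charts_atD(1)[OF d]])
  have nz: "y c \<noteq> 0" "y d \<noteq> 0"
    using tangent_zero_iff[OF y(1) c] tangent_zero_iff[OF y(1) d] y(2) by auto
  have im: "snd c x \<in> snd c ` fst c" "snd d x \<in> snd d ` fst d"
    using c d by (auto simp: charts_at_def)
  have yd: "y d = jacobian c d x (y c)" by (rule tangent_spaceD[OF y(1) c d])
  have "tangent_vector d x (jacobian c d x \<zeta>) = tangent_vector c x \<zeta>" for \<zeta>
    using tangent_vector_of_component[OF tangent_vector[OF c] d, of \<zeta>] d
    by (simp add: tangent_vector_def)
  then have eq: "c.energy (snd c x, \<zeta>) = d.energy (snd d x, jacobian c d x \<zeta>)" for \<zeta>
    by (simp add: c.energy_def d.energy_def F_chart_apply c d)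
  have lin: "(jacobian c d x has_derivative jacobian c d x) (at (y c))"
    by (rule bounded_linear_imp_has_derivative)
       (simp add: linear_conv_bounded_linear[symmetric] linear_jacobian[OF c d])
  have "((\<lambda>\<zeta>. c.energy (snd c x, \<zeta>)) has_derivative
      (\<lambda>w. frechet_derivative d.energy (at (snd d x, y d)) (0, jacobian c d x w))) (at (y c))"
    unfolding eq
    by (rule has_derivative_compose[OF lin
          has_derivative_slice[OF d.differentiable_energy[OF im(2) nz(2)], unfolded yd], folded yd])
  then have "frechet_derivative c.energy (at (snd c x, y c)) (0, w) =
      frechet_derivative d.energy (at (snd d x, y d)) (0, jacobian c d x w)"
    by (rule has_derivative_unique_apply[OF has_derivative_slice[OF c.differentiable_energy[OF im(1) nz(1)]]])
  then show ?thesis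
    using c.inner_legendre[OF im(1) nz(1), of w] d.inner_legendre[OF im(2) nz(2), of "jacobian c d x w"]
    by (simp add: inner_commute)
qed

text \<open>The definition of the dual structure asks for the Legendre relation in all charts around the point
  simultaneously. By covariance it is enough to solve it in the chart at hand.\<close>

lemma K_chart_eq:
  assumes c: "c \<in> A" and u: "u \<in> snd c ` fst c" and q: "q \<noteq> 0"
  shows "K_chart c (u, q) = F_chart c (u, fibre_finsler.legendre_inv (F_chart c) (u, q))"
proof -
  interpret fibre_finsler "snd c ` fst c" "F_chart c" by (rule fibre_finsler_chart[OF c])
  obtain x where x: "x \<in> fst c" "u = snd c x" using u by auto
  have ca: "c \<in> charts_at A x" using x c by (simp add: charts_at_def)
  have xA: "x \<in> atlas_carrier A" using x c by (auto simp: atlas_carrier_def)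
  define y where "y = tangent_vector c x (legendre_inv (u, q))"
  have y: "y \<in> tangent_space A x" "y c = legendre_inv (u, q)" "y \<noteq> vec_zero"
    using legendre_inv(1)[OF u q] tangent_zero_iff[OF tangent_vector[OF ca] ca]
    by (auto simp: y_def tangent_vector[OF ca] tangent_vector_component[OF ca])
  define p where "p = (\<lambda>d. if d \<in> charts_at A x then legendre_chart d (snd d x, y d) else 0)"
  have p: "p \<in> cotangent_space A x"
  proof (rule cotangent_spaceI)
    show "p c \<bullet> w = p d \<bullet> jacobian c d x w" if "c \<in> charts_at A x" "d \<in> charts_at A x" for c d w
      using legendre_chart_covariant[OF that y(1,3), of w] that by (simp only: p_def if_True)
  qed (simp add: p_def)
  have "p c = q" using ca legendre_inv(2)[OF u q] by (simp add: p_def y(2) x)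
  then have pq: "p = covector c x q"
    using covector_of_component[OF p ca] by simp
  have "p d $ i = (\<Sum>j\<in>UNIV. finsler_metric A F d x y $ i $ j * y d $ j)"
    if d: "d \<in> charts_at A x" for d i
  proof -
    interpret d: fibre_finsler "snd d ` fst d" "F_chart d"
      by (rule fibre_finsler_chart[OF charts_atD(1)[OF d]])
    have "snd d x \<in> snd d ` fst d" "y d \<noteq> 0"
      using d tangent_zero_iff[OF y(1) d] y(3) by (auto simp: charts_at_def)
    from d.fibre_metric_contract[OF this] show ?thesis
      by (simp add: p_def d finsler_metric_eq)
  qed
  then have "K (x, p) = F (x, y)"
    using cartan xA y p unfolding dual_cartan_structure_def by blast
  then show ?thesis
    by (simp add: x K_chart_apply[OF ca] F_chart_apply[OF ca] pq y_def)
qed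

lemma fibre_homogeneous_K_chart:
  assumes c: "c \<in> A"
  shows "fibre_homogeneous (snd c ` fst c) (K_chart c)"
proof -
  interpret fibre_finsler "snd c ` fst c" "F_chart c" by (rule fibre_finsler_chart[OF c])
  interpret K: fibre_homogeneous "snd c ` fst c" "\<lambda>(u, q). F_chart c (u, legendre_inv (u, q))"
    by (rule fibre_homogeneous_dual)
  show ?thesis
  proof
    show "smooth_on (snd c ` fst c \<times> - {0}) (K_chart c)"
    proof (rule smooth_on_cong[OF K.open_slit _ K.smooth])
      fix z assume "z \<in> snd c ` fst c \<times> (- {0} :: (real^'n) set)"
      then show "(case z of (u, q) \<Rightarrow> F_chart c (u, legendre_inv (u, q))) = K_chart c z"
        using K_chart_eq[OF c, of "fst z" "snd z"] by (simp add: mem_Times_iff case_prod_beta)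
    qed
    show "K_chart c (u, t *\<^sub>R v) = t * K_chart c (u, v)" if "u \<in> snd c ` fst c" "v \<noteq> 0" "t > 0" for u v t
      using K.homogeneous[OF that] that by (simp add: K_chart_eq[OF c] del: o_apply)
  qed (rule open_base)
qed

definition total_energy :: "('m, 'n) big_point \<Rightarrow> real" where
  "total_energy = (\<lambda>(x, y, p). (F (x, y))\<^sup>2 + (K (x, p))\<^sup>2)"

abbreviation energy_chart :: "('m, real^'n) chart \<Rightarrow> 'n big_coord \<Rightarrow> real" where
  "energy_chart c \<equiv> total_energy \<circ> chart_inv (big_chart c)"

lemma energy_chart_eq:
  assumes c: "c \<in> A" and z: "(u, v, q) \<in> slit (snd c ` fst c)"
  shows "energy_chart c (u, v, q) = (F_chart c (u, v))\<^sup>2 + (K_chart c (u, q))\<^sup>2"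
proof -
  obtain x where x: "x \<in> fst c" "u = snd c x" using z by auto
  have "c \<in> charts_at A x" using x c by (simp add: charts_at_def)
  then show ?thesis
    using c x(1) unfolding o_apply big_chart_inv[OF c z]
    by (simp add: x(2) big_point_at_def total_energy_def Let_def
        F_chart_apply K_chart_apply chart_inv_chart)
qed

lemma energy_chart_eq':
  "c \<in> A \<Longrightarrow> z \<in> slit (snd c ` fst c) \<Longrightarrow>
    energy_chart c z = (F_chart c (fst z, fst (snd z)))\<^sup>2 + (K_chart c (fst z, snd (snd z)))\<^sup>2"
  using energy_chart_eq[of c "fst z" "fst (snd z)" "snd (snd z)"] by simp

lemma smooth_energy_chart:
  assumes c: "c \<in> A"
  shows "smooth_on (slit (snd c ` fst c)) (energy_chart c)"
proof -
  interpret F: fibre_finsler "snd c ` fst c" "F_chart c" by (rule fibre_finsler_chart[OF c])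
  interpret K: fibre_homogeneous "snd c ` fst c" "K_chart c" by (rule fibre_homogeneous_K_chart[OF c])
  note op = open_slit[OF F.open_base]
  have "smooth_on (slit (snd c ` fst c)) (\<lambda>z. F.energy (fst z, fst (snd z)) + K.energy (fst z, snd (snd z)))"
    by (intro smooth_on_add smooth_on_compose[OF F.smooth_energy _ _ op F.open_slit]
        smooth_on_compose[OF K.smooth_energy _ _ op K.open_slit]
        smooth_on_Pair smooth_on_fst smooth_on_snd smooth_on_ident op) auto
  then show ?thesis
    by (rule smooth_on_cong[OF op, rotated])
       (simp only: energy_chart_eq'[OF c] F.energy_def K.energy_def)
qed

lemma cone_function_energy:
  assumes c: "c \<in> A" and T: "orthogonal_transformation T"
  shows "cone_function (snd c ` fst c) (energy_chart c) T"
proof -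
  interpret F: fibre_finsler "snd c ` fst c" "F_chart c" by (rule fibre_finsler_chart[OF c])
  interpret K: fibre_homogeneous "snd c ` fst c" "K_chart c" by (rule fibre_homogeneous_K_chart[OF c])
  show ?thesis
  proof
    fix u v q :: "real^'n" assume z: "u \<in> snd c ` fst c" "v \<noteq> 0" "q \<noteq> 0"
    then have eq: "energy_chart c (u, t *\<^sub>R v, t *\<^sub>R q) =
        (F_chart c (u, t *\<^sub>R v))\<^sup>2 + (K_chart c (u, t *\<^sub>R q))\<^sup>2" if "t > 0" for t
      using that by (intro energy_chart_eq[OF c]) auto
    show "energy_chart c (u, v, q) > 0"
      using eq[of 1] F.energy_pos[OF z(1,2)]
      by (simp add: F.energy_def add_pos_nonneg del: o_apply)
    show "energy_chart c (u, t *\<^sub>R v, t *\<^sub>R q) = t\<^sup>2 * energy_chart c (u, v, q)" if "t > 0" for t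
      using eq[OF that] eq[of 1] F.homogeneous[OF z(1,2) that] K.homogeneous[OF z(1,3) that]
      by (simp add: power_mult_distrib distrib_left del: o_apply)
  qed (use T F.open_base smooth_energy_chart[OF c] in auto)
qed

text \<open>By Euler's relation for both structures, pairing a vertical vector with the Liouville field
  is half the derivative of \<open>F\<^sup>2 + K\<^sup>2\<close> along this vector. The left-hand side is computed in the
  one chart chosen in the definition of the metric, the right-hand side in any chart.\<close>

lemma big_metric_liouville:
  assumes m: "m \<in> atlas_carrier (big_tangent_atlas A)" and X: "X \<in> vertical_bundle A m"
    and b: "b \<in> charts_at (big_tangent_atlas A) m"
  shows "big_metric A F K m X (vec_scale t (liouville_field A m)) =
    t * frechet_derivative (total_energy \<circ> chart_inv b) (at (snd b m)) (X b) / 2"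
proof -
  define c where "c = (SOME c. c \<in> charts_at A (fst m))"
  have c: "c \<in> charts_at A (fst m)"
    unfolding c_def by (rule someI_ex[OF charts_at_big(2)[OF m]])
  have cA: "c \<in> A" by (rule charts_atD[OF c])
  have bc: "big_chart c \<in> charts_at (big_tangent_atlas A) m"
    using c by (simp add: charts_at_big[OF m])
  then have mc: "m \<in> fst (big_chart c)" by (rule big.charts_atD)
  obtain x y p where xyp: "m = (x, y, p)" by (cases m)
  obtain X1 X2 where Xc: "X (big_chart c) = (0, X1, X2)"
    using X vertical_bundle_iff[OF m c] by (metis prod.collapse)
  have slit: "(snd c x, y c, p c) \<in> slit (snd c ` fst c)"
    using big_chart_coordinates(1)[OF cA mc] by (simp add: xyp snd_big_chart)
  then have u: "snd c x \<in> snd c ` fst c" "y c \<noteq> 0" "p c \<noteq> 0" by auto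
  interpret F: fibre_finsler "snd c ` fst c" "F_chart c" by (rule fibre_finsler_chart[OF cA])
  interpret K: fibre_homogeneous "snd c ` fst c" "K_chart c" by (rule fibre_homogeneous_K_chart[OF cA])
  have lf: "((\<lambda>z. (fst z, fst (snd z))) has_derivative (\<lambda>a. (fst a, fst (snd a)))) (at z)"
    and ls: "((\<lambda>z. (fst z, snd (snd z))) has_derivative (\<lambda>a. (fst a, snd (snd a)))) (at z)"
    for z :: "'n big_coord"
    by (intro has_derivative_Pair has_derivative_fst has_derivative_snd has_derivative_ident)+
  have "((\<lambda>z. F.energy (fst z, fst (snd z)) + K.energy (fst z, snd (snd z))) has_derivative
      (\<lambda>a. frechet_derivative F.energy (at (snd c x, y c)) (fst a, fst (snd a)) +
        frechet_derivative K.energy (at (snd c x, p c)) (fst a, snd (snd a)))) (at (snd c x, y c, p c))"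
    by (intro has_derivative_add has_derivative_compose[OF lf] has_derivative_compose[OF ls])
       (use F.differentiable_energy[OF u(1,2)] K.differentiable_energy[OF u(1,3)] in
         \<open>simp_all add: frechet_derivative_works\<close>)
  then have "(energy_chart c has_derivative
      (\<lambda>a. frechet_derivative F.energy (at (snd c x, y c)) (fst a, fst (snd a)) +
        frechet_derivative K.energy (at (snd c x, p c)) (fst a, snd (snd a)))) (at (snd c x, y c, p c))"
    by (rule has_derivative_transform_within_open[OF _ open_slit[OF F.open_base] slit])
       (simp only: energy_chart_eq'[OF cA] F.energy_def K.energy_def)
  then have D: "frechet_derivative (energy_chart c) (at (snd (big_chart c) m)) (X (big_chart c)) =
      frechet_derivative F.energy (at (snd c x, y c)) (0, X1) +
      frechet_derivative K.energy (at (snd c x, p c)) (0, X2)"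
    and diff: "energy_chart c differentiable (at (snd (big_chart c) m))"
    by (auto simp: frechet_derivative_eq Xc xyp snd_big_chart intro: differentiableI)
  have L: "vec_scale t (liouville_field A m) (big_chart c) = (0, t *\<^sub>R y c, t *\<^sub>R p c)"
    using bc by (simp add: vec_scale_def liouville_field_def xyp snd_big_chart)
  have scale: "(\<Sum>i\<in>UNIV. \<Sum>j\<in>UNIV. M $ i $ j * a $ i * (t *\<^sub>R b) $ j) =
      t * (\<Sum>i\<in>UNIV. \<Sum>j\<in>UNIV. M $ i $ j * a $ i * b $ j)" for M :: "real^'n^'n" and a b
    by (simp add: sum_distrib_left mult_ac)
  have "big_metric A F K m X (vec_scale t (liouville_field A m)) =
      t * (frechet_derivative F.energy (at (snd c x, y c)) (0, X1) / 2) +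
      t * (frechet_derivative K.energy (at (snd c x, p c)) (0, X2) / 2)"
    unfolding F.fibre_metric_contract2[OF u(1,2), symmetric]
      K.fibre_metric_contract2[OF u(1,3), symmetric] xyp big_metric_def prod.case Let_def
    unfolding c_def[unfolded xyp fst_conv, symmetric] Xc L[unfolded xyp] prod.case scale
      finsler_metric_eq cartan_metric_eq
    by simp
  also have "\<dots> = t * frechet_derivative (energy_chart c) (at (snd (big_chart c) m)) (X (big_chart c)) / 2"
    by (simp add: D distrib_left add_divide_distrib)
  also have "frechet_derivative (energy_chart c) (at (snd (big_chart c) m)) (X (big_chart c)) =
      frechet_derivative (total_energy \<circ> chart_inv b) (at (snd b m)) (X b)"
    using X by (intro big.derivative_along_tangent_vector[OF _ b bc diff, symmetric])
      (simp add: vertical_bundle_def)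
  finally show ?thesis .
qed

text \<open>This description no longer mentions the metric: two functions of the position, the base point and
  \<open>F\<^sup>2 + K\<^sup>2\<close>, have to be constant to first order along \<open>X\<close>. It is the source of integrability.\<close>

lemma distribution_iff:
  assumes m: "m \<in> atlas_carrier (big_tangent_atlas A)" and c: "c \<in> charts_at A (fst m)"
  shows "X \<in> vertical_liouville_distribution A F K m \<longleftrightarrow>
    X \<in> tangent_space (big_tangent_atlas A) m \<and> fst (X (big_chart c)) = 0 \<and>
    frechet_derivative (energy_chart c) (at (snd (big_chart c) m)) (X (big_chart c)) = 0"
proof -
  have b: "big_chart c \<in> charts_at (big_tangent_atlas A) m"
    using c by (simp add: charts_at_big[OF m])
  have "X \<in> vertical_liouville_distribution A F K m \<longleftrightarrow> X \<in> vertical_bundle A m \<and>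
      (\<forall>t. big_metric A F K m X (vec_scale t (liouville_field A m)) = 0)"
    by (auto simp: vertical_liouville_distribution_def liouville_line_def)
  also have "\<dots> \<longleftrightarrow> X \<in> vertical_bundle A m \<and>
      (\<forall>t. t * frechet_derivative (energy_chart c) (at (snd (big_chart c) m)) (X (big_chart c)) / 2 = 0)"
    by (rule conj_cong[OF refl]) (simp only: big_metric_liouville[OF m _ b])
  also have "\<dots> \<longleftrightarrow> X \<in> vertical_bundle A m \<and>
      frechet_derivative (energy_chart c) (at (snd (big_chart c) m)) (X (big_chart c)) = 0"
    by (auto dest: spec[of _ 1])
  finally show ?thesis by (simp add: vertical_bundle_iff[OF m c])
qed

section \<open>Integrability\<close>

lemma distribution_involutive:
  "involutive (big_tangent_atlas A) (vertical_liouville_distribution A F K)"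
  unfolding involutive_def
proof (intro allI impI ballI; elim conjE)
  let ?D = "vertical_liouville_distribution A F K"
  fix W X Y m
  assume W: "openin (atlas_topology (big_tangent_atlas A)) W" and mW: "m \<in> W"
    and X: "smooth_section_on (big_tangent_atlas A) ?D W X"
    and Y: "smooth_section_on (big_tangent_atlas A) ?D W Y"
  have WB: "W \<subseteq> atlas_carrier (big_tangent_atlas A)"
    using W by (simp add: openin_atlas_topology[OF big.atlas])
  then have m: "m \<in> atlas_carrier (big_tangent_atlas A)" using mW by auto
  obtain c where c: "c \<in> charts_at A (fst m)" using charts_at_big(2)[OF m] by auto
  have cA: "c \<in> A" by (rule charts_atD[OF c])
  have b: "big_chart c \<in> charts_at (big_tangent_atlas A) m"
    using c by (simp add: charts_at_big[OF m])
  have near: "frechet_derivative (energy_chart c) (at (snd (big_chart c) m')) (v (big_chart c)) = 0"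
    "fst (v (big_chart c)) = 0"
    if "m' \<in> W" "big_chart c \<in> charts_at (big_tangent_atlas A) m'" "v \<in> ?D m'" for m' v
  proof -
    have "c \<in> charts_at A (fst m')"
      using big_chart_coordinates(3)[OF cA big.charts_atD(2)[OF that(2)]] cA by (simp add: charts_at_def)
    then show "frechet_derivative (energy_chart c) (at (snd (big_chart c) m')) (v (big_chart c)) = 0"
      "fst (v (big_chart c)) = 0"
      using distribution_iff[of m' c v] that WB by auto
  qed
  let ?Z = "lie_bracket (big_tangent_atlas A) X Y m"
  have "frechet_derivative (energy_chart c) (at (snd (big_chart c) m)) (?Z (big_chart c)) = 0"
    by (rule big.lie_bracket_annihilates[OF W mW b X Y])
       (use near(1) in \<open>simp_all add: big_chart_image_all cA smooth_energy_chart del: o_apply\<close>)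
  moreover have "fst (?Z (big_chart c)) = 0"
  proof -
    have D: "frechet_derivative ((fst \<circ> snd (big_chart c)) \<circ> chart_inv (big_chart c)) (at (snd (big_chart c) m')) = fst"
      if "m' \<in> fst (big_chart c)" for m'
    proof (rule frechet_derivative_eq, rule has_derivative_transform_within_open)
      show "(fst has_derivative fst) (at (snd (big_chart c) m'))"
        by (rule bounded_linear_imp_has_derivative[OF bounded_linear_fst])
      show "open (snd (big_chart c) ` fst (big_chart c))"
        by (rule big.open_chart_image[OF big.charts_atD(1)[OF b]])
    qed (use that big.charts_atD[OF b] in \<open>auto simp: big.chart_inv_chart\<close>)
    have "frechet_derivative ((fst \<circ> snd (big_chart c)) \<circ> chart_inv (big_chart c)) (at (snd (big_chart c) m))
        (?Z (big_chart c)) = 0"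
    proof (rule big.lie_bracket_annihilates[OF W mW b X Y])
      have op: "open (snd (big_chart c) ` fst (big_chart c))"
        by (rule big.open_chart_image[OF big.charts_atD(1)[OF b]])
      show "smooth_on (snd (big_chart c) ` fst (big_chart c))
          ((fst \<circ> snd (big_chart c)) \<circ> chart_inv (big_chart c))"
        by (rule smooth_on_cong[OF op _ smooth_on_linear[OF bounded_linear_fst op]])
           (use big.charts_atD[OF b] in \<open>auto simp: big.chart_inv_chart\<close>)
    qed (use near(2) D big.charts_atD(2) in \<open>simp del: o_apply\<close>)
    then show ?thesis by (simp add: D[OF big.charts_atD(2)[OF b]] del: o_apply)
  qed
  ultimately show "?Z \<in> ?D m"
    using big.lie_bracket_tangent[OF W mW X Y] by (simp add: distribution_iff[OF m c])
qed

text \<open>The index \<open>k\<close> names the coordinate that stores the energy. It is the same for all charts,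
  because the slices of all charts of a foliation are parallel to one subspace.\<close>

definition leaf_chart :: "'n \<Rightarrow> ('m, real^'n) chart \<Rightarrow> (real^'n \<Rightarrow> real^'n) \<Rightarrow>
    (('m, 'n) big_point, 'n big_coord) chart" where
  "leaf_chart k c T = recoordinatize (big_chart c) (cone_function.region (snd c ` fst c) k T)
    (cone_function.straighten (energy_chart c) k T)"

definition leaf_atlas :: "'n \<Rightarrow> (('m, 'n) big_point, 'n big_coord) chart set" where
  "leaf_atlas k = {leaf_chart k c T | c T. c \<in> A \<and> orthogonal_transformation T}"

lemma coordinate_change_leaf_chart:
  assumes c: "c \<in> A" and T: "orthogonal_transformation T"
  shows "coordinate_change (big_tangent_atlas A) (big_chart c)
    (cone_function.region (snd c ` fst c) k T) (cone_function.straighten (energy_chart c) k T)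
    (cone_function.unstraighten (energy_chart c) k T)"
proof -
  interpret cone_function "snd c ` fst c" "energy_chart c" k T
    by (rule cone_function_energy[OF c T])
  show ?thesis
  proof
    show "region \<subseteq> snd (big_chart c) ` fst (big_chart c)"
      using region_subset by (simp add: big_chart_image_all[OF c])
    show "big_chart c \<in> big_tangent_atlas A" using c by (simp add: big_tangent_atlas_def)
  qed (use open_region smooth_straighten smooth_unstraighten open_straight_region
      unstraighten_straighten in \<open>simp_all add: straighten_image\<close>)
qed

lemma leaf_chart_maximal_atlas:
  "c \<in> A \<Longrightarrow> orthogonal_transformation T \<Longrightarrow> leaf_chart k c T \<in> maximal_atlas (big_tangent_atlas A)"
  unfolding leaf_chart_def
  by (rule coordinate_change.recoordinatize_maximal_atlas[OF coordinate_change_leaf_chart])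

lemma leaf_chart_coordinates:
  assumes c: "c \<in> A" and T: "orthogonal_transformation T" and m: "m \<in> fst (leaf_chart k c T)"
  shows "m \<in> fst (big_chart c)" "chart_inv (leaf_chart k c T) (snd (leaf_chart k c T) m) = m"
    "fst (snd (leaf_chart k c T) m) = snd c (fst m)"
    "fst (snd (snd (leaf_chart k c T) m)) $ k = total_energy m"
proof -
  interpret cone_function "snd c ` fst c" "energy_chart c" k T
    by (rule cone_function_energy[OF c T])
  show mc: "m \<in> fst (big_chart c)"
    using m by (simp add: leaf_chart_def recoordinatize_def)
  show "chart_inv (leaf_chart k c T) (snd (leaf_chart k c T) m) = m"
    using m unfolding leaf_chart_def
    by (rule coordinate_change.recoordinatize_inv[OF coordinate_change_leaf_chart[OF c T]])
  show "fst (snd (leaf_chart k c T) m) = snd c (fst m)"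
    using big_chart_coordinates(2)[OF c mc]
    by (simp add: leaf_chart_def recoordinatize_def straighten_coordinates)
  show "fst (snd (snd (leaf_chart k c T) m)) $ k = total_energy m"
    using mc by (simp add: leaf_chart_def recoordinatize_def straighten_coordinates
        big_chart_inv[OF c big_chart_coordinates(1)[OF c mc]] big_point_at_chart[OF c mc])
qed

lemma leaf_atlas_carrier: "atlas_carrier (leaf_atlas k) = atlas_carrier (big_tangent_atlas A)"
proof (intro equalityI subsetI)
  fix m assume "m \<in> atlas_carrier (leaf_atlas k)"
  then obtain c T where "c \<in> A" "orthogonal_transformation T" "m \<in> fst (leaf_chart k c T)"
    unfolding atlas_carrier_def leaf_atlas_def by blast
  then show "m \<in> atlas_carrier (big_tangent_atlas A)"
    using leaf_chart_coordinates(1) unfolding atlas_carrier_def big_tangent_atlas_def by blast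
next
  fix m assume m: "m \<in> atlas_carrier (big_tangent_atlas A)"
  then obtain c where c: "c \<in> charts_at A (fst m)" using charts_at_big(2) by blast
  have cA: "c \<in> A" by (rule charts_atD[OF c])
  have mc: "m \<in> fst (big_chart c)"
    using charts_at_big(1)[OF m] c big.charts_atD(2) by blast
  obtain u v q where z: "snd (big_chart c) m = (u, v, q)" by (cases "snd (big_chart c) m")
  have slit: "u \<in> snd c ` fst c" "v \<noteq> 0" "q \<noteq> 0"
    using big_chart_coordinates(1)[OF cA mc] by (auto simp: z)
  have "norm v = norm (norm v *\<^sub>R axis k (1 :: real))" by simp
  then obtain T :: "real^'n \<Rightarrow> real^'n"
    where T': "orthogonal_transformation T" "T v = norm v *\<^sub>R axis k 1"
    by (rule orthogonal_transformation_exists)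
  interpret cone_function "snd c ` fst c" "energy_chart c" k T
    by (rule cone_function_energy[OF cA T'(1)])
  have "m \<in> fst (leaf_chart k c T)"
    using mc slit by (simp add: leaf_chart_def recoordinatize_def region_def z T'(2))
  then show "m \<in> atlas_carrier (leaf_atlas k)"
    using cA T'(1) unfolding atlas_carrier_def leaf_atlas_def by blast
qed

text \<open>The transverse coordinates of a leaf chart are the base point and the total energy. They do not
  depend on the fibre chart, so two points in a common plaque of one leaf chart agree in the
  transverse coordinates of any other.\<close>

lemma foliation_leaf_atlas:
  "foliation (big_tangent_atlas A) (2 * CARD('n) - 1) (leaf_space k) (leaf_atlas k)"
  unfolding foliation_def
proof (intro conjI ballI)
  show "leaf_atlas k \<subseteq> maximal_atlas (big_tangent_atlas A)"
    using leaf_chart_maximal_atlas by (auto simp: leaf_atlas_def)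
  fix c' d' m assume c': "c' \<in> leaf_atlas k" and d': "d' \<in> leaf_atlas k" and m: "m \<in> fst c' \<inter> fst d'"
  obtain c S where c: "c \<in> A" "orthogonal_transformation S" "c' = leaf_chart k c S"
    using c' by (auto simp: leaf_atlas_def)
  obtain d T where d: "d \<in> A" "orthogonal_transformation T" "d' = leaf_chart k d T"
    using d' by (auto simp: leaf_atlas_def)
  have "smooth_atlas (insert d' (big_tangent_atlas A))"
    using leaf_chart_maximal_atlas[OF d(1,2)] by (simp add: maximal_atlas_def d(3))
  then have "open (snd (big_chart c) ` (fst (big_chart c) \<inter> fst d'))"
    using c(1) by (simp add: smooth_atlas_def big_tangent_atlas_def)
  then have op: "open (snd c' ` (fst c' \<inter> fst d'))"
    using coordinate_change.open_image_restrict[OF coordinate_change_leaf_chart[OF c(1,2)]]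
    by (simp add: c(3) leaf_chart_def)
  show "\<exists>U. open U \<and> snd c' m \<in> U \<and> U \<subseteq> snd c' ` (fst c' \<inter> fst d') \<and>
      (\<forall>u\<in>U. \<forall>u'\<in>U. u - u' \<in> leaf_space k \<longrightarrow> transition c' d' u - transition c' d' u' \<in> leaf_space k)"
  proof (intro exI conjI ballI impI)
    fix u u' assume u: "u \<in> snd c' ` (fst c' \<inter> fst d')" and u': "u' \<in> snd c' ` (fst c' \<inter> fst d')"
      and L: "u - u' \<in> leaf_space k"
    obtain a where a: "a \<in> fst c'" "a \<in> fst d'" "u = snd c' a" using u by auto
    obtain a' where a': "a' \<in> fst c'" "a' \<in> fst d'" "u' = snd c' a'" using u' by auto
    note ca = leaf_chart_coordinates[OF c(1,2) a(1)[unfolded c(3)]]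
    note ca' = leaf_chart_coordinates[OF c(1,2) a'(1)[unfolded c(3)]]
    note da = leaf_chart_coordinates[OF d(1,2) a(2)[unfolded d(3)]]
    note da' = leaf_chart_coordinates[OF d(1,2) a'(2)[unfolded d(3)]]
    have "snd c (fst a) = snd c (fst a')" "total_energy a = total_energy a'"
      using L ca(3,4) ca'(3,4) by (simp_all add: leaf_space_def a a' c(3))
    moreover have "fst a \<in> fst c" "fst a' \<in> fst c"
      using big_chart_coordinates(3) c(1) ca(1) ca'(1) by auto
    ultimately have "fst a = fst a'" "total_energy a = total_energy a'"
      using chart_inj[OF c(1)] by (auto dest: inj_onD)
    moreover have "transition c' d' u = snd d' a" "transition c' d' u' = snd d' a'"
      using ca(2) ca'(2) by (simp_all add: transition_def a a' c(3))
    ultimately show "transition c' d' u - transition c' d' u' \<in> leaf_space k"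
      using da(3,4) da'(3,4) by (simp add: leaf_space_def d(3))
  qed (use op m in auto)
qed (simp_all add: subspace_leaf_space dim_leaf_space leaf_atlas_carrier)

text \<open>A vector is tangent to a plaque when it annihilates the base point and the stored energy, which is
  the description of the distribution as a kernel.\<close>

lemma tangent_to_leaf_atlas:
  "tangent_to_foliation (big_tangent_atlas A) (leaf_space k) (leaf_atlas k)
    (vertical_liouville_distribution A F K)"
  unfolding tangent_to_foliation_def
proof (intro ballI set_eqI)
  fix c' m v assume c': "c' \<in> leaf_atlas k" and mc': "m \<in> fst c'"
  obtain c T where c: "c \<in> A" and T: "orthogonal_transformation T" and c'_eq: "c' = leaf_chart k c T"
    using c' by (auto simp: leaf_atlas_def)
  interpret cone_function "snd c ` fst c" "energy_chart c" k T
    by (rule cone_function_energy[OF c T])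
  have m: "m \<in> atlas_carrier (big_tangent_atlas A)"
    using c' mc' leaf_atlas_carrier[of k] by (auto simp: atlas_carrier_def)
  have mc: "m \<in> fst (big_chart c)"
    using leaf_chart_coordinates(1)[OF c T] mc' by (simp add: c'_eq)
  have ca: "c \<in> charts_at A (fst m)"
    using c big_chart_coordinates(3)[OF c mc] by (simp add: charts_at_def)
  have b: "big_chart c \<in> charts_at (big_tangent_atlas A) m"
    using ca by (simp add: charts_at_big[OF m])
  have z: "snd (big_chart c) m \<in> region"
    using mc' by (simp add: c'_eq leaf_chart_def recoordinatize_def)
  have tr: "((snd c' \<circ> chart_inv (big_chart c)) has_derivative
      frechet_derivative straighten (at (snd (big_chart c) m))) (at (snd (big_chart c) m))"
  proof (rule has_derivative_transform_within_open[OF smooth_on_has_derivative[OF smooth_straighten z] open_region z])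
    fix w assume "w \<in> region"
    then have w: "w \<in> slit (snd c ` fst c)" using region_subset by auto
    show "straighten w = (snd c' \<circ> chart_inv (big_chart c)) w"
      by (simp add: c'_eq leaf_chart_def recoordinatize_def big_chart_inv[OF c w] big_point_at(2)[OF c w])
  qed
  have eq: "frechet_derivative (transition b' c') (at (snd b' m)) (v b') =
      frechet_derivative straighten (at (snd (big_chart c) m)) (v (big_chart c))"
    if "v \<in> tangent_space (big_tangent_atlas A) m" "b' \<in> charts_at (big_tangent_atlas A) m" for b'
    using big.derivative_along_tangent_vector[OF that b differentiableI[OF tr]]
    by (simp add: frechet_derivative_eq[OF tr] transition_def)
  have "v \<in> {v \<in> tangent_space (big_tangent_atlas A) m. \<forall>b\<in>charts_at (big_tangent_atlas A) m.
        frechet_derivative (transition b c') (at (snd b m)) (v b) \<in> leaf_space k} \<longleftrightarrow>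
      v \<in> tangent_space (big_tangent_atlas A) m \<and>
      frechet_derivative straighten (at (snd (big_chart c) m)) (v (big_chart c)) \<in> leaf_space k"
  proof (cases "v \<in> tangent_space (big_tangent_atlas A) m")
    case True
    then show ?thesis using eq[OF True] b by (simp only: mem_Collect_eq simp_thms cong: ball_cong) blast
  qed simp
  then show "v \<in> vertical_liouville_distribution A F K m \<longleftrightarrow>
      v \<in> {v \<in> tangent_space (big_tangent_atlas A) m. \<forall>b\<in>charts_at (big_tangent_atlas A) m.
        frechet_derivative (transition b c') (at (snd b m)) (v b) \<in> leaf_space k}"
    by (simp add: distribution_iff[OF m ca] straighten_derivative_leaf[OF z])
qed

end

theorem theorem2p1:
  fixes A :: "('m, real^'n) chart set"
    and F K :: "'m \<times> ('m, real^'n) chart_vec \<Rightarrow> real"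
  assumes "smooth_manifold A"
    and "finsler_structure A F"
    and "dual_cartan_structure A F K"
  shows "involutive (big_tangent_atlas A) (vertical_liouville_distribution A F K) \<and>
    defines_foliation (big_tangent_atlas A) (2 * CARD('n) - 1)
      (vertical_liouville_distribution A F K)"
proof -
  interpret finsler_space A F K
    by unfold_locales (use assms in \<open>simp_all add: smooth_manifold_def\<close>)
  show ?thesis
    unfolding defines_foliation_def
    using distribution_involutive foliation_leaf_atlas tangent_to_leaf_atlas by blast
qed

end
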